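(* Let $p\ge2$ be an integer not divisible by $3$. For all $\mu,\mu'\in E_p$ with $\mu\ne\mu'$, $$\sum_{y\in\mathcal W^{(+)}_p}\chi_y^{(p)}(\mu)\,\overline{\chi_y^{(p)}(\mu')}=0,$$ and hence the vectors $\chi(\mu)=\big(\chi_y^{(p)}(\mu)\big)_{y\in\mathcal W^{(+)}_p}$, $\mu\in E_p$, form a linearly independent set of common eigenvectors of the fusion matrices $N_y$, $y\in\mathcal W_p^{(+)}$, with entries $(N_y)_x^z={}^{(p)}N^z_{y,x}$.
   Context: Setting: $sl(3)$ with simple roots $\alpha_1,\alpha_2$, positive roots $\alpha_1,\alpha_2,\theta=\alpha_1+\alpha_2$, $\langle\alpha_i,\alpha_i\rangle=2$, root lattice $Q$, weight lattice $P$, fundamental weights $\bar\Lambda_1,\bar\Lambda_2$, $\bar\rho=\bar\Lambda_1+\bar\Lambda_2$, dominant weights $P_+$; triality $\tau(\lambda)=\langle\lambda,\alpha_1\rangle+2\langle\lambda,\alpha_2\rangle$ mod 3. $\overline W$ is the finite Weyl group, $\det(w)=\pm1$, shifted action $w\cdot\lambda=w(\lambda+\bar\rho)-\bar\rho$. $W=\overline W\ltimes t_Q$ is the affine Weyl group ($w\,t_\beta w^{-1}=t_{w(\beta)}$), each $y\in W$ being uniquely $y=\bar y\,t_{-\lambda}$, $\bar y\in\overline W$, $\lambda\in Q$. $\iota(\bar y\,t_{-\lambda})=3\lambda+\bar y^{-1}\cdot0$. $W^{[p]}=\overline W\ltimes t_{pQ}\subset W$. For $w\in\overline W$ let $P_{+,p}^{(w)}$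 be the set of $\lambda\in P_+$ with $\langle\lambda,\alpha_i\rangle>0$ whenever $w(\alpha_i)<0$ ($i=1,2$), and with $\langle\lambda,\theta\rangle<p$ if $w(\theta)>0$, $\langle\lambda,\theta\rangle\le p$ if $w(\theta)<0$. $\mathcal W^{(+)}_p=\{\bar y\,t_{-\lambda}\in W:\lambda\in P_{+,p}^{(\bar y)}\cap Q\}$. Let $K_\beta$ be the Kostant partition function of $sl(3)$ and $\bar m^\lambda_\nu=\sum_{w\in\overline W}\det(w)K_{w\cdot\lambda-\nu}$ for $\lambda,\nu\in P$ (the weight multiplicity of $\nu$ in the irreducible module of highest weight $\lambda$ if $\lambda\in P_+$). For $x,y,z\in\mathcal W_p^{(+)}$: ${}^{(p)}N^z_{x,y}=\sum_{w\in W^{[p]}}\det(\bar w)\,\bar m^{\iota(x)}_{\iota(zwy^{-1})}$ (a finite sum). For $\lambda,\mu\in P$: $\bar\chi^{(p)}_\lambda(\mu)=\sum_{\nu\in P}\bar m^\lambda_\nu\,e^{-\frac{2\pi i}{p}\langle\nu,\mu+\bar\rho\rangle}$. $E_p=\{\mu\in P_+:0\le\langle\mu,\alpha_i\rangle\le p-1,\ i=1,2\}$; for $\mu\in E_p$ put $\varepsilon(\mu)=1$ if $\langle\mu,\theta\rangle\le p-2$ and $\varepsilon(\mu)=-1$ otherwise, and $F(\mu)=\varepsilon(\mu)\sqrt{3+\bar\chi^{(p)}_{\bar\Lambda_1}(\mu)+\bar\chi^{(p)}_{\bar\Lambda_2}(\mu)}$ (nonnegative square root of a nonnegative real number). For $y=\bar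 y\,t_{-\lambda}\in\mathcal W_p^{(+)}$ and $\mu\in E_p$: $$\chi_y^{(p)}(\mu)=e^{-\frac{2\pi i p}{3}\tau(\mu)\tau(\lambda)}\Big(\bar\chi^{(p)}_{\lambda+\bar y^{-1}\cdot0}(\mu)+\bar\chi^{(p)}_{\lambda+\bar y^{-1}\cdot(-2\bar\Lambda_1)}(\mu)+\bar\chi^{(p)}_{\lambda+\bar y^{-1}\cdot(-2\bar\Lambda_2)}(\mu)+(F(\mu)+2)\big(\bar\chi^{(p)}_{\lambda+\bar y^{-1}\cdot(-\bar\rho)}(\mu)+\bar\chi^{(p)}_{\lambda+\bar y^{-1}\cdot(-\bar\Lambda_2)}(\mu)+\bar\chi^{(p)}_{\lambda+\bar y^{-1}\cdot(-\bar\Lambda_1)}(\mu)\big)\Big)$$ (the overall phase equals $1$ for $y\in\mathcal W^{(+)}_p$). That $\chi(\mu)$ is a common eigenvector means $\sum_{z}{}^{(p)}N^z_{y,x}\chi^{(p)}_z(\mu)=\chi_y^{(p)}(\mu)\chi_x^{(p)}(\mu)$ for all $x,y\in\mathcal W_p^{(+)}$. *)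

theory Defs
  imports Complex_Main "HOL-Library.Product_Plus" "HOL-Library.Function_Algebras"
begin

section \<open>Weights and roots of sl(3)\<close>

text \<open>The weight lattice \<open>P\<close> is the whole type: \<open>(a, b)\<close> stands for \<open>a \<Lambda>\<^sub>1 + b \<Lambda>\<^sub>2\<close>. Hence
  \<open>\<alpha>\<^sub>1 = 2 \<Lambda>\<^sub>1 - \<Lambda>\<^sub>2\<close> and \<open>\<alpha>\<^sub>2 = - \<Lambda>\<^sub>1 + 2 \<Lambda>\<^sub>2\<close>.\<close>

type_synonym weight = "int \<times> int"

definition Lam1 :: weight where "Lam1 = (1, 0)"
definition Lam2 :: weight where "Lam2 = (0, 1)"
definition rho :: weight where "rho = Lam1 + Lam2"
definition alpha1 :: weight where "alpha1 = (2, -1)"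
definition alpha2 :: weight where "alpha2 = (-1, 2)"
definition theta :: weight where "theta = alpha1 + alpha2"

definition pos_roots :: "weight set" where "pos_roots = {alpha1, alpha2, theta}"

definition smult :: "int \<Rightarrow> weight \<Rightarrow> weight" where
  "smult n v = (n * fst v, n * snd v)"

text \<open>The invariant form normalised by \<open>\<langle>\<alpha>\<^sub>i, \<alpha>\<^sub>i\<rangle> = 2\<close>; its matrix in the basis of fundamental weights
  is the inverse Cartan matrix.\<close>

definition ip :: "weight \<Rightarrow> weight \<Rightarrow> real" where
  "ip v u = of_int (2 * fst v * fst u + fst v * snd u + snd v * fst u + 2 * snd v * snd u) / 3"

lemma ip_alpha1: "ip v alpha1 = of_int (fst v)"
  and ip_alpha2: "ip v alpha2 = of_int (snd v)"
  by (simp_all add: ip_def alpha1_def alpha2_def)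

definition root_lattice :: "weight set" where
  "root_lattice = {smult a alpha1 + smult b alpha2 | a b. True}"

definition dominant :: "weight set" where
  "dominant = {v. 0 \<le> ip v alpha1 \<and> 0 \<le> ip v alpha2}"

text \<open>\<open>fst v\<close> and \<open>snd v\<close> are \<open>\<langle>v, \<alpha>\<^sub>1\<rangle>\<close> and \<open>\<langle>v, \<alpha>\<^sub>2\<rangle>\<close>.\<close>

definition triality :: "weight \<Rightarrow> int" where
  "triality v = (fst v + 2 * snd v) mod 3"

section \<open>Finite and affine Weyl groups\<close>

text \<open>Both groups are realised by their faithful actions on the weight lattice, so that the
  product is composition and \<open>w t\<^sub>\<beta> w\<^sup>-\<^sup>1 = t\<^bsub>w(\<beta>)\<^esub>\<close> holds automatically.\<close>

definition s1 :: "weight \<Rightarrow> weight" where "s1 v = v - smult (fst v) alpha1"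
definition s2 :: "weight \<Rightarrow> weight" where "s2 v = v - smult (snd v) alpha2"

inductive_set weyl :: "(weight \<Rightarrow> weight) set" where
  weyl_id: "id \<in> weyl"
| weyl_s1: "w \<in> weyl \<Longrightarrow> s1 \<circ> w \<in> weyl"
| weyl_s2: "w \<in> weyl \<Longrightarrow> s2 \<circ> w \<in> weyl"

text \<open>Determinant in the basis of fundamental weights.\<close>

definition wdet :: "(weight \<Rightarrow> weight) \<Rightarrow> int" where
  "wdet w = fst (w Lam1) * snd (w Lam2) - fst (w Lam2) * snd (w Lam1)"

definition dot :: "(weight \<Rightarrow> weight) \<Rightarrow> weight \<Rightarrow> weight" where
  "dot w v = w (v + rho) - rho"

definition transl :: "weight \<Rightarrow> weight \<Rightarrow> weight" where
  "transl b v = v + b"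

text \<open>\<open>aff_weyl p\<close> is \<open>W\<^bsup>[p]\<^esup>\<close>, and \<open>aff_weyl 1\<close> is the affine Weyl group \<open>W\<close>.\<close>

definition aff_weyl :: "int \<Rightarrow> (weight \<Rightarrow> weight) set" where
  "aff_weyl p = {w \<circ> transl (smult p b) | w b. w \<in> weyl \<and> b \<in> root_lattice}"

text \<open>The components of \<open>y = fin_part y \<circ> transl (- lat_part y)\<close>; see the lemmas
  \<open>fin_part_eq\<close> and \<open>lat_part_eq\<close> below.\<close>

definition fin_part :: "(weight \<Rightarrow> weight) \<Rightarrow> weight \<Rightarrow> weight" where
  "fin_part y v = y v - y 0"

definition lat_part :: "(weight \<Rightarrow> weight) \<Rightarrow> weight" where
  "lat_part y = - inv (fin_part y) (y 0)"

lemma weyl_linear: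
  assumes "w \<in> weyl" shows "w (u + v) = w u + w v" "w 0 = 0" "w (- v) = - w v"
proof -
  have "(\<forall>u v. w (u + v) = w u + w v) \<and> w 0 = 0 \<and> (\<forall>v. w (- v) = - w v)" using assms
    by induction (simp_all add: s1_def s2_def smult_def alpha1_def alpha2_def prod_eq_iff)
  then show "w (u + v) = w u + w v" "w 0 = 0" "w (- v) = - w v" by blast+
qed

lemma weyl_inj:
  assumes "w \<in> weyl" shows "inj w"
  using assms
proof induction
  case weyl_id then show ?case by simp
next
  case (weyl_s1 w)
  have "inj s1"
    by (rule injI) (auto simp: s1_def smult_def alpha1_def prod_eq_iff)
  then show ?case using weyl_s1.IH by (rule inj_compose)
next
  case (weyl_s2 w)
  have "inj s2"
    by (rule injI) (auto simp: s2_def smult_def alpha2_def prod_eq_iff)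
  then show ?case using weyl_s2.IH by (rule inj_compose)
qed

lemma fin_part_eq:
  assumes "w \<in> weyl" shows "fin_part (w \<circ> transl (- l)) = w"
proof
  fix v
  have "w (v + - l) - w (0 + - l) = w v" by (simp only: weyl_linear[OF assms]) simp
  then show "fin_part (w \<circ> transl (- l)) v = w v" by (simp add: fin_part_def transl_def)
qed

lemma lat_part_eq:
  assumes "w \<in> weyl" shows "lat_part (w \<circ> transl (- l)) = l"
proof -
  have "inv w (w (- l)) = - l" by (simp add: inv_f_f weyl_inj[OF assms])
  then show ?thesis
    unfolding lat_part_def fin_part_eq[OF assms] by (simp add: transl_def)
qed

definition iota :: "(weight \<Rightarrow> weight) \<Rightarrow> weight" where
  "iota y = smult 3 (lat_part y) + dot (inv (fin_part y)) 0"

section \<open>The index sets\<close>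

definition Pplus :: "int \<Rightarrow> (weight \<Rightarrow> weight) \<Rightarrow> weight set" where
  "Pplus p w = {v \<in> dominant.
     (- w alpha1 \<in> pos_roots \<longrightarrow> 0 < ip v alpha1) \<and>
     (- w alpha2 \<in> pos_roots \<longrightarrow> 0 < ip v alpha2) \<and>
     (w theta \<in> pos_roots \<longrightarrow> ip v theta < of_int p) \<and>
     (- w theta \<in> pos_roots \<longrightarrow> ip v theta \<le> of_int p)}"

definition Wplus :: "int \<Rightarrow> (weight \<Rightarrow> weight) set" where
  "Wplus p = {w \<circ> transl (- l) | w l. w \<in> weyl \<and> l \<in> Pplus p w \<inter> root_lattice}"

definition E :: "int \<Rightarrow> weight set" where
  "E p = {m \<in> dominant. ip m alpha1 \<le> of_int (p - 1) \<and> ip m alpha2 \<le> of_int (p - 1)}"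

section \<open>Multiplicities and fusion coefficients\<close>

definition kostant :: "weight \<Rightarrow> int" where
  "kostant b = int (card {(k1, k2, k3).
     b = smult (int k1) alpha1 + smult (int k2) alpha2 + smult (int k3) theta})"

definition mbar :: "weight \<Rightarrow> weight \<Rightarrow> int" where
  "mbar l n = (\<Sum>w\<in>weyl. wdet w * kostant (dot w l - n))"

text \<open>The next two sums run over infinite sets but have finitely many nonzero terms, whereas
  \<open>sum\<close> over an infinite set is \<open>0\<close> by convention; they are therefore restricted to their support.\<close>

definition fusion :: "int \<Rightarrow> (weight \<Rightarrow> weight) \<Rightarrow> (weight \<Rightarrow> weight) \<Rightarrow> (weight \<Rightarrow> weight) \<Rightarrow> int" where
  "fusion p x y z =
     (\<Sum>w \<in> {w \<in> aff_weyl p. mbar (iota x) (iota (z \<circ> w \<circ> inv y)) \<noteq> 0}.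
        wdet (fin_part w) * mbar (iota x) (iota (z \<circ> w \<circ> inv y)))"

definition chibar :: "int \<Rightarrow> weight \<Rightarrow> weight \<Rightarrow> complex" where
  "chibar p l m = (\<Sum>n \<in> {n. mbar l n \<noteq> 0}.
     of_int (mbar l n) * exp (- (2 * of_real pi * \<i> / of_int p) * of_real (ip n (m + rho))))"

section \<open>The vectors \<open>\<chi>(\<mu>)\<close>\<close>

definition eps :: "int \<Rightarrow> weight \<Rightarrow> complex" where
  "eps p m = (if ip m theta \<le> of_int (p - 2) then 1 else -1)"

text \<open>The radicand is a nonnegative real number, on which \<open>csqrt\<close> is the nonnegative root.\<close>

definition F :: "int \<Rightarrow> weight \<Rightarrow> complex" where
  "F p m = eps p m * csqrt (3 + chibar p Lam1 m + chibar p Lam2 m)"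

definition chi :: "int \<Rightarrow> (weight \<Rightarrow> weight) \<Rightarrow> weight \<Rightarrow> complex" where
  "chi p y m =
     (let l = lat_part y;
          c = (\<lambda>v. chibar p (l + dot (inv (fin_part y)) v) m)
      in exp (- (2 * of_real pi * \<i> * of_int p / 3) * of_int (triality m * triality l)) *
         (c 0 + c (smult (-2) Lam1) + c (smult (-2) Lam2)
          + (F p m + 2) * (c (- rho) + c (- Lam2) + c (- Lam1))))"

text \<open>The complex vector space with coordinates indexed by \<open>Wplus p\<close> is realised as the space of
  functions vanishing outside \<open>Wplus p\<close>.\<close>

definition chi_vec :: "int \<Rightarrow> weight \<Rightarrow> (weight \<Rightarrow> weight) \<Rightarrow> complex" where
  "chi_vec p m = (\<lambda>y. if y \<in> Wplus p then chi p y m else 0)"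

text \<open>The matrix \<open>N\<^sub>y\<close> has entry \<open>fusion p y x z\<close> in row \<open>x\<close> and column \<open>z\<close>.\<close>

definition fusion_matrix_mult ::
    "int \<Rightarrow> (weight \<Rightarrow> weight) \<Rightarrow> ((weight \<Rightarrow> weight) \<Rightarrow> complex) \<Rightarrow> (weight \<Rightarrow> weight) \<Rightarrow> complex" where
  "fusion_matrix_mult p y v x = (\<Sum>z\<in>Wplus p. of_int (fusion p y x z) * v z)"

definition cscale :: "complex \<Rightarrow> ('a \<Rightarrow> complex) \<Rightarrow> 'a \<Rightarrow> complex" where
  "cscale c f = (\<lambda>x. c * f x)"

interpretation cfun: vector_space "cscale :: complex \<Rightarrow> ('a \<Rightarrow> complex) \<Rightarrow> 'a \<Rightarrow> complex"
  by unfold_locales (auto simp: cscale_def fun_eq_iff algebra_simps)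

end

theory Submission
  imports Defs
begin

text \<open>Put \<open>\<xi> = \<mu> + \<rho>\<close> and let \<open>e\<close> be the character \<open>n \<mapsto> exp (- 2 \<pi> i \<langle>n, \<xi>\<rangle> / 3p)\<close> of the weight
  lattice, so that the exponentials entering \<open>chibar\<close> are the cubes of its values. The six weights
  \<open>w(\<rho>)\<close> fall into the three \<open>\<theta>, -\<alpha>\<^sub>1, -\<alpha>\<^sub>2\<close> with \<open>w\<close> even and their negatives with \<open>w\<close> odd. Let
  \<open>s\<close> be the sum of \<open>e\<close> over the even ones; the odd ones give the complex conjugate of \<open>s\<close>. The
  radicand of \<open>F\<close> is \<open>s\<close> times its conjugate, so \<open>F = \<kappa> s\<close> for a phase \<open>\<kappa>\<close> with \<open>\<kappa>\<^sup>2 s = cnj s\<close>.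

  Split the weights of the module with highest weight \<open>\<iota>(y)\<close> by their class modulo \<open>3P\<close>, the
  classes being represented by \<open>0\<close>, \<open>\<rho>\<close> and \<open>2\<rho>\<close>, and let \<open>p\<^sub>0, p\<^sub>1, p\<^sub>2\<close> be the corresponding
  parts of its character at \<open>e\<close>. The Weyl character formula respects this grading and becomes
  three linear relations between the \<open>p\<^sub>i\<close> with coefficients \<open>s\<close> and \<open>cnj s\<close>. They have two
  consequences. First, \<open>p\<^sub>0\<close> and \<open>p\<^sub>1 / s\<close> are the two combinations of values of \<open>chibar\<close> from
  which \<open>\<chi>\<^sub>y\<close> is built, so \<open>\<chi>\<^sub>y(\<mu>) = p\<^sub>0 + \<kappa> p\<^sub>1\<close>; this holds after multiplication by the Weyl
  denominator and then everywhere by density (\<open>graded_irr_char\<close>, \<open>chi_graded\<close>). Secondly, \<open>s (1 -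
  \<kappa>\<^sup>3) \<chi>\<^sub>y(\<mu>)\<close> is the alternating sum of \<open>e (w(\<iota>(y) + \<rho>))\<close> over the finite Weyl group, with an
  additional factor \<open>\<kappa>\<close> where \<open>w\<close> and \<open>y\<close> have opposite parity (\<open>twisted_num_graded\<close>,
  \<open>chi_twisted_num\<close>). The remaining steps rest on this closed formula.

  The factor \<open>s (1 - \<kappa>\<^sup>3)\<close> never vanishes on \<open>E p\<close> (\<open>rot_sum_F_cube\<close>). Off the walls this is so
  because the Weyl denominator at \<open>\<xi>\<close> equals \<open>s\<^sup>3 - (cnj s)\<^sup>3\<close>. On the walls \<open>s\<close> is a real number
  times a cube root of unity, and the sign \<open>\<epsilon>(\<mu>)\<close> is just the one for which \<open>\<kappa>\<^sup>3 = -1\<close>.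

  For the eigenvector equation, \<open>y \<mapsto> \<iota>(y) + \<rho>\<close> identifies \<open>W\<close> with the orbit of \<open>\<rho>\<close> under the
  affine Weyl group rescaled by \<open>3\<close>, and \<open>Wplus p\<close> with the points of that orbit inside the open
  alcove of size \<open>3p\<close>. Hence \<open>Wplus p\<close> represents the cosets of \<open>W\<close> modulo \<open>W\<^bsup>[p]\<^esup>\<close>
  (\<open>Wplus_unique\<close>, \<open>Wplus_exists\<close>). Since \<open>\<chi>\<close> is antisymmetric under \<open>W\<^bsup>[p]\<^esup>\<close> (\<open>chi_right\<close>), the
  double sum over \<open>Wplus p\<close> and \<open>W\<^bsup>[p]\<^esup>\<close> collapses to the sum of \<open>m(\<iota>(h)) \<chi>\<^bsub>hx\<^esub>\<close> over \<open>h \<in> W\<close>, and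
  the closed formula factors it (\<open>chi_mult\<close>, \<open>fusion_eigen\<close>).

  For orthogonality, the sum over \<open>Wplus p\<close> is a sixth of a sum over \<open>W\<close> modulo \<open>pQ\<close>. Summing over
  translations leaves those pairs \<open>w, w'\<close> for which \<open>w\<^sup>-\<^sup>1(\<xi>) - w'\<^sup>-\<^sup>1(\<xi>') = p \<delta>\<close> for some weight
  \<open>\<delta>\<close>. If \<open>\<delta>\<close> is outside the root lattice, the remaining sum contains the three cube roots of
  unity and vanishes. If \<open>\<delta>\<close> is in the root lattice, \<open>\<xi>\<close> and \<open>\<xi>'\<close> are equivalent under \<open>W\<^bsup>[p]\<^esup>\<close>.
  The sign \<open>\<epsilon>\<close> divides the square \<open>E p\<close> into two triangles, each of which lies in a closed alcove
  after the shift by \<open>\<rho>\<close>, so different equivalent points have opposite signs \<open>\<epsilon>\<close>, and then the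
  even and the odd part cancel (\<open>parity_sum_zero\<close>). Finally, \<open>\<chi>\<close> takes the value \<open>1\<close> at the
  identity, so every \<open>\<chi>(\<mu>)\<close> has positive norm, and linear independence follows from orthogonality.\<close>

section \<open>The finite Weyl group and the root lattice\<close>

lemma s1_pair [simp]: "s1 (a, b) = (- a, a + b)"
  by (simp add: s1_def smult_def alpha1_def)

lemma s2_pair [simp]: "s2 (a, b) = (a + b, - b)"
  by (simp add: s2_def smult_def alpha2_def)

lemma rho_eq: "rho = (1, 1)" and theta_eq: "theta = (1, 1)"
  by (simp_all add: rho_def Lam1_def Lam2_def theta_def alpha1_def alpha2_def)

lemmas weight_defs = rho_eq theta_eq alpha1_def alpha2_def Lam1_def Lam2_def zero_prod_def

text \<open>The rules of the inductive definition with \<open>id\<close> and composition kept folded.\<close>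

lemma weyl_induct [consumes 1, case_names id s1 s2]:
  assumes "w \<in> weyl" and "P id"
    and "\<And>w. w \<in> weyl \<Longrightarrow> P w \<Longrightarrow> P (s1 \<circ> w)" and "\<And>w. w \<in> weyl \<Longrightarrow> P w \<Longrightarrow> P (s2 \<circ> w)"
  shows "P w"
  using assms by (induction rule: weyl.induct) (simp_all add: comp_def id_def)

lemma weyl_eq: "weyl = {id, s1, s2, s1 \<circ> s2, s2 \<circ> s1, s1 \<circ> s2 \<circ> s1}" (is "_ = ?W")
proof
  show "weyl \<subseteq> ?W"
  proof
    fix w assume "w \<in> weyl"
    then show "w \<in> ?W"
    proof (induction rule: weyl_induct)
      case id then show ?case by simp
    next
      case (s1 w)
      have "s1 \<circ> (s1 \<circ> v) = v" for v :: "weight \<Rightarrow> weight"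
        by (simp add: fun_eq_iff s1_def smult_def alpha1_def prod_eq_iff)
      with s1.IH show ?case by (auto simp: o_assoc[symmetric])
    next
      case (s2 w)
      have "s2 \<circ> (s2 \<circ> v) = v" and "s2 \<circ> (s1 \<circ> (s2 \<circ> s1)) = s1 \<circ> s2"
        and "s2 \<circ> (s1 \<circ> s2) = s1 \<circ> s2 \<circ> s1"
        for v :: "weight \<Rightarrow> weight"
        by (simp_all add: fun_eq_iff s1_def s2_def smult_def alpha1_def alpha2_def prod_eq_iff)
      with s2.IH show ?case by (auto simp: o_assoc[symmetric])
    qed
  qed
  have "s1 \<in> weyl" "s2 \<in> weyl"
    using weyl_s1[OF weyl_id] weyl_s2[OF weyl_id] by simp_all
  then show "?W \<subseteq> weyl"
    by (auto intro: weyl_id weyl_s1 weyl_s2 simp: o_assoc[symmetric])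
qed

lemma finite_weyl [simp]: "finite weyl"
  by (simp add: weyl_eq)

lemma sum_weyl:
  "(\<Sum>w\<in>weyl. h w) = h id + h s1 + h s2 + h (s1 \<circ> s2) + h (s2 \<circ> s1) + h (s1 \<circ> s2 \<circ> s1)"
proof -
  have ne: "v \<noteq> w" if "v rho \<noteq> w rho" for v w :: "weight \<Rightarrow> weight" using that by auto
  have "distinct [id, s1, s2, s1 \<circ> s2, s2 \<circ> s1, s1 \<circ> s2 \<circ> s1]"
    by (simp, intro conjI; rule ne; simp add: rho_eq)
  then show ?thesis by (simp add: weyl_eq add.assoc)
qed

lemma card_weyl: "card weyl = 6"
  using sum_weyl[of "\<lambda>_. 1 :: nat"] by simp

lemma weyl_bij:
  assumes "w \<in> weyl" shows "bij w"
proof -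
  have b: "bij s1" "bij s2"
    by (rule o_bij[of s1], auto simp: fun_eq_iff) (rule o_bij[of s2], auto simp: fun_eq_iff)
  from assms show ?thesis unfolding weyl_eq by (elim insertE emptyE) (simp_all only: bij_comp bij_id b)
qed

lemma weyl_comp:
  assumes "v \<in> weyl" "w \<in> weyl" shows "v \<circ> w \<in> weyl"
  using assms(1)
proof (induction rule: weyl_induct)
  case id then show ?case using assms(2) by (simp only: id_comp)
next
  case (s1 v) then show ?case by (simp only: o_assoc[symmetric] weyl_s1)
next
  case (s2 v) then show ?case by (simp only: o_assoc[symmetric] weyl_s2)
qed

lemma weyl_inv:
  assumes "w \<in> weyl" shows "inv w \<in> weyl"
proof -
  have s: "inv s1 = s1" "inv s2 = s2" by (rule inv_equality; auto)+
  have b: "bij s1" "bij s2" "s1 \<in> weyl" "s2 \<in> weyl" using weyl_bij weyl_eq by auto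
  show ?thesis using assms
  proof (induction rule: weyl_induct)
    case id then show ?case by (simp only: inv_id weyl_id)
  next
    case (s1 w) then show ?case using b s by (simp only: o_inv_distrib weyl_bij weyl_comp)
  next
    case (s2 w) then show ?case using b s by (simp only: o_inv_distrib weyl_bij weyl_comp)
  qed
qed

lemma weyl_inv_apply [simp]:
  "w \<in> weyl \<Longrightarrow> w (inv w v) = v" "w \<in> weyl \<Longrightarrow> inv w (w v) = v"
  by (simp_all add: weyl_bij bij_inv_eq_iff bij_is_surj surj_f_inv_f bij_is_inj)

lemma weyl_inv_inv [simp]: "w \<in> weyl \<Longrightarrow> inv (inv w) = w"
  by (simp add: weyl_bij inv_inv_eq)

lemma weyl_diff: "w \<in> weyl \<Longrightarrow> w (u - v) = w u - w v"
  using weyl_linear(1)[of w u "- v"] weyl_linear(3)[of w v] by simp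

lemma weyl_smult: "w \<in> weyl \<Longrightarrow> w (smult k v) = smult k (w v)"
  by (cases v; auto simp: weyl_eq smult_def algebra_simps)

lemma wdet_s: "wdet (s1 \<circ> w) = - wdet w" "wdet (s2 \<circ> w) = - wdet w"
  by (cases "w Lam1"; cases "w Lam2"; simp add: wdet_def algebra_simps)+

lemma wdet_id [simp]: "wdet id = 1"
  by (simp add: wdet_def weight_defs)

lemma wdet_comp:
  assumes "v \<in> weyl" shows "wdet (v \<circ> w) = wdet v * wdet w"
  using assms
proof (induction rule: weyl_induct)
  case id then show ?case by (simp only: id_comp wdet_id)
next
  case (s1 v) then show ?case by (simp only: o_assoc[symmetric] wdet_s)
next
  case (s2 v) then show ?case by (simp only: o_assoc[symmetric] wdet_s)
qed

lemma wdet_values: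
  "wdet s1 = - 1" "wdet s2 = - 1" "wdet (s1 \<circ> s2) = 1" "wdet (s2 \<circ> s1) = 1"
  "wdet (s1 \<circ> s2 \<circ> s1) = - 1"
  by (simp_all add: wdet_def weight_defs)

lemma wdet_cases: "w \<in> weyl \<Longrightarrow> wdet w = 1 \<or> wdet w = - 1"
  unfolding weyl_eq by (elim insertE emptyE; simp only: wdet_values wdet_id simp_thms)

lemma wdet_inv [simp]: "w \<in> weyl \<Longrightarrow> wdet (inv w) = wdet w"
proof -
  assume w: "w \<in> weyl"
  have "inv w \<circ> w = id" using w by auto
  then have "wdet (inv w) * wdet w = 1" using wdet_comp[OF weyl_inv[OF w], of w] by simp
  then show ?thesis using wdet_cases[OF w] wdet_cases[OF weyl_inv[OF w]] by auto
qed

lemma sum_weyl_left: "v \<in> weyl \<Longrightarrow> (\<Sum>w\<in>weyl. h (v \<circ> w)) = (\<Sum>w\<in>weyl. h w)"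
  by (rule sum.reindex_bij_witness[of _ "\<lambda>w. inv v \<circ> w" "\<lambda>w. v \<circ> w"])
    (auto intro: weyl_comp weyl_inv simp: fun_eq_iff)

lemma sum_weyl_right: "v \<in> weyl \<Longrightarrow> (\<Sum>w\<in>weyl. h (w \<circ> v)) = (\<Sum>w\<in>weyl. h w)"
  by (rule sum.reindex_bij_witness[of _ "\<lambda>w. w \<circ> inv v" "\<lambda>w. w \<circ> v"])
    (auto intro: weyl_comp weyl_inv simp: fun_eq_iff)

lemma sum_weyl_inv: "(\<Sum>w\<in>weyl. h (inv w)) = (\<Sum>w\<in>weyl. h w)"
  by (rule sum.reindex_bij_witness[of _ inv inv]) (auto intro: weyl_inv)

lemma root_lattice_iff: "v \<in> root_lattice \<longleftrightarrow> (fst v - snd v) mod 3 = 0"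
proof
  assume "v \<in> root_lattice"
  then obtain a b where "v = smult a alpha1 + smult b alpha2" by (auto simp: root_lattice_def)
  then have "fst v - snd v = 3 * (a - b)" by (simp add: smult_def weight_defs)
  then show "(fst v - snd v) mod 3 = 0" by simp
next
  assume "(fst v - snd v) mod 3 = 0"
  then obtain k where k: "fst v - snd v = 3 * k" by (auto simp: mod_eq_0_iff_dvd)
  have "v = smult (2 * k + snd v) alpha1 + smult (k + snd v) alpha2"
    using k by (simp add: prod_eq_iff smult_def weight_defs)
  then show "v \<in> root_lattice" by (auto simp: root_lattice_def)
qed

lemma weyl_root_lattice: "w \<in> weyl \<Longrightarrow> v \<in> root_lattice \<Longrightarrow> w v \<in> root_lattice"
  unfolding root_lattice_iff by (cases v, auto simp: weyl_eq; presburger)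

lemma ip_weyl: "w \<in> weyl \<Longrightarrow> ip (w u) (w v) = ip u v"
  by (cases u; cases v; auto simp: weyl_eq ip_def; simp add: algebra_simps)

section \<open>Weight multiplicities and the Weyl character formula\<close>

text \<open>The number of ways to write \<open>A \<alpha>\<^sub>1 + B \<alpha>\<^sub>2\<close> by positive roots: the multiplicity of \<open>\<theta>\<close> ranges
  from \<open>0\<close> to \<open>min A B\<close> and determines the other two.\<close>

definition kmin :: "int \<Rightarrow> int \<Rightarrow> int" where
  "kmin A B = max 0 (min A B + 1)"

lemma kostant_kmin: "kostant (2 * A - B, 2 * B - A) = kmin A B"
proof -
  let ?S = "{(k1, k2, k3). (2 * A - B, 2 * B - A)
      = smult (int k1) alpha1 + smult (int k2) alpha2 + smult (int k3) theta}"
  let ?g = "\<lambda>k. (nat (A - int k), nat (B - int k), k)"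
  have "?S = ?g ` {k. int k \<le> min A B}"
    by (auto simp: smult_def weight_defs image_iff)
  moreover have "inj_on ?g {k. int k \<le> min A B}" by (auto simp: inj_on_def)
  moreover have "{k. int k \<le> min A B} = {..<nat (min A B + 1)}" by auto
  ultimately show ?thesis unfolding kostant_def kmin_def by (simp add: card_image)
qed

lemma kostant_nonroot:
  assumes "b \<notin> root_lattice" shows "kostant b = 0"
proof -
  have "{(k1, k2, k3). b = smult (int k1) alpha1 + smult (int k2) alpha2 + smult (int k3) theta} = {}"
  proof -
    have "smult k1 alpha1 + smult k2 alpha2 + smult k3 theta \<in> root_lattice" for k1 k2 k3
      unfolding root_lattice_iff by (simp add: smult_def weight_defs)
    then show ?thesis using assms by auto
  qed
  then show ?thesis by (simp only: kostant_def) simp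
qed

lemma root_lattice_coords:
  assumes "b \<in> root_lattice" obtains A B where "b = (2 * A - B, 2 * B - A)"
  using assms by (auto simp: root_lattice_def smult_def weight_defs algebra_simps)

text \<open>The partition function is the inverse of the Weyl denominator: its generating function is the
  product of the series \<open>1 / (1 - e(-\<alpha>))\<close> over the positive roots.\<close>

lemma kostant_inverse:
  "(\<Sum>w\<in>weyl. wdet w * kostant (b + (w rho - rho))) = (if b = 0 then 1 else 0)"
proof (cases "b \<in> root_lattice")
  case True
  then obtain A B where b: "b = (2 * A - B, 2 * B - A)" by (rule root_lattice_coords)
  have "kostant (2 * A - B - 2, 2 * B - A + 1) = kmin (A - 1) B"
    "kostant (2 * A - B + 1, 2 * B - A - 2) = kmin A (B - 1)"
    "kostant (2 * A - B, 2 * B - A - 3) = kmin (A - 1) (B - 2)"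
    "kostant (2 * A - B - 3, 2 * B - A) = kmin (A - 2) (B - 1)"
    "kostant (2 * A - B - 2, 2 * B - A - 2) = kmin (A - 2) (B - 2)"
    using kostant_kmin[of "A - 1" B] kostant_kmin[of A "B - 1"] kostant_kmin[of "A - 1" "B - 2"]
      kostant_kmin[of "A - 2" "B - 1"] kostant_kmin[of "A - 2" "B - 2"]
    by (simp_all add: algebra_simps)
  then have "(\<Sum>w\<in>weyl. wdet w * kostant (b + (w rho - rho)))
      = kmin A B - kmin (A - 1) B - kmin A (B - 1) + kmin (A - 1) (B - 2) + kmin (A - 2) (B - 1)
        - kmin (A - 2) (B - 2)"
    by (simp add: sum_weyl wdet_values b rho_eq kostant_kmin)
  also have "\<dots> = (if A = 0 \<and> B = 0 then 1 else 0)"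
    unfolding kmin_def by (simp add: min_def max_def)
  also have "(A = 0 \<and> B = 0) = (b = 0)" by (auto simp: b zero_prod_def)
  finally show ?thesis by simp
next
  case False
  have "b + (w rho - rho) \<notin> root_lattice" if "w \<in> weyl" for w
    using that False unfolding root_lattice_iff
    by (auto simp: weyl_eq rho_eq mod_eq_0_iff_dvd algebra_simps; presburger)
  moreover have "b \<noteq> 0" using False by (auto simp: root_lattice_iff)
  ultimately show ?thesis by (simp add: kostant_nonroot)
qed

text \<open>The six arguments belong to the six elements of the Weyl group. Far away from the origin one of
  three cancellations takes place. If all first coordinates dominate, only the second ones matter,
  and they agree for the pairs related by the reflection in \<open>\<alpha>\<^sub>1\<close>; symmetrically for \<open>\<alpha>\<^sub>2\<close>. If
  both coordinates are large and close to each other, all terms are affine in \<open>min\<close>, and the pairs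
  related by the reflection in \<open>\<theta>\<close> cancel up to constants whose alternating sum is \<open>0\<close>.\<close>

lemma kmin_support:
  assumes nz: "kmin A B - kmin (A - a) B - kmin A (B - b) + kmin (A - a) (B - a - b)
      + kmin (A - a - b) (B - b) - kmin (A - a - b) (B - a - b) \<noteq> 0"
    and R: "R = 2 * \<bar>a\<bar> + 2 * \<bar>b\<bar>"
  shows "- R \<le> A \<and> A \<le> 2 * R \<and> - R \<le> B \<and> B \<le> 2 * R"
proof -
  have r: "\<bar>a\<bar> \<le> R" "\<bar>b\<bar> \<le> R" "\<bar>a + b\<bar> \<le> R" using R by auto
  \<comment> \<open>otherwise all six partition numbers vanish\<close>
  have 0: "- R \<le> A \<and> - R \<le> B"
  proof (rule ccontr)
    assume "\<not> ?thesis"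
    then show False using nz r by (auto simp: kmin_def min_def max_def split: if_splits)
  qed
  \<comment> \<open>otherwise cancellation in pairs related by the reflection in \<open>\<alpha>\<^sub>1\<close> or \<open>\<alpha>\<^sub>2\<close>\<close>
  have 1: "B - A \<le> R \<and> A - B \<le> R"
  proof (rule ccontr)
    assume n: "\<not> ?thesis"
    show False
    proof (cases "B \<le> A")
      case True
      have "kmin x y = max 0 (y + 1)" if "y \<le> x" for x y using that by (simp add: kmin_def)
      moreover have "B \<le> A - a" "B - b \<le> A" "B - a - b \<le> A - a" "B - b \<le> A - a - b"
        "B - a - b \<le> A - a - b" using True n R by linarith+
      ultimately show False using nz True by simp
    next
      case False
      have "kmin x y = max 0 (x + 1)" if "x \<le> y" for x y using that by (simp add: kmin_def)
      moreover have "A \<le> B" "A - a \<le> B" "A \<le> B - b" "A - a \<le> B - a - b" "A - a - b \<le> B - b"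
        "A - a - b \<le> B - a - b" using False n R by linarith+
      ultimately show False using nz by simp
    qed
  qed
  \<comment> \<open>cancellation in pairs related by the reflection in \<open>\<theta>\<close>\<close>
  have "\<not> (R \<le> A \<and> R \<le> B)"
  proof
    assume "R \<le> A \<and> R \<le> B"
    then have "kmin A B = min A B + 1" "kmin (A - a) B = min (A - a) B + 1"
      "kmin A (B - b) = min A (B - b) + 1"
      "kmin (A - a) (B - a - b) = min (A - a) (B - a - b) + 1"
      "kmin (A - a - b) (B - b) = min (A - a - b) (B - b) + 1"
      "kmin (A - a - b) (B - a - b) = min (A - a - b) (B - a - b) + 1"
      using r unfolding kmin_def by linarith+
    moreover have "min (A - a) (B - a - b) = min A (B - b) - a"
      "min (A - a - b) (B - b) = min (A - a) B - b"
      "min (A - a - b) (B - a - b) = min A B - a - b" by linarith+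
    ultimately show False using nz by simp
  qed
  then show ?thesis using 0 1 by linarith
qed

lemma mbar_kmin:
  assumes "l = (a - 1, b - 1)"
  shows "mbar l (l - (2 * A - B, 2 * B - A)) = kmin A B - kmin (A - a) B - kmin A (B - b)
      + kmin (A - a) (B - a - b) + kmin (A - a - b) (B - b) - kmin (A - a - b) (B - a - b)"
proof -
  have "kostant (2 * A - B - 2 * a, 2 * B - A + a) = kmin (A - a) B"
    "kostant (2 * A - B + b, 2 * B - A - 2 * b) = kmin A (B - b)"
    "kostant (2 * A - B - a + b, 2 * B - A - a - 2 * b) = kmin (A - a) (B - a - b)"
    "kostant (2 * A - B - 2 * a - b, 2 * B - A + a - b) = kmin (A - a - b) (B - b)"
    "kostant (2 * A - B - a - b, 2 * B - A - a - b) = kmin (A - a - b) (B - a - b)"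
    using kostant_kmin[of "A - a" B] kostant_kmin[of A "B - b"] kostant_kmin[of "A - a" "B - a - b"]
      kostant_kmin[of "A - a - b" "B - b"] kostant_kmin[of "A - a - b" "B - a - b"]
    by (simp_all add: algebra_simps)
  moreover note kostant_kmin[of A B]
  ultimately show ?thesis
    by (simp add: mbar_def sum_weyl wdet_values assms dot_def rho_eq algebra_simps)
qed

lemma mbar_root_lattice:
  assumes "mbar l n \<noteq> 0" shows "l - n \<in> root_lattice"
proof (rule ccontr)
  assume n: "l - n \<notin> root_lattice"
  have "dot w l - n \<notin> root_lattice" if "w \<in> weyl" for w
    using that n unfolding root_lattice_iff
    by (cases l, auto simp: weyl_eq dot_def rho_eq mod_eq_0_iff_dvd algebra_simps; presburger)
  then show False using assms by (simp add: mbar_def kostant_nonroot)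
qed

text \<open>Finiteness is needed for every weight \<open>l\<close>, dominant or not. It does not follow from the
  definition alone, since each of the six translated partition functions has infinite support.\<close>

lemma mbar_finite_support: "finite {n. mbar l n \<noteq> 0}"
proof -
  define a b where "a = fst l + 1" and "b = snd l + 1"
  define R where "R = 2 * \<bar>a\<bar> + 2 * \<bar>b\<bar>"
  have "{n. mbar l n \<noteq> 0} \<subseteq> (\<lambda>(A, B). l - (2 * A - B, 2 * B - A)) ` ({- R..2 * R} \<times> {- R..2 * R})"
  proof
    fix n assume "n \<in> {n. mbar l n \<noteq> 0}"
    then have nz: "mbar l n \<noteq> 0" by simp
    obtain A B where AB: "l - n = (2 * A - B, 2 * B - A)"
      using root_lattice_coords[OF mbar_root_lattice[OF nz]] by blast
    have n: "n = l - (2 * A - B, 2 * B - A)" by (simp add: AB[symmetric])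
    have l: "l = (a - 1, b - 1)" by (simp add: a_def b_def)
    have "A \<in> {- R..2 * R} \<and> B \<in> {- R..2 * R}"
      using kmin_support[of A B a b R] nz n mbar_kmin[OF l, of A B] R_def by auto
    then show "n \<in> (\<lambda>(A, B). l - (2 * A - B, 2 * B - A)) ` ({- R..2 * R} \<times> {- R..2 * R})"
      using n by force
  qed
  then show ?thesis by (rule finite_subset) simp
qed

lemma mbar_numerator:
  "(\<Sum>v\<in>weyl. wdet v * mbar l (n - v rho)) = (\<Sum>w\<in>weyl. wdet w * (if n = w (l + rho) then 1 else 0))"
proof -
  have "(\<Sum>v\<in>weyl. wdet v * mbar l (n - v rho))
      = (\<Sum>w\<in>weyl. wdet w * (\<Sum>v\<in>weyl. wdet v * kostant ((w (l + rho) - n) + (v rho - rho))))"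
    unfolding mbar_def sum_distrib_left by (subst sum.swap) (simp add: dot_def algebra_simps)
  also have "\<dots> = (\<Sum>w\<in>weyl. wdet w * (if n = w (l + rho) then 1 else 0))"
    by (simp only: kostant_inverse) (auto intro!: sum.cong)
  finally show ?thesis .
qed

text \<open>The Weyl character formula in the form in which it is used throughout: pairing the formal
  identity with an arbitrary function \<open>f\<close> gives a statement about numbers which can be evaluated
  on characters as well as on characters restricted to a residue class.\<close>

lemma weyl_character_formula:
  fixes f :: "weight \<Rightarrow> complex"
  shows "(\<Sum>n\<in>{n. mbar l n \<noteq> 0}. of_int (mbar l n) * (\<Sum>w\<in>weyl. of_int (wdet w) * f (n + w rho)))
    = (\<Sum>w\<in>weyl. of_int (wdet w) * f (w (l + rho)))"
proof -
  let ?S = "{n. mbar l n \<noteq> 0}"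
  \<comment> \<open>a finite set that contains all weights occurring on either side\<close>
  define U where "U = (\<Union>w\<in>weyl. (\<lambda>n. n + w rho) ` ?S) \<union> (\<lambda>w. w (l + rho)) ` weyl"
  have U: "finite U" by (simp add: U_def mbar_finite_support)
  have shift: "(\<Sum>n\<in>?S. of_int (mbar l n) * f (n + w rho)) = (\<Sum>k\<in>U. of_int (mbar l (k - w rho)) * f k)"
    if "w \<in> weyl" for w
  proof -
    have "(\<Sum>n\<in>?S. of_int (mbar l n) * f (n + w rho))
        = (\<Sum>k\<in>(\<lambda>n. n + w rho) ` ?S. of_int (mbar l (k - w rho)) * f k)"
      by (subst sum.reindex) (auto simp: inj_on_def)
    also have "\<dots> = (\<Sum>k\<in>U. of_int (mbar l (k - w rho)) * f k)"
    proof (rule sum.mono_neutral_left[OF U])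
      show "(\<lambda>n. n + w rho) ` ?S \<subseteq> U" using that by (auto simp: U_def)
      have "k \<in> (\<lambda>n. n + w rho) ` ?S" if "mbar l (k - w rho) \<noteq> 0" for k
        using that by (intro image_eqI[of _ _ "k - w rho"]) auto
      then show "\<forall>k\<in>U - (\<lambda>n. n + w rho) ` ?S. of_int (mbar l (k - w rho)) * f k = 0" by fastforce
    qed
    finally show ?thesis .
  qed
  have "(\<Sum>n\<in>?S. of_int (mbar l n) * (\<Sum>w\<in>weyl. of_int (wdet w) * f (n + w rho)))
      = (\<Sum>w\<in>weyl. of_int (wdet w) * (\<Sum>n\<in>?S. of_int (mbar l n) * f (n + w rho)))"
    unfolding sum_distrib_left by (subst sum.swap) (simp add: ac_simps)
  also have "\<dots> = (\<Sum>w\<in>weyl. of_int (wdet w) * (\<Sum>k\<in>U. of_int (mbar l (k - w rho)) * f k))"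
    using shift by simp
  also have "\<dots> = (\<Sum>k\<in>U. of_int (\<Sum>w\<in>weyl. wdet w * mbar l (k - w rho)) * f k)"
    unfolding sum_distrib_left of_int_sum sum_distrib_right
    by (subst sum.swap) (simp add: ac_simps)
  also have "\<dots> = (\<Sum>w\<in>weyl. of_int (wdet w) * (\<Sum>k\<in>U. if k = w (l + rho) then f k else 0))"
    unfolding mbar_numerator sum_distrib_left of_int_sum sum_distrib_right
    by (subst sum.swap) (auto intro!: sum.cong)
  also have "\<dots> = (\<Sum>w\<in>weyl. of_int (wdet w) * f (w (l + rho)))"
    using U by (intro sum.cong refl) (auto simp: U_def)
  finally show ?thesis .
qed

section \<open>Characters of the weight lattice and the grading modulo 3P\<close>

definition is_char :: "(weight \<Rightarrow> complex) \<Rightarrow> bool" where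
  "is_char e \<longleftrightarrow> e 0 = 1 \<and> (\<forall>u v. e (u + v) = e u * e v)"

definition inv_char :: "(weight \<Rightarrow> complex) \<Rightarrow> weight \<Rightarrow> complex" where
  "inv_char e v = e (- v)"

text \<open>The sum of \<open>e\<close> over the orbit of \<open>\<theta> = \<rho>\<close> under the rotations, that is the even part of the Weyl
  denominator of \<open>e\<close>. The odd part is the same sum for \<open>inv_char e\<close>.\<close>

definition rot_sum :: "(weight \<Rightarrow> complex) \<Rightarrow> complex" where
  "rot_sum e = e theta + e (- alpha1) + e (- alpha2)"

definition parity_factor :: "complex \<Rightarrow> (weight \<Rightarrow> weight) \<Rightarrow> complex" where
  "parity_factor k w = (if wdet w = 1 then 1 else k)"

text \<open>The factor \<open>3\<close> reflects that \<open>e\<close> stands for a cube root of the character at which \<open>chibar\<close> is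
  evaluated; the same convention is used in \<open>irr_char\<close>.\<close>

definition weyl_denom :: "(weight \<Rightarrow> complex) \<Rightarrow> complex" where
  "weyl_denom e = (\<Sum>w\<in>weyl. of_int (wdet w) * e (smult 3 (w rho)))"

definition irr_char :: "weight \<Rightarrow> (weight \<Rightarrow> complex) \<Rightarrow> complex" where
  "irr_char l e = (\<Sum>n\<in>{n. mbar l n \<noteq> 0}. of_int (mbar l n) * e (smult 3 n))"

text \<open>The contribution of the weights whose first coordinate is \<open>k\<close> modulo \<open>3\<close>. On the root lattice,
  where both coordinates agree modulo \<open>3\<close>, this is the class of \<open>k \<rho>\<close> modulo \<open>3P\<close>.\<close>

definition graded_char :: "weight \<Rightarrow> (weight \<Rightarrow> complex) \<Rightarrow> int \<Rightarrow> complex" where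
  "graded_char l e k =
     (\<Sum>n\<in>{n. mbar l n \<noteq> 0}. of_int (mbar l n) * (if fst n mod 3 = k then e n else 0))"

definition graded_num :: "weight \<Rightarrow> (weight \<Rightarrow> complex) \<Rightarrow> int \<Rightarrow> complex" where
  "graded_num l e k = (\<Sum>w\<in>weyl. of_int (wdet w) *
     (if fst (w (l + rho)) mod 3 = k then e (w (l + rho)) else 0))"

text \<open>The numerator of the Weyl character formula of highest weight \<open>\<iota>(y)\<close> at \<open>e\<close>, twisted by \<open>k\<close> on
  those terms whose grade is that of \<open>2\<rho>\<close>. With \<open>k = 1\<close> it is the ordinary numerator.\<close>

definition twisted_num :: "(weight \<Rightarrow> weight) \<Rightarrow> (weight \<Rightarrow> complex) \<Rightarrow> complex \<Rightarrow> complex" where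
  "twisted_num y e k = (\<Sum>w\<in>weyl. of_int (wdet w) *
     (parity_factor k (w \<circ> fin_part y) * e (w (iota y + rho))))"

lemma char_0: "is_char e \<Longrightarrow> e 0 = 1"
  and char_add: "is_char e \<Longrightarrow> e (u + v) = e u * e v"
  unfolding is_char_def by blast+

lemma smult_add: "smult k (u + v) = smult k u + smult k v"
  and smult_diff: "smult k (u - v) = smult k u - smult k v"
  and smult_0 [simp]: "smult k 0 = 0" and smult_1 [simp]: "smult 1 v = v"
  by (simp_all add: smult_def prod_eq_iff algebra_simps)

lemma comp_char:
  assumes "is_char e" "w \<in> weyl" shows "is_char (e \<circ> w)"
  unfolding is_char_def comp_apply weyl_linear[OF assms(2)]
  using assms by (auto simp only: char_0 char_add)

text \<open>Everything is expressed by the values \<open>U, V, Z\<close> at \<open>\<theta>, -\<alpha>\<^sub>1, -\<alpha>\<^sub>2\<close>, whose product is \<open>1\<close> because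
  these weights add up to \<open>0\<close>.\<close>

lemma char_values:
  assumes e: "is_char e"
  defines "U \<equiv> e theta" and "V \<equiv> e (- alpha1)" and "Z \<equiv> e (- alpha2)"
  shows "U * V * Z = 1" "e (- theta) = V * Z" "e alpha1 = U * Z" "e alpha2 = U * V"
    "e (smult 3 theta) = U ^ 3" "e (smult 3 (- alpha1)) = V ^ 3" "e (smult 3 (- alpha2)) = Z ^ 3"
    "e (smult 3 (- theta)) = (V * Z) ^ 3" "e (smult 3 alpha1) = (U * Z) ^ 3" "e (smult 3 alpha2) = (U * V) ^ 3"
    "e (smult 3 Lam1) = U\<^sup>2 * Z" "e (smult 3 Lam2) = U\<^sup>2 * V"
    "e (smult 3 (Lam2 - Lam1)) = U * V\<^sup>2" "e (smult 3 (Lam1 - Lam2)) = U * Z\<^sup>2"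
  unfolding U_def V_def Z_def power2_eq_square power3_eq_cube
  by (simp_all only: char_add[OF e, symmetric] char_0[OF e, symmetric])
    (rule arg_cong[of _ _ e], simp add: weight_defs smult_def)+

lemma rot_sum_inv_char: "is_char e \<Longrightarrow> rot_sum (inv_char e) = e (- theta) + e alpha1 + e alpha2"
  by (simp add: rot_sum_def inv_char_def)

lemma inv_char_inv_char [simp]: "inv_char (inv_char e) = e"
  by (simp add: inv_char_def fun_eq_iff)

lemma rot_sum_comp:
  assumes "w \<in> weyl"
  shows "rot_sum (e \<circ> w) = (if wdet w = 1 then rot_sum e else rot_sum (inv_char e))"
  using assms unfolding weyl_eq
  by (elim insertE emptyE) (simp_all add: wdet_values rot_sum_def inv_char_def weight_defs)

text \<open>With the values \<open>U, V, Z\<close> of \<open>e\<close> at \<open>\<theta>, -\<alpha>\<^sub>1, -\<alpha>\<^sub>2\<close> the left sides are \<open>U (U + V + Z)\<^sup>2\<close> and \<open>U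
  (V Z + U Z + U V)\<close>. This is why the six shifts in the definition of \<open>\<chi>\<^sub>y\<close>, with their
  coefficients \<open>1\<close> and \<open>2\<close>, are the right ones.\<close>

lemma char_bracket:
  assumes e: "is_char e"
  shows "e (smult 3 rho) + e (smult 3 (rho - smult 2 Lam1)) + e (smult 3 (rho - smult 2 Lam2))
      + 2 * (e (smult 3 0) + e (smult 3 Lam1) + e (smult 3 Lam2)) = e rho * (rot_sum e)\<^sup>2"
    and "e (smult 3 0) + e (smult 3 Lam1) + e (smult 3 Lam2) = e rho * rot_sum (inv_char e)"
proof -
  note v = char_values[OF e]
  have eq: "rho = theta" "theta - smult 2 Lam1 = Lam2 - Lam1" "theta - smult 2 Lam2 = Lam1 - Lam2"
    by (simp_all add: smult_def weight_defs)
  have 1: "e (smult 3 0) = e theta * e (- alpha1) * e (- alpha2)" using v(1) char_0[OF e] by simp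
  have 2: "e theta * e (- alpha1) * e (- alpha2) = 1" by (rule v(1))
  show "e (smult 3 rho) + e (smult 3 (rho - smult 2 Lam1)) + e (smult 3 (rho - smult 2 Lam2))
      + 2 * (e (smult 3 0) + e (smult 3 Lam1) + e (smult 3 Lam2)) = e rho * (rot_sum e)\<^sup>2"
    unfolding eq v(2-) 1 rot_sum_def using 2 by algebra
  show "e (smult 3 0) + e (smult 3 Lam1) + e (smult 3 Lam2) = e rho * rot_sum (inv_char e)"
    unfolding eq v(2-) 1 rot_sum_inv_char[OF e] using 2 by algebra
qed

text \<open>The first identity is Newton's formula for the third power sums of the values \<open>U, V, Z\<close> of \<open>e\<close>
  at \<open>\<theta>, -\<alpha>\<^sub>1, -\<alpha>\<^sub>2\<close> and of their inverses. The second statement is the product form of the Weyl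
  denominator.\<close>

lemma weyl_denom_rot_sum:
  assumes e: "is_char e" shows "weyl_denom e = rot_sum e ^ 3 - rot_sum (inv_char e) ^ 3"
    and "weyl_denom e = 0 \<longleftrightarrow> e theta ^ 3 = 1 \<or> e (- alpha1) ^ 3 = 1 \<or> e (- alpha2) ^ 3 = 1"
proof -
  note v = char_values[OF e]
  define U V Z where d: "U = e theta" "V = e (- alpha1)" "Z = e (- alpha2)"
  have 1: "U * V * Z = 1" using v(1) d by simp
  have "weyl_denom e = e (smult 3 theta) - e (smult 3 alpha2) - e (smult 3 alpha1)
      + e (smult 3 (- alpha1)) + e (smult 3 (- alpha2)) - e (smult 3 (- theta))"
    by (simp add: weyl_denom_def sum_weyl wdet_values weight_defs)
  also have "\<dots> = U ^ 3 - (U * V) ^ 3 - (U * Z) ^ 3 + V ^ 3 + Z ^ 3 - (V * Z) ^ 3"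
    unfolding v(2-) d by simp
  finally have D: "weyl_denom e = U ^ 3 - (U * V) ^ 3 - (U * Z) ^ 3 + V ^ 3 + Z ^ 3 - (V * Z) ^ 3" .
  have "\<dots> = (U + V + Z) ^ 3 - (V * Z + U * Z + U * V) ^ 3" using 1 by algebra
  then show "weyl_denom e = rot_sum e ^ 3 - rot_sum (inv_char e) ^ 3"
    unfolding D rot_sum_inv_char[OF e] v(2-4) rot_sum_def[of e] d .
  have "weyl_denom e = U ^ 3 * ((1 - V ^ 3) * (1 - Z ^ 3) * (1 - (V * Z) ^ 3))"
    unfolding D using 1 by algebra
  also have "U ^ 3 * ((1 - V ^ 3) * (1 - Z ^ 3) * (1 - (V * Z) ^ 3)) = (1 - V ^ 3) * (1 - Z ^ 3) * (U ^ 3 - 1)"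
    using 1 by algebra
  finally show "weyl_denom e = 0 \<longleftrightarrow> e theta ^ 3 = 1 \<or> e (- alpha1) ^ 3 = 1 \<or> e (- alpha2) ^ 3 = 1"
    unfolding d by auto
qed

lemma irr_char_weyl:
  assumes e: "is_char e"
  shows "weyl_denom e * irr_char l e = (\<Sum>w\<in>weyl. of_int (wdet w) * e (smult 3 (w (l + rho))))"
  using weyl_character_formula[of l "\<lambda>n. e (smult 3 n)"]
  by (simp add: irr_char_def weyl_denom_def smult_add char_add[OF e] sum_distrib_left sum_distrib_right ac_simps)

text \<open>The restriction of a character to a residue class in the Weyl character formula. Multiplication
  by an even term \<open>e (w(\<rho>))\<close> raises the grade by one, by an odd term it lowers the grade by one.\<close>

lemma graded_weyl:
  assumes e: "is_char e" and k: "0 \<le> k" "k < 3"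
  shows "rot_sum e * graded_char l e ((k - 1) mod 3) - rot_sum (inv_char e) * graded_char l e ((k + 1) mod 3)
    = graded_num l e k"
proof -
  let ?f = "\<lambda>n. if fst n mod 3 = k then e n else 0"
  have inner: "(\<Sum>w\<in>weyl. of_int (wdet w) * ?f (n + w rho))
      = rot_sum e * (if fst n mod 3 = (k - 1) mod 3 then e n else 0)
        - rot_sum (inv_char e) * (if fst n mod 3 = (k + 1) mod 3 then e n else 0)" for n
  proof -
    have c: "fst n mod 3 = (k - 1) mod 3 \<longleftrightarrow> (fst n + 1) mod 3 = k"
      "(fst n - 2) mod 3 = k \<longleftrightarrow> (fst n + 1) mod 3 = k"
      "fst n mod 3 = (k + 1) mod 3 \<longleftrightarrow> (fst n - 1) mod 3 = k"
      "(fst n + 2) mod 3 = k \<longleftrightarrow> (fst n - 1) mod 3 = k"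
    proof -
      have "k = 0 \<or> k = 1 \<or> k = 2" using k by linarith
      then show "fst n mod 3 = (k - 1) mod 3 \<longleftrightarrow> (fst n + 1) mod 3 = k"
        "(fst n - 2) mod 3 = k \<longleftrightarrow> (fst n + 1) mod 3 = k"
        "fst n mod 3 = (k + 1) mod 3 \<longleftrightarrow> (fst n - 1) mod 3 = k"
        "(fst n + 2) mod 3 = k \<longleftrightarrow> (fst n - 1) mod 3 = k"
        by (elim disjE; hypsubst; simp; presburger)+
    qed
    have f: "fst (n + theta) = fst n + 1" "fst (n + alpha2) = fst n - 1" "fst (n + alpha1) = fst n + 2"
      "fst (n + - alpha1) = fst n - 2" "fst (n + - alpha2) = fst n + 1" "fst (n + - theta) = fst n - 1"
      by (simp_all add: weight_defs)
    have S: "(\<Sum>w\<in>weyl. of_int (wdet w) * ?f (n + w rho))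
      = ?f (n + theta) - ?f (n + alpha2) - ?f (n + alpha1) + ?f (n + - alpha1) + ?f (n + - alpha2)
        - ?f (n + - theta)"
      by (simp add: sum_weyl wdet_values weight_defs)
    show ?thesis
      unfolding S unfolding f c char_add[OF e] rot_sum_inv_char[OF e] rot_sum_def[of e]
      by (cases "(fst n + 1) mod 3 = k"; cases "(fst n - 1) mod 3 = k"; simp add: algebra_simps)
  qed
  have "graded_num l e k = (\<Sum>n\<in>{n. mbar l n \<noteq> 0}. of_int (mbar l n) *
      (\<Sum>w\<in>weyl. of_int (wdet w) * ?f (n + w rho)))"
    unfolding graded_num_def weyl_character_formula[of l ?f] ..
  then show ?thesis
    unfolding inner graded_char_def sum_distrib_left sum_subtractf[symmetric]
    by (simp only: right_diff_distrib mult.left_commute[of "of_int _"])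
qed

section \<open>The closed formula for the twisted numerators\<close>

lemma affE:
  assumes "y \<in> aff_weyl p"
  obtains w b where "w \<in> weyl" "b \<in> root_lattice" "y = w \<circ> transl (- smult p b)"
proof -
  obtain w b where wb: "w \<in> weyl" "b \<in> root_lattice" "y = w \<circ> transl (smult p b)"
    using assms by (auto simp: aff_weyl_def)
  have "smult p b = - smult p (- b)" by (simp add: smult_def prod_eq_iff)
  moreover have "- b \<in> root_lattice" using wb(2) unfolding root_lattice_iff by simp presburger
  ultimately show ?thesis using that wb by metis
qed

lemma aff1E:
  assumes "y \<in> aff_weyl 1"
  obtains w l where "w \<in> weyl" "l \<in> root_lattice" "y = w \<circ> transl (- l)"
  using assms by (elim affE) simp

lemma affI:
  assumes "w \<in> weyl" "b \<in> root_lattice" shows "w \<circ> transl (- smult p b) \<in> aff_weyl p"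
proof -
  have "- smult p b = smult p (- b)" by (simp add: smult_def prod_eq_iff)
  moreover have "- b \<in> root_lattice" using assms(2) unfolding root_lattice_iff by simp presburger
  then have "w \<circ> transl (smult p (- b)) \<in> aff_weyl p" using assms(1) unfolding aff_weyl_def by blast
  ultimately show ?thesis by simp
qed

lemma aff1I:
  assumes "w \<in> weyl" "b \<in> root_lattice" shows "w \<circ> transl (- b) \<in> aff_weyl 1"
  using affI[OF assms, of 1] by simp

lemma iota_rho:
  assumes "w \<in> weyl" shows "iota (w \<circ> transl (- l)) + rho = smult 3 l + inv w rho"
  by (simp add: iota_def fin_part_eq[OF assms] lat_part_eq[OF assms] dot_def)

text \<open>The commutation rule \<open>t\<^sub>\<beta> v = v t\<^bsub>v\<^sup>-\<^sup>1(\<beta>)\<^esub>\<close> in normal form.\<close>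

lemma transl_comp:
  assumes "v \<in> weyl"
  shows "(w \<circ> transl (- l)) \<circ> (v \<circ> transl (- b)) = (w \<circ> v) \<circ> transl (- (inv v l + b))"
proof -
  have "v (x + - (inv v l + b)) = v (x + - b) + - l" for x
    using weyl_diff[OF assms, of "x - b" "inv v l"] assms by (simp add: algebra_simps)
  then show ?thesis unfolding comp_def transl_def by (simp only:)
qed

lemma fst_weyl_rho:
  assumes "w \<in> weyl" shows "fst (w rho) mod 3 = (if wdet w = 1 then 1 else 2)"
  using assms unfolding weyl_eq by (elim insertE emptyE) (simp_all add: wdet_values rho_eq)

text \<open>The grade of a term of the numerator depends only on the parity of \<open>w\<close> times that of \<open>y\<close>,
  because \<open>\<iota>(y) + \<rho>\<close> is congruent modulo \<open>3Q\<close> to the image of \<open>\<rho>\<close> under the inverse of the finite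
  part of \<open>y\<close>.\<close>

lemma fst_weyl_iota:
  assumes "y \<in> aff_weyl 1" "w \<in> weyl"
  shows "fst (w (iota y + rho)) mod 3 = (if wdet (w \<circ> fin_part y) = 1 then 1 else 2)"
proof -
  obtain g l where y: "g \<in> weyl" "l \<in> root_lattice" "y = g \<circ> transl (- l)"
    using aff1E[OF assms(1)] .
  have "fst (w (iota y + rho)) = 3 * fst (w l) + fst ((w \<circ> inv g) rho)"
    using assms(2) y by (simp add: iota_rho weyl_linear weyl_smult) (simp add: smult_def)
  then have "fst (w (iota y + rho)) mod 3 = fst ((w \<circ> inv g) rho) mod 3" by presburger
  also have "\<dots> = (if wdet (w \<circ> inv g) = 1 then 1 else 2)"
    using assms(2) y(1) by (intro fst_weyl_rho weyl_comp weyl_inv)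
  also have "wdet (w \<circ> inv g) = wdet (w \<circ> fin_part y)"
    using assms(2) y by (simp add: fin_part_eq wdet_comp)
  finally show ?thesis .
qed

lemma graded_num_iota:
  assumes "y \<in> aff_weyl 1"
  shows "graded_num (iota y) e 0 = 0"
    and "graded_num (iota y) e 1 + k * graded_num (iota y) e 2 = twisted_num y e k"
  unfolding graded_num_def twisted_num_def sum_distrib_left sum.distrib[symmetric]
  by (auto intro!: sum.neutral sum.cong simp: fst_weyl_iota[OF assms] parity_factor_def)

text \<open>The numerator has no part of grade \<open>0\<close>, which gives the first relation. It is what allows \<open>p\<^sub>2\<close>
  to be eliminated in the next lemma.\<close>

lemma graded_relations:
  assumes e: "is_char e" and y: "y \<in> aff_weyl 1"
  defines "s \<equiv> rot_sum e" and "t \<equiv> rot_sum (inv_char e)"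
  defines "p \<equiv> graded_char (iota y) e"
  shows "s * p 2 = t * p 1" "s * p 0 - t * p 2 = graded_num (iota y) e 1"
    "s * p 1 - t * p 0 = graded_num (iota y) e 2"
  using graded_weyl[OF e, of 0 "iota y"] graded_weyl[OF e, of 1 "iota y"]
    graded_weyl[OF e, of 2 "iota y"] graded_num_iota(1)[OF y, of e]
  by (simp_all add: assms)

text \<open>The combination \<open>p\<^sub>0 + k p\<^sub>1\<close> solves the three relations in closed form when \<open>k\<^sup>2\<close> is the
  quotient of the odd by the even half of the denominator: then \<open>s p\<^sub>2 = k\<^sup>2 s p\<^sub>1\<close>, and \<open>p\<^sub>2\<close> can
  be eliminated.\<close>

lemma twisted_num_graded:
  assumes e: "is_char e" and y: "y \<in> aff_weyl 1" and k: "k\<^sup>2 * rot_sum e = rot_sum (inv_char e)"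
  shows "rot_sum e * (1 - k ^ 3) * (graded_char (iota y) e 0 + k * graded_char (iota y) e 1)
    = twisted_num y e k"
  unfolding graded_num_iota(2)[OF y, symmetric]
  using graded_relations[OF e y] k by algebra

text \<open>An odd element exchanges the two grades of the numerator, and with them \<open>k\<close> and \<open>1 / k\<close>.\<close>

lemma twisted_num_comp:
  assumes y: "y \<in> aff_weyl 1" and g: "g \<in> weyl" and k: "k \<noteq> 0"
  shows "wdet g = 1 \<Longrightarrow> twisted_num y (e \<circ> g) k = twisted_num y e k"
    and "wdet g = - 1 \<Longrightarrow> twisted_num y (e \<circ> g) (1 / k) = - (1 / k) * twisted_num y e k"
proof -
  obtain h l where h: "h \<in> weyl" "fin_part y = h" using aff1E[OF y] fin_part_eq by metis
  have 0: "twisted_num y e k = (\<Sum>w\<in>weyl. of_int (wdet (g \<circ> w)) *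
      (parity_factor k (g \<circ> w \<circ> h) * e ((g \<circ> w) (iota y + rho))))"
    unfolding twisted_num_def h
    using sum_weyl_left[OF g, of "\<lambda>w. of_int (wdet w) * (parity_factor k (w \<circ> h) * e (w (iota y + rho)))"]
    by simp
  have parity: "wdet (g \<circ> w \<circ> h) = wdet g * wdet (w \<circ> h)" "wdet (g \<circ> w) = wdet g * wdet w" for w
    unfolding o_assoc[symmetric] by (rule wdet_comp[OF g])+
  have "of_int (wdet w) * (parity_factor k (w \<circ> h) * (e \<circ> g) (w (iota y + rho)))
      = of_int (wdet (g \<circ> w)) * (parity_factor k (g \<circ> w \<circ> h) * e ((g \<circ> w) (iota y + rho)))"
    if "wdet g = 1" for w
    unfolding parity_factor_def parity that by simp
  then show "twisted_num y (e \<circ> g) k = twisted_num y e k" if "wdet g = 1"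
    unfolding 0 using that by (simp only: twisted_num_def h)
  have "of_int (wdet w) * (parity_factor (1 / k) (w \<circ> h) * (e \<circ> g) (w (iota y + rho)))
      = - (1 / k) * (of_int (wdet (g \<circ> w)) * (parity_factor k (g \<circ> w \<circ> h) * e ((g \<circ> w) (iota y + rho))))"
    if "wdet g = - 1" "w \<in> weyl" for w
    unfolding parity_factor_def parity that(1) using wdet_cases[OF weyl_comp[OF that(2) h(1)]] k by auto
  then show "twisted_num y (e \<circ> g) (1 / k) = - (1 / k) * twisted_num y e k" if "wdet g = - 1"
    unfolding 0 sum_distrib_left using that by (simp only: twisted_num_def h cong: sum.cong)
qed

text \<open>Right multiplication by an element of \<open>W\<^bsup>[p]\<^esup>\<close> permutes the terms of the alternating sum up to
  sign; its translation part is invisible to a character that is trivial on \<open>3pQ\<close>.\<close>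

lemma twisted_num_right:
  assumes e: "is_char e" "\<And>b. b \<in> root_lattice \<Longrightarrow> e (smult 3 (smult p b)) = 1"
    and y: "y \<in> aff_weyl 1" and v: "v \<in> aff_weyl p"
  shows "y \<circ> v \<in> aff_weyl 1" "twisted_num (y \<circ> v) e k = of_int (wdet (fin_part v)) * twisted_num y e k"
proof -
  obtain g l where g: "g \<in> weyl" "l \<in> root_lattice" "y = g \<circ> transl (- l)" using aff1E[OF y] .
  obtain u b where u: "u \<in> weyl" "b \<in> root_lattice" "v = u \<circ> transl (- smult p b)" using affE[OF v] .
  have yv: "y \<circ> v = (g \<circ> u) \<circ> transl (- (inv u l + smult p b))"
    unfolding g u by (rule transl_comp[OF u(1)])
  have gu: "g \<circ> u \<in> weyl" by (rule weyl_comp[OF g(1) u(1)])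
  have lat: "inv u l + smult p b \<in> root_lattice"
    using weyl_root_lattice[OF weyl_inv[OF u(1)] g(2)] u(2) unfolding root_lattice_iff smult_def
    by (simp add: mod_eq_0_iff_dvd) (metis (no_types, opaque_lifting) add_diff_add dvd_add dvd_mult right_diff_distrib')
  show "y \<circ> v \<in> aff_weyl 1" unfolding yv by (rule aff1I[OF gu lat])
  have inv: "inv (g \<circ> u) = inv u \<circ> inv g" using g u by (simp add: o_inv_distrib weyl_bij)
  define T where "T w = of_int (wdet w) * (parity_factor k (w \<circ> g) * e (w (smult 3 l + inv g rho)))" for w
  have T: "of_int (wdet w) * (parity_factor k (w \<circ> fin_part (y \<circ> v)) * e (w (iota (y \<circ> v) + rho)))
      = of_int (wdet (fin_part v)) * T (w \<circ> inv u)" if w: "w \<in> weyl" for w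
  proof -
    have d: "wdet w = wdet u * wdet (w \<circ> inv u)" "wdet (w \<circ> (g \<circ> u)) = wdet (w \<circ> inv u \<circ> g)"
      using wdet_cases[OF u(1)] w u(1) g(1) by (auto simp: wdet_comp weyl_comp weyl_inv simp del: comp_apply)
    have "w (iota (y \<circ> v) + rho) = (w \<circ> inv u) (smult 3 l + inv g rho) + smult 3 (smult p (w b))"
      unfolding yv iota_rho[OF gu] inv using w u(1) weyl_inv[OF u(1)]
      by (simp add: weyl_linear weyl_smult smult_add add_ac)
    moreover have "e (smult 3 (smult p (w b))) = 1" using e(2) weyl_root_lattice[OF w u(2)] .
    ultimately have "e (w (iota (y \<circ> v) + rho)) = e ((w \<circ> inv u) (smult 3 l + inv g rho))"
      by (simp add: char_add[OF e(1)])
    moreover have "fin_part (y \<circ> v) = g \<circ> u" "fin_part v = u"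
      using fin_part_eq[OF gu, of "inv u l + smult p b"] fin_part_eq[OF u(1), of "smult p b"]
      by (simp_all only: yv, simp only: u(3))
    ultimately show ?thesis unfolding T_def parity_factor_def by (simp only: d(2)) (simp add: d(1))
  qed
  have "twisted_num (y \<circ> v) e k = (\<Sum>w\<in>weyl. of_int (wdet (fin_part v)) * T (w \<circ> inv u))"
    unfolding twisted_num_def by (rule sum.cong[OF refl T])
  also have "\<dots> = of_int (wdet (fin_part v)) * (\<Sum>w\<in>weyl. T w)"
    unfolding sum_distrib_left[symmetric] sum_weyl_right[OF weyl_inv[OF u(1)]] ..
  also have "(\<Sum>w\<in>weyl. T w) = twisted_num y e k"
    unfolding twisted_num_def T_def g(3) fin_part_eq[OF g(1)] iota_rho[OF g(1)] ..
  finally show "twisted_num (y \<circ> v) e k = of_int (wdet (fin_part v)) * twisted_num y e k" .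
qed

section \<open>Graded characters in terms of irreducible characters\<close>

definition torus_char :: "real \<Rightarrow> real \<Rightarrow> weight \<Rightarrow> complex" where
  "torus_char a b n = cis (- 2 * pi * (a * of_int (fst n) + b * of_int (snd n)))"

lemma torus_char_char: "is_char (torus_char a b)"
  unfolding is_char_def torus_char_def by (simp add: cis_mult algebra_simps)

lemma torus_char_cont: "isCont (\<lambda>t. torus_char (a + t) (b + t) n) t0"
  unfolding torus_char_def cis_conv_exp by (intro continuous_intros)

text \<open>A real line with nonzero slope leaves the integers at once.\<close>

lemma eventually_not_period:
  assumes c: "c \<noteq> (0 :: real)"
  shows "\<forall>\<^sub>F t in at_right 0. cis (2 * pi * (x + c * t)) \<noteq> 1"
proof -
  have "((\<lambda>t. x + c * t) \<longlongrightarrow> x + c * 0) (at_right 0)" by (intro tendsto_intros)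
  then have lim: "((\<lambda>t. x + c * t) \<longlongrightarrow> x) (at_right 0)" by simp
  have per: "y \<in> \<int>" if "cis (2 * pi * y) = 1" for y
  proof -
    have "cos (2 * pi * y) = 1" using that by (auto simp: complex_eq_iff)
    then obtain k :: int where "2 * pi * y = of_int k * 2 * pi" by (auto simp: cos_one_2pi_int)
    then have "y = of_int k" by simp
    then show ?thesis by simp
  qed
  have non_int: "y \<notin> \<int>" if "of_int k < y" "y < of_int k + 1" for y :: real and k
    using that by (auto elim!: Ints_cases)
  have "\<forall>\<^sub>F t in at_right 0. x + c * t \<notin> \<int>"
  proof (cases "c > 0")
    case True
    have "\<forall>\<^sub>F t in at_right 0. x + c * t < of_int \<lfloor>x\<rfloor> + 1"
      by (rule order_tendstoD[OF lim]) linarith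
    moreover have "\<forall>\<^sub>F t :: real in at_right 0. t > 0" by (simp add: eventually_at_right_less)
    ultimately show ?thesis
    proof eventually_elim
      case (elim t)
      have "0 < c * t" using True elim by simp
      then have "of_int \<lfloor>x\<rfloor> < x + c * t" by linarith
      then show ?case using non_int elim by blast
    qed
  next
    case False
    have "\<forall>\<^sub>F t in at_right 0. x + c * t > of_int (\<lceil>x\<rceil> - 1)"
      by (rule order_tendstoD[OF lim]) linarith
    moreover have "\<forall>\<^sub>F t :: real in at_right 0. t > 0" by (simp add: eventually_at_right_less)
    ultimately show ?thesis
    proof eventually_elim
      case (elim t)
      have "c * t < 0" using False c elim by (simp add: mult_neg_pos)
      then have "x + c * t < of_int (\<lceil>x\<rceil> - 1) + 1" by linarith
      then show ?case using non_int elim by blast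
    qed
  qed
  then show ?thesis by (rule eventually_mono) (use per in blast)
qed

text \<open>Identities between functions of a character may be divided by the Weyl denominator although it
  has zeros: its zero set is left by moving in the direction \<open>(1, 1)\<close>, on which none of the three
  positive roots vanishes.\<close>

lemma eq_by_density:
  fixes G H :: "(weight \<Rightarrow> complex) \<Rightarrow> complex"
  assumes eq: "\<And>a b. weyl_denom (torus_char a b) \<noteq> 0 \<Longrightarrow> G (torus_char a b) = H (torus_char a b)"
    and cont: "isCont (\<lambda>t. G (torus_char (a + t) (b + t))) 0" "isCont (\<lambda>t. H (torus_char (a + t) (b + t))) 0"
  shows "G (torus_char a b) = H (torus_char a b)"
proof -
  let ?c = "\<lambda>t. torus_char (a + t) (b + t)"
  have "\<forall>\<^sub>F t in at_right 0. (cis (2 * pi * (- 3 * a - 3 * b + (- 6) * t)) \<noteq> 1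
      \<and> cis (2 * pi * (6 * a - 3 * b + 3 * t)) \<noteq> 1) \<and> cis (2 * pi * (6 * b - 3 * a + 3 * t)) \<noteq> 1"
    by (intro eventually_conj eventually_not_period) auto
  then have "\<forall>\<^sub>F t in at_right 0. G (?c t) = H (?c t)"
  proof (rule eventually_mono)
    fix t
    assume t: "(cis (2 * pi * (- 3 * a - 3 * b + (- 6) * t)) \<noteq> 1
      \<and> cis (2 * pi * (6 * a - 3 * b + 3 * t)) \<noteq> 1) \<and> cis (2 * pi * (6 * b - 3 * a + 3 * t)) \<noteq> 1"
    have "?c t theta ^ 3 = cis (2 * pi * (- 3 * a - 3 * b + (- 6) * t))"
      "?c t (- alpha1) ^ 3 = cis (2 * pi * (6 * a - 3 * b + 3 * t))"
      "?c t (- alpha2) ^ 3 = cis (2 * pi * (6 * b - 3 * a + 3 * t))"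
      by (simp_all add: torus_char_def weight_defs DeMoivre) (simp_all add: algebra_simps)
    with t have "weyl_denom (?c t) \<noteq> 0" by (simp add: weyl_denom_rot_sum(2)[OF torus_char_char])
    then show "G (?c t) = H (?c t)" by (rule eq)
  qed
  moreover have "((\<lambda>t. G (?c t)) \<longlongrightarrow> G (?c 0)) (at_right 0)" "((\<lambda>t. H (?c t)) \<longlongrightarrow> H (?c 0)) (at_right 0)"
    using cont unfolding isCont_def by (auto intro: tendsto_within_subset)
  ultimately have "((\<lambda>t. G (?c t)) \<longlongrightarrow> H (?c 0)) (at_right 0)"
    by (subst tendsto_cong) 
  then have "G (?c 0) = H (?c 0)"
    using \<open>((\<lambda>t. G (?c t)) \<longlongrightarrow> G (?c 0)) (at_right 0)\<close> by (intro tendsto_unique[of "at_right (0 :: real)"]) auto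
  then show ?thesis by simp
qed

lemma irr_char_cont: "isCont (\<lambda>t. irr_char l (torus_char (a + t) (b + t))) t0"
  unfolding irr_char_def by (intro continuous_intros torus_char_cont)

lemma graded_char_cont: "isCont (\<lambda>t. graded_char l (torus_char (a + t) (b + t)) k) t0"
proof -
  have "isCont (\<lambda>t. if fst n mod 3 = k then torus_char (a + t) (b + t) n else 0) t0" for n
    by (cases "fst n mod 3 = k") (simp_all add: torus_char_cont)
  then show ?thesis unfolding graded_char_def by (intro continuous_intros)
qed

text \<open>The relations of \<open>graded_relations\<close> solved for \<open>p\<^sub>0\<close> and \<open>p\<^sub>1\<close> by Cramer's rule; their
  determinant is the Weyl denominator \<open>s\<^sup>3 - t\<^sup>3\<close>.\<close>

lemma graded_denom:
  assumes e: "is_char e" and y: "y \<in> aff_weyl 1"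
  shows "weyl_denom e * graded_char (iota y) e 0
      = (rot_sum e)\<^sup>2 * graded_num (iota y) e 1 + (rot_sum (inv_char e))\<^sup>2 * graded_num (iota y) e 2"
    and "weyl_denom e * graded_char (iota y) e 1
      = rot_sum e * (rot_sum (inv_char e) * graded_num (iota y) e 1 + rot_sum e * graded_num (iota y) e 2)"
  unfolding weyl_denom_rot_sum(1)[OF e] using graded_relations[OF e y] by algebra+

lemma graded_num_sum:
  assumes y: "y \<in> aff_weyl 1"
  shows "A * graded_num (iota y) e 1 + B * graded_num (iota y) e 2 = (\<Sum>w\<in>weyl. of_int (wdet w) *
    ((if wdet (w \<circ> fin_part y) = 1 then A else B) * e (w (iota y + rho))))"
  unfolding graded_num_def sum_distrib_left sum.distrib[symmetric]
  by (rule sum.cong) (auto simp: fst_weyl_iota[OF y])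

text \<open>The graded parts of the character of highest weight \<open>\<iota>(y)\<close> are themselves combinations of the
  functions \<open>irr_char\<close>, namely those in the definition of \<open>\<chi>\<^sub>y\<close>. Both sides have the same
  numerator: on the right the six shifts contribute the brackets of \<open>char_bracket\<close>, transported by
  \<open>w\<close> and the finite part of \<open>y\<close>.\<close>

lemma graded_irr_char:
  fixes a b :: real
  assumes g: "g \<in> weyl" and l: "l \<in> root_lattice"
  defines "c \<equiv> \<lambda>v. irr_char (l + dot (inv g) v)"
  defines "e \<equiv> torus_char a b"
  shows "graded_char (iota (g \<circ> transl (- l))) e 0 = c 0 e + c (smult (-2) Lam1) e + c (smult (-2) Lam2) e
      + 2 * (c (- rho) e + c (- Lam2) e + c (- Lam1) e)"
    and "graded_char (iota (g \<circ> transl (- l))) e 1 = rot_sum e * (c (- rho) e + c (- Lam2) e + c (- Lam1) e)"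
proof -
  let ?y = "g \<circ> transl (- l)"
  note y = aff1I[OF g l]
  have c: "weyl_denom e * c v e = (\<Sum>w\<in>weyl. of_int (wdet w) *
      (e (smult 3 (w l)) * e (smult 3 ((w \<circ> inv g) (v + rho)))))" if "is_char e" for v e
    unfolding c_def irr_char_weyl[OF that]
  proof (rule sum.cong[OF refl])
    fix w assume w: "w \<in> weyl"
    have "smult 3 (w (l + dot (inv g) v + rho)) = smult 3 (w l) + smult 3 ((w \<circ> inv g) (v + rho))"
      by (simp add: dot_def weyl_linear(1)[OF w] smult_add[symmetric])
    then show "of_int (wdet w) * e (smult 3 (w (l + dot (inv g) v + rho)))
        = of_int (wdet w) * (e (smult 3 (w l)) * e (smult 3 ((w \<circ> inv g) (v + rho))))"
      by (simp only: char_add[OF that])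
  qed
  have br: "\<And>w. w \<in> weyl \<Longrightarrow> e (smult 3 (w l)) * e ((w \<circ> inv g) rho) = e (w (iota ?y + rho))" if "is_char e" for e
    unfolding iota_rho[OF g] by (simp add: weyl_linear weyl_smult char_add[OF that])
  have sgn: "wdet (w \<circ> inv g) = wdet (w \<circ> fin_part ?y)" if "w \<in> weyl" for w
    using that g by (simp only: fin_part_eq wdet_comp wdet_inv)
  have arg: "- rho + rho = 0" "- Lam2 + rho = Lam1" "- Lam1 + rho = Lam2" "0 + rho = rho"
    "smult (-2) Lam1 + rho = rho - smult 2 Lam1" "smult (-2) Lam2 + rho = rho - smult 2 Lam2"
    by (simp_all add: weight_defs smult_def)
  have gen2: "d * (X * (m * r)) = d * (m * a) + d * (m * b) + d * (m * c) +
        (2 * (d * (m * u)) + 2 * (d * (m * v)) + 2 * (d * (m * z)))"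
    if "X = S" "a + b + c + 2 * (u + v + z) = r * S" for d X m r a b c u v z S :: complex
  proof -
    have "d * (X * (m * r)) = d * m * (a + b + c + 2 * (u + v + z))" unfolding that by (simp only: ac_simps)
    then show ?thesis by (simp only: distrib_left mult.assoc mult.left_commute[of _ 2])
  qed
  have 0: "weyl_denom e * graded_char (iota ?y) e 0 = weyl_denom e * (c 0 e + c (smult (-2) Lam1) e
      + c (smult (-2) Lam2) e + 2 * (c (- rho) e + c (- Lam2) e + c (- Lam1) e))" if e: "is_char e" for e
    unfolding graded_denom(1)[OF e y] graded_num_sum[OF y] distrib_left mult.left_commute[of _ 2]
      c[OF e] sum.distrib[symmetric] sum_distrib_left
  proof (rule sum.cong[OF refl])
    fix w assume w: "w \<in> weyl"
    have h: "w \<circ> inv g \<in> weyl" using weyl_comp[OF w weyl_inv[OF g]] .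
    have i: "(if wdet (w \<circ> fin_part ?y) = 1 then (rot_sum e)\<^sup>2 else (rot_sum (inv_char e))\<^sup>2) = (rot_sum (e \<circ> (w \<circ> inv g)))\<^sup>2"
      unfolding rot_sum_comp[OF h] sgn[OF w] by simp
    show "of_int (wdet w) * ((if wdet (w \<circ> fin_part ?y) = 1 then (rot_sum e)\<^sup>2 else (rot_sum (inv_char e))\<^sup>2)
          * e (w (iota ?y + rho)))
      = of_int (wdet w) * (e (smult 3 (w l)) * e (smult 3 ((w \<circ> inv g) (0 + rho))))
       + of_int (wdet w) * (e (smult 3 (w l)) * e (smult 3 ((w \<circ> inv g) (smult (-2) Lam1 + rho))))
       + of_int (wdet w) * (e (smult 3 (w l)) * e (smult 3 ((w \<circ> inv g) (smult (-2) Lam2 + rho))))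
       + (2 * (of_int (wdet w) * (e (smult 3 (w l)) * e (smult 3 ((w \<circ> inv g) (- rho + rho)))))
       + 2 * (of_int (wdet w) * (e (smult 3 (w l)) * e (smult 3 ((w \<circ> inv g) (- Lam2 + rho)))))
       + 2 * (of_int (wdet w) * (e (smult 3 (w l)) * e (smult 3 ((w \<circ> inv g) (- Lam1 + rho))))))"
      unfolding arg br[OF e w, symmetric]
      using gen2[OF i char_bracket(1)[OF comp_char[OF e h], unfolded comp_apply[of e] weyl_smult[OF h], folded comp_apply[of e]]]
      by (simp only: comp_apply[of e])
  qed
  have gen: "d * (X * (m * r)) = d * (m * u) + d * (m * v) + d * (m * z)"
    if "X = S" "u + v + z = r * S" for d X m r u v z S :: complex
  proof -
    have "d * (X * (m * r)) = d * m * (u + v + z)" unfolding that by (simp only: ac_simps)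
    then show ?thesis by (simp only: distrib_left mult.assoc)
  qed
  have 1: "weyl_denom e * graded_char (iota ?y) e 1 = weyl_denom e * (rot_sum e *
      (c (- rho) e + c (- Lam2) e + c (- Lam1) e))" if e: "is_char e" for e
  proof -
    have "rot_sum (inv_char e) * graded_num (iota ?y) e 1 + rot_sum e * graded_num (iota ?y) e 2
      = weyl_denom e * (c (- rho) e + c (- Lam2) e + c (- Lam1) e)"
      unfolding graded_num_sum[OF y] distrib_left c[OF e] sum.distrib[symmetric]
    proof (rule sum.cong[OF refl])
      fix w assume w: "w \<in> weyl"
      have h: "w \<circ> inv g \<in> weyl" using weyl_comp[OF w weyl_inv[OF g]] .
      have "inv_char (e \<circ> (w \<circ> inv g)) = inv_char e \<circ> (w \<circ> inv g)"
        unfolding inv_char_def comp_def weyl_linear(3)[OF h, unfolded comp_def] ..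
      then have i: "(if wdet (w \<circ> fin_part ?y) = 1 then rot_sum (inv_char e) else rot_sum e) = rot_sum (inv_char (e \<circ> (w \<circ> inv g)))"
        unfolding sgn[OF w, symmetric] by (simp only: rot_sum_comp[OF h] inv_char_inv_char)
      then show "of_int (wdet w) * ((if wdet (w \<circ> fin_part ?y) = 1 then rot_sum (inv_char e) else rot_sum e)
          * e (w (iota ?y + rho)))
      = of_int (wdet w) * (e (smult 3 (w l)) * e (smult 3 ((w \<circ> inv g) (- rho + rho))))
       + of_int (wdet w) * (e (smult 3 (w l)) * e (smult 3 ((w \<circ> inv g) (- Lam2 + rho))))
       + of_int (wdet w) * (e (smult 3 (w l)) * e (smult 3 ((w \<circ> inv g) (- Lam1 + rho))))"
        unfolding arg br[OF e w, symmetric]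
        using gen[OF i char_bracket(2)[OF comp_char[OF e h], unfolded comp_apply[of e] weyl_smult[OF h], folded comp_apply[of e]]]
        by (simp only: comp_apply[of e])
    qed
    then show ?thesis unfolding graded_denom(2)[OF e y] by algebra
  qed
  have cont: "isCont (\<lambda>t. c v (torus_char (a + t) (b + t))) 0" for v
    unfolding c_def by (rule irr_char_cont)
  show "graded_char (iota ?y) e 0 = c 0 e + c (smult (-2) Lam1) e + c (smult (-2) Lam2) e
      + 2 * (c (- rho) e + c (- Lam2) e + c (- Lam1) e)"
    unfolding e_def
  proof (rule eq_by_density[of "\<lambda>e. graded_char (iota ?y) e 0" "\<lambda>e. c 0 e + c (smult (-2) Lam1) e
      + c (smult (-2) Lam2) e + 2 * (c (- rho) e + c (- Lam2) e + c (- Lam1) e)"])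
    fix a b assume "weyl_denom (torus_char a b) \<noteq> 0"
    then show "graded_char (iota ?y) (torus_char a b) 0 = c 0 (torus_char a b) + c (smult (-2) Lam1) (torus_char a b)
      + c (smult (-2) Lam2) (torus_char a b) + 2 * (c (- rho) (torus_char a b) + c (- Lam2) (torus_char a b)
      + c (- Lam1) (torus_char a b))"
      using 0[OF torus_char_char, of a b] by (metis mult_left_cancel)
  qed (intro continuous_intros cont graded_char_cont)+
  show "graded_char (iota ?y) e 1 = rot_sum e * (c (- rho) e + c (- Lam2) e + c (- Lam1) e)"
    unfolding e_def
  proof (rule eq_by_density[of "\<lambda>e. graded_char (iota ?y) e 1"
        "\<lambda>e. rot_sum e * (c (- rho) e + c (- Lam2) e + c (- Lam1) e)"])
    fix a b assume "weyl_denom (torus_char a b) \<noteq> 0"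
    then show "graded_char (iota ?y) (torus_char a b) 1 = rot_sum (torus_char a b) *
        (c (- rho) (torus_char a b) + c (- Lam2) (torus_char a b) + c (- Lam1) (torus_char a b))"
      using 1[OF torus_char_char, of a b] by (metis mult_left_cancel)
  qed (unfold rot_sum_def, (intro continuous_intros cont graded_char_cont torus_char_cont)+)
qed

text \<open>Used to read off the exponents of the numerators below as monomials.\<close>

lemma char_monomial:
  assumes e: "is_char e"
  shows "e (int i - 2 * int j + int k, int i + int j - 2 * int k) = e theta ^ i * e (- alpha1) ^ j * e (- alpha2) ^ k"
proof -
  have pow: "e (smult (int n) v) = e v ^ n" for n v
  proof (induction n)
    case 0 show ?case using char_0[OF e] by (simp add: smult_def zero_prod_def)
  next
    case (Suc n)
    have "smult (int (Suc n)) v = v + smult (int n) v" by (simp add: smult_def prod_eq_iff algebra_simps)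
    then show ?case using Suc by (simp add: char_add[OF e])
  qed
  have "(int i - 2 * int j + int k, int i + int j - 2 * int k)
      = smult (int i) theta + smult (int j) (- alpha1) + smult (int k) (- alpha2)"
    by (simp add: smult_def weight_defs)
  then show ?thesis by (simp only: char_add[OF e] pow)
qed

text \<open>The three weights of each fundamental module are, after multiplication by \<open>3\<close>, the differences
  of \<open>\<theta>, -\<alpha>\<^sub>1, -\<alpha>\<^sub>2\<close>. So this is the expansion of the product of \<open>s\<close> with its conjugate, whose
  three diagonal terms give the constant \<open>3\<close>.\<close>

lemma fundamental_sum:
  "3 + irr_char Lam1 (torus_char a b) + irr_char Lam2 (torus_char a b)
    = rot_sum (torus_char a b) * rot_sum (inv_char (torus_char a b))"
proof -
  have *: "weyl_denom e * (3 + irr_char Lam1 e + irr_char Lam2 e) = weyl_denom e * (rot_sum e * rot_sum (inv_char e))"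
    if e: "is_char e" for e
  proof -
    define U V Z where d: "U = e theta" "V = e (- alpha1)" "Z = e (- alpha2)"
    note m = char_monomial[OF e, folded d]
    have 1: "U * V * Z = 1" using char_values(1)[OF e] d by simp
    have 2: "weyl_denom e = U ^ 3 - (U * V) ^ 3 - (U * Z) ^ 3 + V ^ 3 + Z ^ 3 - (V * Z) ^ 3"
      using m[of 3 0 0] m[of 3 3 0] m[of 3 0 3] m[of 0 3 0] m[of 0 0 3] m[of 0 3 3]
      by (simp add: weyl_denom_def sum_weyl wdet_values weight_defs smult_def power_mult_distrib)
    have 3: "weyl_denom e * irr_char Lam1 e
        = U^5 * Z - U^4 * V^5 - U^5 * Z^4 + U * V^5 + V * Z^5 - V^4 * Z^5"
      using m[of 5 0 1] m[of 4 5 0] m[of 5 0 4] m[of 1 5 0] m[of 0 1 5] m[of 0 4 5]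
      by (simp add: irr_char_weyl[OF e] sum_weyl wdet_values weight_defs smult_def)
    have 4: "weyl_denom e * irr_char Lam2 e
        = U^5 * V - U^4 * Z^5 - U^5 * V^4 + U * Z^5 + Z * V^5 - Z^4 * V^5"
      using m[of 5 1 0] m[of 4 0 5] m[of 5 4 0] m[of 1 0 5] m[of 0 5 1] m[of 0 5 4]
      by (simp add: irr_char_weyl[OF e] sum_weyl wdet_values weight_defs smult_def)
    have 5: "rot_sum e * rot_sum (inv_char e) = (U + V + Z) * (V * Z + U * Z + U * V)"
      unfolding rot_sum_inv_char[OF e] char_values(2-4)[OF e] rot_sum_def[of e] d ..
    show ?thesis unfolding distrib_left 3 4 5 unfolding 2 using 1 by algebra
  qed
  show ?thesis
  proof (rule eq_by_density[of "\<lambda>e. 3 + irr_char Lam1 e + irr_char Lam2 e" "\<lambda>e. rot_sum e * rot_sum (inv_char e)"])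
    fix a b assume "weyl_denom (torus_char a b) \<noteq> 0"
    then show "3 + irr_char Lam1 (torus_char a b) + irr_char Lam2 (torus_char a b)
        = rot_sum (torus_char a b) * rot_sum (inv_char (torus_char a b))"
      using *[OF torus_char_char, of a b] by (metis mult_left_cancel)
  qed (unfold rot_sum_def inv_char_def, (intro continuous_intros irr_char_cont torus_char_cont)+)
qed

section \<open>The closed formula for \<open>\<chi>\<close>\<close>

text \<open>The character \<open>e\<close> belonging to \<open>x = \<mu> + \<rho>\<close>. The denominator \<open>3p\<close> instead of \<open>p\<close> makes its cubes
  the exponentials in \<open>chibar\<close>.\<close>

definition eval_char :: "int \<Rightarrow> weight \<Rightarrow> weight \<Rightarrow> complex" where
  "eval_char p x n = cis (- 2 * pi * ip n x / (3 * of_int p))"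

lemma eval_char_torus:
  "eval_char p x = torus_char (of_int (2 * fst x + snd x) / (9 * of_int p)) (of_int (fst x + 2 * snd x) / (9 * of_int p))"
  unfolding eval_char_def torus_char_def
  by (rule ext, rule arg_cong[of _ _ cis]) (cases "p = 0"; simp add: ip_def field_simps)

lemma eval_char_char: "is_char (eval_char p x)"
  unfolding eval_char_torus by (rule torus_char_char)

lemma eval_char_weyl:
  assumes "w \<in> weyl" shows "eval_char p x (w n) = eval_char p (inv w x) n"
  using ip_weyl[OF assms, of n "inv w x"] assms by (simp add: eval_char_def)

lemma ip_minus: "ip (- v) u = - ip v u"
  by (simp add: ip_def field_simps)

lemma inv_char_eval: "inv_char (eval_char p x) n = cnj (eval_char p x n)"
  by (simp add: inv_char_def eval_char_def cis_cnj ip_minus)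

lemma rot_sum_inv_eval: "rot_sum (inv_char (eval_char p x)) = cnj (rot_sum (eval_char p x))"
  unfolding rot_sum_def inv_char_eval by simp

lemma chibar_irr_char: "chibar p l m = irr_char l (eval_char p (m + rho))"
proof -
  have "exp (- (2 * of_real pi * \<i> / of_int p) * of_real (ip n (m + rho))) = eval_char p (m + rho) (smult 3 n)" for n
  proof -
    have "ip (smult 3 n) (m + rho) = 3 * ip n (m + rho)"
      by (simp add: ip_def smult_def algebra_simps)
    then show ?thesis
      unfolding eval_char_def cis_conv_exp by (simp add: field_simps)
  qed
  then show ?thesis by (simp add: chibar_def irr_char_def)
qed

lemma triality_root: "l \<in> root_lattice \<Longrightarrow> triality l = 0"
  unfolding root_lattice_iff triality_def by presburger

lemma F_eq: "F p m = eps p m * of_real (cmod (rot_sum (eval_char p (m + rho))))"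
proof -
  let ?s = "rot_sum (eval_char p (m + rho))"
  have "3 + chibar p Lam1 m + chibar p Lam2 m = ?s * cnj ?s"
    unfolding chibar_irr_char rot_sum_inv_eval[symmetric] unfolding eval_char_torus by (rule fundamental_sum)
  also have "\<dots> = of_real ((cmod ?s)\<^sup>2)" by (rule complex_norm_square[symmetric])
  also have "csqrt \<dots> = of_real (cmod ?s)" by (subst csqrt_of_real_nonneg) simp_all
  finally show ?thesis unfolding F_def by simp
qed

text \<open>The phase \<open>\<kappa>\<close> with \<open>F = \<kappa> s\<close>; it has absolute value \<open>1\<close> because \<open>F\<close> is plus or minus the
  absolute value of \<open>s\<close>, which does not vanish on \<open>E p\<close>.\<close>

definition twist_phase :: "int \<Rightarrow> weight \<Rightarrow> complex" where
  "twist_phase p m = F p m / rot_sum (eval_char p (m + rho))"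

text \<open>Shifted by \<open>\<rho>\<close>, the set \<open>E p\<close> is a full set of representatives of the weights modulo \<open>p\<close>.\<close>

lemma E_iff: "m \<in> E p \<longleftrightarrow> fst (m + rho) \<in> {1..p} \<and> snd (m + rho) \<in> {1..p}"
  unfolding E_def dominant_def mem_Collect_eq ip_alpha1 ip_alpha2 of_int_le_iff of_int_0_le_iff
  by (auto simp: rho_eq)

lemma eps_eq: "eps p m = (if fst (m + rho) + snd (m + rho) \<le> p then 1 else - 1)"
proof -
  have "ip m theta = of_int (fst m + snd m)" by (simp add: ip_def theta_eq)
  then have "ip m theta \<le> of_int (p - 2) \<longleftrightarrow> fst m + snd m \<le> p - 2" by (simp only: of_int_le_iff)
  then show ?thesis by (simp add: eps_def rho_eq)
qed

lemma eval_char_values: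
  "eval_char p x theta = cis (- 2 * pi * of_int (fst x + snd x) / (3 * of_int p))"
  "eval_char p x (- alpha1) = cis (2 * pi * of_int (fst x) / (3 * of_int p))"
  "eval_char p x (- alpha2) = cis (2 * pi * of_int (snd x) / (3 * of_int p))"
  unfolding eval_char_def
  by (rule arg_cong[of _ _ cis], cases "p = 0"; simp add: ip_def weight_defs field_simps)+

lemma cis_sum_cnj: "1 + cis t + cis (- t) = of_real (1 + 2 * cos t)"
  by (simp add: complex_eq_iff)

lemma cis_two_pi_shift: "cis (t + 2 * pi) = cis t" "cis (t - 2 * pi) = cis t"
  by (simp_all add: complex_eq_iff sin_diff cos_diff)

lemma cis_thirds_cube: "cis (2 * pi / 3) ^ 3 = 1" "cis (- (2 * pi / 3)) ^ 3 = 1"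
  by (simp_all add: DeMoivre complex_eq_iff)

lemma cos_gt_minus_half: "\<bar>t\<bar> < 2 * pi / 3 \<Longrightarrow> 1 + 2 * cos t > 0"
proof -
  assume t: "\<bar>t\<bar> < 2 * pi / 3"
  have "cos (2 * pi / 3) < cos \<bar>t\<bar>" using t by (intro cos_monotone_0_pi) auto
  then show ?thesis by (simp add: cos_120 abs_if split: if_splits)
qed

lemma cos_lt_minus_half: "2 * pi / 3 < t \<Longrightarrow> t < 4 * pi / 3 \<Longrightarrow> 1 + 2 * cos t < 0"
proof -
  assume t: "2 * pi / 3 < t" "t < 4 * pi / 3"
  have "1 < 2 * cos (t - pi)"
  proof -
    have "\<bar>t - pi\<bar> < pi / 3" using t unfolding abs_less_iff by linarith
    then have "cos (pi / 3) < cos \<bar>t - pi\<bar>" by (intro cos_monotone_0_pi) auto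
    then show ?thesis by (simp add: cos_60 abs_if split: if_splits)
  qed
  then show ?thesis by (simp add: cos_diff)
qed

lemma cis_period_dvd:
  assumes "p > 0" "cis (2 * pi * of_int k / of_int p) = 1" shows "p dvd k"
proof -
  have "cos (2 * pi * of_int k / of_int p) = 1" using assms(2) by (auto simp: complex_eq_iff)
  then obtain j :: int where "2 * pi * of_int k / of_int p = of_int j * 2 * pi" by (auto simp: cos_one_2pi_int)
  then have "of_int k = of_int j * (of_int p :: real)" using assms(1) by (simp add: field_simps)
  then have "k = j * p" by (simp only: of_int_mult[symmetric] of_int_eq_iff)
  then show ?thesis by simp
qed

text \<open>On an edge of the square one of the three terms of \<open>s\<close> is a primitive cube root of unity and the
  other two are conjugate up to the same root.\<close>

lemma rot_sum_wall_edge: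
  assumes p: "p > 0" and x: "x = (p, b) \<or> x = (b, p)" "1 \<le> b" "b \<le> p"
  shows "\<exists>r > 0. rot_sum (eval_char p x) = cis (2 * pi / 3) * of_real r"
proof -
  define t where "t = 2 * pi * of_int b / (3 * of_int p)"
  have pp: "of_int p > (0 :: real)" using p by simp
  have V: "2 * pi * of_int p / (3 * of_int p) = 2 * pi / 3" using p by simp
  have U: "- 2 * pi * of_int (p + b) / (3 * of_int p) = 2 * pi / 3 + - (t - 2 * pi / 3) - 2 * pi"
    using p by (simp add: t_def field_simps)
  have U2: "- 2 * pi * of_int (b + p) / (3 * of_int p) = 2 * pi / 3 + - (t - 2 * pi / 3) - 2 * pi"
    using U by (simp only: add.commute)
  have "rot_sum (eval_char p x) = cis (2 * pi / 3 + - (t - 2 * pi / 3) - 2 * pi) + cis (2 * pi / 3) + cis t"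
    using x(1) unfolding rot_sum_def eval_char_values
    by (elim disjE; hypsubst; simp only: fst_conv snd_conv U U2 V t_def[symmetric] add_ac)
  also have "\<dots> = cis (2 * pi / 3) * (1 + cis (t - 2 * pi / 3) + cis (- (t - 2 * pi / 3)))"
    unfolding cis_two_pi_shift by (simp add: distrib_left cis_mult)
  finally have "rot_sum (eval_char p x) = cis (2 * pi / 3) * of_real (1 + 2 * cos (t - 2 * pi / 3))"
    unfolding cis_sum_cnj .
  moreover have "1 + 2 * cos (t - 2 * pi / 3) > 0"
  proof (rule cos_gt_minus_half)
    have "0 < t" using x p by (simp add: t_def)
    moreover have "t \<le> 2 * pi / 3" using x pp unfolding t_def
      by (simp add: field_simps)
    ultimately show "\<bar>t - 2 * pi / 3\<bar> < 2 * pi / 3" by simp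
  qed
  ultimately show ?thesis by blast
qed

text \<open>On the diagonal the situation is the same as on the edges, except that now the real factor is
  negative. The change of sign is compensated by \<open>\<epsilon>\<close>.\<close>

lemma rot_sum_wall_diagonal:
  assumes p: "p > 0" and x: "x = (a, p - a)" "1 \<le> a" "a < p"
  shows "\<exists>r < 0. rot_sum (eval_char p x) = cis (- (2 * pi / 3)) * of_real r"
proof -
  define t where "t = 2 * pi * of_int a / (3 * of_int p)"
  have pp: "of_int p > (0 :: real)" using p by simp
  have U: "- 2 * pi * of_int (a + (p - a)) / (3 * of_int p) = - (2 * pi / 3)" using p by simp
  have Z: "2 * pi * of_int (p - a) / (3 * of_int p) = - (2 * pi / 3) + - (t + 2 * pi / 3) + 2 * pi"
    using p by (simp add: t_def field_simps)
  have "rot_sum (eval_char p x) = cis (- (2 * pi / 3)) + cis t + cis (- (2 * pi / 3) + - (t + 2 * pi / 3) + 2 * pi)"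
    unfolding rot_sum_def eval_char_values x fst_conv snd_conv U Z t_def ..
  also have "\<dots> = cis (- (2 * pi / 3)) * (1 + cis (t + 2 * pi / 3) + cis (- (t + 2 * pi / 3)))"
    unfolding cis_two_pi_shift by (simp add: distrib_left cis_mult)
  finally have "rot_sum (eval_char p x) = cis (- (2 * pi / 3)) * of_real (1 + 2 * cos (t + 2 * pi / 3))"
    unfolding cis_sum_cnj .
  moreover have "1 + 2 * cos (t + 2 * pi / 3) < 0"
  proof (rule cos_lt_minus_half)
    have "0 < t" using x p by (simp add: t_def)
    moreover have "t < 2 * pi / 3" using x pp unfolding t_def
      by (simp add: field_simps)
    ultimately show "2 * pi / 3 < t + 2 * pi / 3" "t + 2 * pi / 3 < 4 * pi / 3" by simp_all
  qed
  ultimately show ?thesis by blast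
qed

text \<open>The second statement says that \<open>\<kappa>\<^sup>3\<close> is different from \<open>1\<close>.\<close>

lemma rot_sum_F_cube:
  assumes p: "p \<ge> 2" and m: "m \<in> E p"
  defines "s \<equiv> rot_sum (eval_char p (m + rho))"
  shows "s \<noteq> 0" "F p m ^ 3 \<noteq> s ^ 3"
proof -
  define x where "x = m + rho"
  obtain a b where x: "x = (a, b)" "1 \<le> a" "a \<le> p" "1 \<le> b" "b \<le> p"
    using m unfolding E_iff x_def[symmetric] by (cases x) auto
  have F: "F p m = eps p m * of_real (cmod s)" unfolding s_def by (rule F_eq)
  have eps: "eps p m = (if a + b \<le> p then 1 else - 1)" unfolding eps_eq x_def[symmetric] by (simp add: x)
  have pp: "p > 0" "of_int p > (0::real)" using p by auto
  have "s \<noteq> 0 \<and> F p m ^ 3 \<noteq> s ^ 3"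
  proof (cases "weyl_denom (eval_char p x) = 0")
    case False
    have D: "weyl_denom (eval_char p x) = s ^ 3 - cnj s ^ 3"
      unfolding weyl_denom_rot_sum(1)[OF eval_char_char] rot_sum_inv_eval s_def x_def ..
    have "cnj (F p m) = F p m" unfolding F eps by simp
    then have "F p m ^ 3 = cnj (F p m ^ 3)" by (simp only: complex_cnj_power)
    \<comment> \<open>\<open>F\<close> is real but \<open>s\<^sup>3\<close> is not\<close>
    moreover have ne: "s ^ 3 \<noteq> cnj (s ^ 3)" using False D by (simp only: complex_cnj_power) simp
    ultimately have "F p m ^ 3 \<noteq> s ^ 3" by (metis)
    moreover have "s \<noteq> 0" using ne by (intro notI) simp
    ultimately show ?thesis by blast
  next
    case True
    have cube: "eval_char p x theta ^ 3 = cis (2 * pi * of_int (- (a + b)) / of_int p)"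
      "eval_char p x (- alpha1) ^ 3 = cis (2 * pi * of_int a / of_int p)"
      "eval_char p x (- alpha2) ^ 3 = cis (2 * pi * of_int b / of_int p)"
      unfolding eval_char_values DeMoivre x fst_conv snd_conv by (rule arg_cong[of _ _ cis], use pp in \<open>simp add: field_simps\<close>)+
    have "p dvd - (a + b) \<or> p dvd a \<or> p dvd b"
      using True cis_period_dvd[OF pp(1)] unfolding weyl_denom_rot_sum(2)[OF eval_char_char] cube by blast
    then have cases: "(a = p \<or> b = p) \<or> a + b = p"
    proof (elim disjE)
      assume "p dvd - (a + b)"
      then have "p dvd a + b" by (simp only: dvd_minus_iff)
      then obtain k where k: "a + b = p * k" by (rule dvdE)
      have "0 < p * k" "p * k \<le> p * 2" using k x by linarith+
      then have "0 < k" "k \<le> 2" using pp by (simp_all add: zero_less_mult_iff mult_le_cancel_left)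
      moreover note pp
      ultimately have "k = 1 \<or> k = 2" by linarith
      then show ?thesis using k x by auto
    next
      assume "p dvd a" then have "a = p" using x by (simp add: zdvd_imp_le dual_order.antisym)
      then show ?thesis by simp
    next
      assume "p dvd b" then have "b = p" using x by (simp add: zdvd_imp_le dual_order.antisym)
      then show ?thesis by simp
    qed
    show ?thesis
    proof (cases "a + b = p")
      case True
      then have "\<exists>r<0. s = cis (- (2 * pi / 3)) * of_real r"
        unfolding s_def x_def[symmetric] using x by (intro rot_sum_wall_diagonal[OF pp(1), of _ a]) auto
      then obtain r where r: "r < 0" "s = cis (- (2 * pi / 3)) * of_real r" by blast
      have "cmod s = - r" using r by (simp add: norm_mult)
      then have "F p m = of_real (- r)" using True unfolding F eps by simp
      then have "F p m ^ 3 = - of_real (r ^ 3)" by simp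
      moreover have "- complex_of_real (r ^ 3) \<noteq> of_real (r ^ 3)" unfolding neg_equal_zero using r by simp
      moreover have "s \<noteq> 0" using r by simp
      moreover have "s ^ 3 = of_real (r ^ 3)" unfolding r power_mult_distrib cis_thirds_cube by simp
      ultimately show ?thesis by (simp only:) simp
    next
      case False
      with cases have "a = p \<or> b = p" by simp
      then obtain c where c: "x = (p, c) \<or> x = (c, p)" "1 \<le> c" "c \<le> p" using x by blast
      then have "\<exists>r>0. s = cis (2 * pi / 3) * of_real r"
        unfolding s_def x_def[symmetric] by (rule rot_sum_wall_edge[OF pp(1)])
      then obtain r where r: "r > 0" "s = cis (2 * pi / 3) * of_real r" by blast
      have "cmod s = r" using r by (simp add: norm_mult)
      moreover have "\<not> a + b \<le> p" using \<open>a = p \<or> b = p\<close> x by auto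
      ultimately have "F p m = - of_real r" unfolding F eps by simp
      then have "F p m ^ 3 = - of_real (r ^ 3)" by simp
      moreover have "- complex_of_real (r ^ 3) \<noteq> of_real (r ^ 3)" unfolding neg_equal_zero using r by simp
      moreover have "s \<noteq> 0" using r by simp
      moreover have "s ^ 3 = of_real (r ^ 3)" unfolding r power_mult_distrib cis_thirds_cube by simp
      ultimately show ?thesis by (simp only:) simp
    qed
  qed
  then show "s \<noteq> 0" "F p m ^ 3 \<noteq> s ^ 3" by auto
qed

lemma twist_phase_props:
  assumes p: "p \<ge> 2" and m: "m \<in> E p"
  defines "s \<equiv> rot_sum (eval_char p (m + rho))"
  shows "s \<noteq> 0" "twist_phase p m ^ 3 \<noteq> 1" "(twist_phase p m)\<^sup>2 * s = cnj s" "F p m = twist_phase p m * s" "cmod (twist_phase p m) = 1"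
    "twist_phase p m \<noteq> 0"
proof -
  have s: "s \<noteq> 0" "F p m ^ 3 \<noteq> s ^ 3" using rot_sum_F_cube[OF p m] unfolding s_def .
  have F: "F p m = eps p m * of_real (cmod s)" unfolding s_def by (rule F_eq)
  have k: "twist_phase p m = F p m / s" by (simp add: twist_phase_def s_def)
  show "s \<noteq> 0" by (rule s(1))
  show "twist_phase p m ^ 3 \<noteq> 1" unfolding k power_divide using s by simp
  show Fk: "F p m = twist_phase p m * s" unfolding k using s(1) by simp
  have e: "eps p m * eps p m = 1" "cmod (eps p m) = 1" by (simp_all add: eps_def)
  have "(F p m)\<^sup>2 = of_real ((cmod s)\<^sup>2)" unfolding F power_mult_distrib by (simp add: power2_eq_square e)
  also have "\<dots> = s * cnj s" by (rule complex_norm_square)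
  finally have FF: "(twist_phase p m * s)\<^sup>2 = s * cnj s"
    by (simp only: Fk)
  have "s * ((twist_phase p m)\<^sup>2 * s) = (twist_phase p m * s)\<^sup>2" by (simp add: power2_eq_square)
  also note FF
  finally show "(twist_phase p m)\<^sup>2 * s = cnj s" using s by simp
  show k1: "cmod (twist_phase p m) = 1" unfolding k F norm_divide norm_mult e using s(1) by simp
  then show "twist_phase p m \<noteq> 0" by auto
qed

text \<open>The phase in front of \<open>\<chi>\<^sub>y\<close> is \<open>1\<close> because the triality vanishes on the root lattice. The terms
  with coefficient \<open>2\<close> belong to \<open>p\<^sub>0\<close>, those with coefficient \<open>F = \<kappa> s\<close> form \<open>\<kappa> p\<^sub>1\<close>.\<close>

lemma chi_graded:
  assumes p: "p \<ge> 2" and m: "m \<in> E p" and y: "y \<in> aff_weyl 1"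
  shows "chi p y m = graded_char (iota y) (eval_char p (m + rho)) 0
    + twist_phase p m * graded_char (iota y) (eval_char p (m + rho)) 1"
proof -
  obtain g l where g: "g \<in> weyl" "l \<in> root_lattice" "y = g \<circ> transl (- l)" using aff1E[OF y] .
  have ring: "1 * (c + (k * s + 2) * B) = c + 2 * B + k * (s * B)" for c k s B :: complex
    by (simp add: algebra_simps)
  show ?thesis
    unfolding chi_def Let_def chibar_irr_char g(3) fin_part_eq[OF g(1)] lat_part_eq[OF g(1)] triality_root[OF g(2)]
      twist_phase_props(4)[OF p m]
    unfolding eval_char_torus graded_irr_char[OF g(1,2)] mult_zero_right of_int_0 exp_zero
    by (rule ring)
qed

lemma chi_twisted_num:
  assumes p: "p \<ge> 2" and m: "m \<in> E p" and y: "y \<in> aff_weyl 1"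
  shows "rot_sum (eval_char p (m + rho)) * (1 - twist_phase p m ^ 3) * chi p y m
    = twisted_num y (eval_char p (m + rho)) (twist_phase p m)"
  unfolding chi_graded[OF assms]
  by (rule twisted_num_graded[OF eval_char_char y twist_phase_props(3)[OF p m, folded rot_sum_inv_eval]])

text \<open>At the identity the numerator is \<open>s - \<kappa> cnj s = s (1 - \<kappa>\<^sup>3)\<close>.\<close>

lemma chi_one:
  assumes p: "p \<ge> 2" and m: "m \<in> E p"
  shows "chi p id m = 1"
proof -
  let ?e = "eval_char p (m + rho)" and ?k = "twist_phase p m"
  note kp = twist_phase_props[OF p m]
  have id: "id = id \<circ> transl (- 0)" by (auto simp: transl_def)
  have "0 \<in> root_lattice" by (simp add: root_lattice_iff)
  then have 1: "id \<in> aff_weyl 1" using aff1I[OF weyl_id, of 0] id by simp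
  have f: "fin_part id = id" using fin_part_eq[OF weyl_id, of 0] id by simp
  have i: "iota id + rho = rho" using iota_rho[OF weyl_id, of 0] id by simp
  have "twisted_num id ?e ?k = rot_sum ?e - ?k * rot_sum (inv_char ?e)"
    unfolding twisted_num_def f i
    by (simp add: sum_weyl wdet_values parity_factor_def rot_sum_def inv_char_def weight_defs algebra_simps)
  also have "\<dots> = rot_sum ?e * (1 - ?k ^ 3)"
    unfolding rot_sum_inv_eval kp(3)[symmetric] by (simp add: algebra_simps power2_eq_square power3_eq_cube)
  finally show ?thesis
    using chi_twisted_num[OF p m 1] kp by simp
qed

lemma eval_char_period:
  assumes p: "p \<noteq> 0" and b: "b \<in> root_lattice" shows "eval_char p x (smult 3 (smult p b)) = 1"
proof -
  obtain A B where "b = (2 * A - B, 2 * B - A)" using root_lattice_coords[OF b] .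
  then have "ip (smult 3 (smult p b)) x = 3 * of_int p * of_int (A * fst x + B * snd x)"
    by (simp add: ip_def smult_def algebra_simps)
  then have "- 2 * pi * ip (smult 3 (smult p b)) x / (3 * of_int p) = 2 * pi * of_int (- (A * fst x + B * snd x))"
    using p by (simp add: field_simps)
  then show ?thesis unfolding eval_char_def by (simp only: cis_multiple_2pi Ints_of_int)
qed

lemma chi_right:
  assumes p: "p \<ge> 2" and m: "m \<in> E p" and y: "y \<in> aff_weyl 1" and v: "v \<in> aff_weyl p"
  shows "chi p (y \<circ> v) m = of_int (wdet (fin_part v)) * chi p y m"
proof -
  let ?e = "eval_char p (m + rho)"
  have per: "\<And>b. b \<in> root_lattice \<Longrightarrow> ?e (smult 3 (smult p b)) = 1" using eval_char_period p by simp
  note r = twisted_num_right[OF eval_char_char per y v]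
  have "rot_sum ?e * (1 - twist_phase p m ^ 3) * chi p (y \<circ> v) m
      = rot_sum ?e * (1 - twist_phase p m ^ 3) * (of_int (wdet (fin_part v)) * chi p y m)"
    using chi_twisted_num[OF p m r(1)] chi_twisted_num[OF p m y] r(2)[of "twist_phase p m"] by (simp add: ac_simps)
  then show ?thesis using twist_phase_props(1,2)[OF p m] by simp
qed

section \<open>Coset representatives and alcoves\<close>

definition in_alcove :: "int \<Rightarrow> weight \<Rightarrow> bool" where
  "in_alcove q v \<longleftrightarrow> 0 < fst v \<and> 0 < snd v \<and> fst v + snd v < q"

text \<open>The closed alcove is a strict fundamental domain of the affine Weyl group with translation
  lattice \<open>qQ\<close>, and points of its interior have trivial stabiliser. The coordinates of \<open>x'\<close> and \<open>w
  x\<close> leave only finitely many possibilities for \<open>d\<close>.\<close>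

lemma alcove_unique:
  assumes q: "0 < q" and w: "w \<in> weyl" and d: "d \<in> root_lattice"
    and x: "0 \<le> fst x" "0 \<le> snd x" "fst x + snd x \<le> q"
    and x': "0 \<le> fst x'" "0 \<le> snd x'" "fst x' + snd x' \<le> q"
    and eq: "x' = w x + smult q d"
  shows "x' = x" and "in_alcove q x \<Longrightarrow> w = id \<and> d = 0"
proof -
  obtain a b where ab: "x = (a, b)" by (cases x)
  obtain d1 d2 where dd: "d = (d1, d2)" by (cases d)
  have cong: "(d1 - d2) mod 3 = 0" using d by (simp add: root_lattice_iff dd)
  have wx: "\<bar>fst (w x)\<bar> \<le> q" "\<bar>snd (w x)\<bar> \<le> q"
    using w x unfolding weyl_eq ab by auto
  have q1: "- q \<le> q * d1" "q * d1 \<le> 2 * q" "- q \<le> q * d2" "q * d2 \<le> 2 * q"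
    using wx x' unfolding eq dd by (simp_all add: smult_def)
  have bnd: "- 1 \<le> k \<and> k \<le> 2" if "- q \<le> q * k" "q * k \<le> 2 * q" for k
  proof -
    have "q * (- 1) \<le> q * k" "q * k \<le> q * 2" using that by simp_all
    then show ?thesis using q by (simp only: mult_le_cancel_left_pos)
  qed
  have "d1 = - 1 \<or> d1 = 0 \<or> d1 = 1 \<or> d1 = 2" "d2 = - 1 \<or> d2 = 0 \<or> d2 = 1 \<or> d2 = 2"
    using bnd[OF q1(1,2)] bnd[OF q1(3,4)] by linarith+
  then have dc: "(d1, d2) \<in> {(-1,-1), (0,0), (1,1), (2,2), (-1,2), (2,-1)}"
    using cong by auto
  have "x' = x \<and> (in_alcove q x \<longrightarrow> w = id \<and> d = 0)"
    using w dc x x' q unfolding weyl_eq eq ab dd in_alcove_def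
    by (elim insertE emptyE; clarsimp simp: smult_def zero_prod_def)
  then show "x' = x" "in_alcove q x \<Longrightarrow> w = id \<and> d = 0" by auto
qed

text \<open>Both triangles of the square \<open>E p + \<rho>\<close> lie in closed alcoves: the one with \<open>\<epsilon> = 1\<close> in the
  fundamental alcove, the other one in its image under \<open>x \<mapsto> p \<rho> - x\<close>.\<close>

lemma triangle_unique:
  assumes p: "2 \<le> p" and m: "m \<in> E p" "m' \<in> E p" and w: "w \<in> weyl" and d: "d \<in> root_lattice"
    and eq: "m' + rho = w (m + rho) + smult p d" and eps: "eps p m = eps p m'"
  shows "m = m'"
proof -
  have r: "fst (m + rho) \<in> {1..p}" "snd (m + rho) \<in> {1..p}" "fst (m' + rho) \<in> {1..p}" "snd (m' + rho) \<in> {1..p}"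
    using m unfolding E_iff by auto
  have same: "fst (m + rho) + snd (m + rho) \<le> p \<longleftrightarrow> fst (m' + rho) + snd (m' + rho) \<le> p"
    using eps unfolding eps_eq by (auto split: if_splits)
  have p0: "0 < p" using p by simp
  show ?thesis
  proof (cases "fst (m + rho) + snd (m + rho) \<le> p")
    case True
    have "m' + rho = m + rho"
      by (rule alcove_unique(1)[OF p0 w d _ _ _ _ _ _ eq]) (use r same True in auto)
    then show ?thesis by simp
  next
    case False
    \<comment> \<open>the vertex of the upper triangle that is mapped to the origin\<close>
    define c where "c = smult p rho"
    have c: "fst c = p" "snd c = p" by (simp_all add: c_def smult_def rho_eq)
    have d': "rho - w rho - d \<in> root_lattice"
      using w d unfolding root_lattice_iff weyl_eq by (auto simp: rho_eq; presburger)
    have "c - (m' + rho) = w (c - (m + rho)) + smult p (rho - w rho - d)"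
      unfolding eq c_def using w by (simp add: weyl_diff weyl_smult smult_diff)
    then have "c - (m' + rho) = c - (m + rho)"
      by (rule alcove_unique(1)[OF p0 w d', rotated -1]) (use r same False c in auto)
    then show ?thesis by simp
  qed
qed

lemma weyl_inverses:
  "inv s1 = s1" "inv s2 = s2" "inv (s1 \<circ> s2) = s2 \<circ> s1" "inv (s2 \<circ> s1) = s1 \<circ> s2"
  "inv (s1 \<circ> s2 \<circ> s1) = s1 \<circ> s2 \<circ> s1"
  by (rule inv_equality; auto)+

text \<open>The case distinctions in the definition of \<open>Pplus\<close> describe the sign of an infinitesimal shift
  of \<open>l\<close> by the weight \<open>inv g rho\<close>. Multiplying by \<open>3\<close> makes the shift integral, because the
  pairings of \<open>inv g rho\<close> with the roots have absolute value at most \<open>2\<close>.\<close>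

lemma Pplus_iff:
  assumes "g \<in> weyl"
  shows "l \<in> Pplus p g \<longleftrightarrow> in_alcove (3 * p) (smult 3 l + inv g rho)"
proof -
  have th: "ip v theta = of_int (fst v + snd v)" for v by (simp add: ip_def theta_eq)
  have "l \<in> Pplus p g \<longleftrightarrow> 0 \<le> fst l \<and> 0 \<le> snd l \<and> (- g alpha1 \<in> pos_roots \<longrightarrow> 0 < fst l) \<and>
     (- g alpha2 \<in> pos_roots \<longrightarrow> 0 < snd l) \<and>
     (g theta \<in> pos_roots \<longrightarrow> fst l + snd l < p) \<and> (- g theta \<in> pos_roots \<longrightarrow> fst l + snd l \<le> p)"
    unfolding Pplus_def dominant_def mem_Collect_eq ip_alpha1 ip_alpha2 th of_int_le_iff of_int_less_iff
      of_int_0_le_iff of_int_0_less_iff by blast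
  also have "\<dots> \<longleftrightarrow> in_alcove (3 * p) (smult 3 l + inv g rho)"
    using assms unfolding weyl_eq in_alcove_def pos_roots_def
    by (elim insertE emptyE; hypsubst; simp add: weyl_inverses weight_defs smult_def; linarith?)
  finally show ?thesis .
qed

lemma Wplus_iff: "y \<in> Wplus p \<longleftrightarrow> y \<in> aff_weyl 1 \<and> in_alcove (3 * p) (iota y + rho)"
proof
  assume "y \<in> Wplus p"
  then obtain g l where g: "g \<in> weyl" "l \<in> Pplus p g" "l \<in> root_lattice" "y = g \<circ> transl (- l)"
    unfolding Wplus_def by auto
  then show "y \<in> aff_weyl 1 \<and> in_alcove (3 * p) (iota y + rho)"
    using aff1I[OF g(1,3)] Pplus_iff[OF g(1)] iota_rho[OF g(1)] by simp
next
  assume a: "y \<in> aff_weyl 1 \<and> in_alcove (3 * p) (iota y + rho)"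
  then obtain g l where g: "g \<in> weyl" "l \<in> root_lattice" "y = g \<circ> transl (- l)" using aff1E by metis
  then have "l \<in> Pplus p g" using a Pplus_iff[OF g(1)] iota_rho[OF g(1)] by simp
  then show "y \<in> Wplus p" unfolding Wplus_def using g by blast
qed

lemma root_lattice_smult:
  assumes "u \<in> root_lattice" shows "smult k u \<in> root_lattice"
proof -
  have "fst (smult k u) - snd (smult k u) = k * (fst u - snd u)" by (simp add: smult_def algebra_simps)
  then show ?thesis using assms unfolding root_lattice_iff mod_eq_0_iff_dvd by (simp only: dvd_mult)
qed

lemma root_lattice_add:
  assumes "u \<in> root_lattice" "v \<in> root_lattice" shows "u + v \<in> root_lattice"
proof -
  have "fst (u + v) - snd (u + v) = (fst u - snd u) + (fst v - snd v)" by simp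
  then show ?thesis using assms unfolding root_lattice_iff mod_eq_0_iff_dvd by (simp only: dvd_add)
qed

lemma root_lattice_minus: "u \<in> root_lattice \<Longrightarrow> - u \<in> root_lattice"
  using root_lattice_smult[of u "- 1"] by (simp add: smult_def uminus_prod_def)

lemma root_lattice_diff: "u \<in> root_lattice \<Longrightarrow> v \<in> root_lattice \<Longrightarrow> u - v \<in> root_lattice"
  using root_lattice_add[of u "- v"] root_lattice_minus[of v] by simp

lemma aff_weyl_mono:
  assumes "v \<in> aff_weyl p" shows "v \<in> aff_weyl 1"
proof -
  obtain w b where "w \<in> weyl" "b \<in> root_lattice" "v = w \<circ> transl (- smult p b)" using affE[OF assms] .
  then show ?thesis using aff1I[of w "smult p b"] root_lattice_smult by simp
qed

lemma aff_weyl_comp: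
  assumes "u \<in> aff_weyl p" "v \<in> aff_weyl p" shows "u \<circ> v \<in> aff_weyl p"
proof -
  obtain a b where a: "a \<in> weyl" "b \<in> root_lattice" "u = a \<circ> transl (- smult p b)" using affE[OF assms(1)] .
  obtain c d where c: "c \<in> weyl" "d \<in> root_lattice" "v = c \<circ> transl (- smult p d)" using affE[OF assms(2)] .
  have "u \<circ> v = (a \<circ> c) \<circ> transl (- smult p (inv c b + d))"
    unfolding a c transl_comp[OF c(1)] by (simp only: weyl_smult[OF weyl_inv[OF c(1)]] smult_add)
  then show ?thesis
    using affI[OF weyl_comp[OF a(1) c(1)] root_lattice_add[OF weyl_root_lattice[OF weyl_inv[OF c(1)] a(2)] c(2)]]
    by simp
qed

lemma transl_zero: "transl 0 = id"
  by (auto simp: transl_def)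

lemma id_aff_weyl: "id \<in> aff_weyl p"
  using affI[OF weyl_id, of 0 p] by (simp add: root_lattice_iff transl_zero)

lemma aff_weyl_right_inverse:
  assumes "v \<in> aff_weyl p" obtains v' where "v' \<in> aff_weyl p" "v \<circ> v' = id"
proof -
  obtain a b where a: "a \<in> weyl" "b \<in> root_lattice" "v = a \<circ> transl (- smult p b)" using affE[OF assms] .
  have "v \<circ> (inv a \<circ> transl (- smult p (- a b))) = (a \<circ> inv a) \<circ> transl (- (a (smult p b) + smult p (- a b)))"
    unfolding a(3) transl_comp[OF weyl_inv[OF a(1)]] weyl_inv_inv[OF a(1)] ..
  also have "a (smult p b) + smult p (- a b) = 0"
    unfolding weyl_smult[OF a(1)] smult_add[symmetric] right_minus smult_0 ..
  also have "a \<circ> inv a = id" by (rule ext) (simp only: comp_apply weyl_inv_apply(1)[OF a(1)] id_apply)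
  finally have "v \<circ> (inv a \<circ> transl (- smult p (- a b))) = id"
    by (simp only: minus_zero transl_zero id_o)
  moreover have "inv a \<circ> transl (- smult p (- a b)) \<in> aff_weyl p"
    by (rule affI[OF weyl_inv[OF a(1)] root_lattice_minus[OF weyl_root_lattice[OF a(1,2)]]])
  ultimately show thesis using that by blast
qed

lemma aff_weyl_inv:
  assumes "v \<in> aff_weyl p" shows "inv v \<in> aff_weyl p" "v \<circ> inv v = id" "inv v \<circ> v = id"
proof -
  obtain v' where v': "v' \<in> aff_weyl p" "v \<circ> v' = id" using aff_weyl_right_inverse[OF assms] .
  obtain v'' where v'': "v'' \<in> aff_weyl p" "v' \<circ> v'' = id" using aff_weyl_right_inverse[OF v'(1)] .
  have "v = v \<circ> (v' \<circ> v'')" by (simp only: v''(2) o_id)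
  also have "\<dots> = v''" by (simp only: o_assoc v'(2) id_o)
  finally have vv: "v' \<circ> v = id" using v''(2) by (simp only:)
  have i: "inv v = v'" by (rule inv_unique_comp[OF v'(2) vv])
  show "inv v \<in> aff_weyl p" "v \<circ> inv v = id" "inv v \<circ> v = id" unfolding i by (rule v'(1) v'(2) vv)+
qed

text \<open>Up to the shift by \<open>\<rho>\<close>, the map \<open>\<iota>\<close> intertwines right multiplication with the inverse of the
  affine action rescaled by \<open>3\<close>.\<close>

lemma iota_comp:
  assumes y: "y \<in> aff_weyl 1" and u: "u \<in> weyl" and b: "b \<in> root_lattice"
  shows "iota (y \<circ> (u \<circ> transl (- smult p b))) + rho = inv u (iota y + rho) + smult (3 * p) b"
proof -
  obtain g l where g: "g \<in> weyl" "l \<in> root_lattice" "y = g \<circ> transl (- l)" using aff1E[OF y] .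
  have "inv (g \<circ> u) = inv u \<circ> inv g" using g u by (simp add: o_inv_distrib weyl_bij)
  moreover have "smult 3 (smult p b) = smult (3 * p) b" by (simp add: smult_def)
  ultimately show ?thesis
    unfolding g transl_comp[OF u] iota_rho[OF weyl_comp[OF g(1) u]] iota_rho[OF g(1)]
    using weyl_inv[OF u] by (simp add: weyl_linear weyl_smult smult_add)
qed

text \<open>The weight \<open>\<rho>\<close> is an interior point of the alcove of size \<open>3\<close> and so has trivial stabiliser.\<close>

lemma iota_inj:
  assumes y: "y \<in> aff_weyl 1" "y' \<in> aff_weyl 1" and eq: "iota y = iota y'"
  shows "y = y'"
proof -
  obtain g l where g: "g \<in> weyl" "l \<in> root_lattice" "y = g \<circ> transl (- l)" using aff1E[OF y(1)] .
  obtain h k where h: "h \<in> weyl" "k \<in> root_lattice" "y' = h \<circ> transl (- k)" using aff1E[OF y(2)] .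
  have e: "smult 3 l + inv g rho = smult 3 k + inv h rho"
    using eq iota_rho[OF g(1), of l] iota_rho[OF h(1), of k] g h by simp
  have "rho = (g \<circ> inv h) rho + smult 3 (g (k - l))"
  proof -
    have "inv g rho = smult 3 (k - l) + inv h rho" using e by (simp add: smult_diff algebra_simps)
    then have "g (inv g rho) = g (smult 3 (k - l)) + g (inv h rho)" using g(1) by (simp only: weyl_linear)
    then show ?thesis using g(1) by (simp add: weyl_smult add.commute)
  qed
  then have "g \<circ> inv h = id \<and> g (k - l) = 0"
    by (rule alcove_unique(2)[OF _ weyl_comp[OF g(1) weyl_inv[OF h(1)]]
          weyl_root_lattice[OF g(1) root_lattice_diff[OF h(2) g(2)]], rotated -2])
      (simp_all add: in_alcove_def rho_eq)
  then have "g = h" "k = l"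
  proof -
    assume a: "g \<circ> inv h = id \<and> g (k - l) = 0"
    have "g v = h v" for v using a h(1) by (metis comp_apply id_apply weyl_inv_apply(2))
    then show "g = h" by auto
    have "inv g (g (k - l)) = inv g 0" using a by simp
    then show "k = l" using g(1) weyl_inv[OF g(1)] by (simp add: weyl_linear(2))
  qed
  then show ?thesis using g h by simp
qed

lemma Wplus_unique:
  assumes p: "2 \<le> p" and z: "z \<in> Wplus p" "z' \<in> Wplus p" and v: "v \<in> aff_weyl p" "v' \<in> aff_weyl p"
    and eq: "z \<circ> v = z' \<circ> v'"
  shows "z = z'" "v = v'"
proof -
  obtain u b where u: "u \<in> weyl" "b \<in> root_lattice" "v = u \<circ> transl (- smult p b)" using affE[OF v(1)] .
  obtain t d where t: "t \<in> weyl" "d \<in> root_lattice" "v' = t \<circ> transl (- smult p d)" using affE[OF v(2)] .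
  have a: "z \<in> aff_weyl 1" "z' \<in> aff_weyl 1" "in_alcove (3 * p) (iota z + rho)" "in_alcove (3 * p) (iota z' + rho)"
    using z unfolding Wplus_iff by auto
  have "inv u (iota z + rho) + smult (3 * p) b = inv t (iota z' + rho) + smult (3 * p) d"
    using iota_comp[OF a(1) u(1,2), of p] iota_comp[OF a(2) t(1,2), of p] eq u(3) t(3) by simp
  then have "t (inv t (iota z' + rho)) = t (inv u (iota z + rho) + smult (3 * p) (b - d))"
    by (simp add: smult_diff algebra_simps)
  then have e: "iota z' + rho = (t \<circ> inv u) (iota z + rho) + smult (3 * p) (t (b - d))"
    using t(1) by (simp add: weyl_linear weyl_smult)
  have tu: "t \<circ> inv u \<in> weyl" "t (b - d) \<in> root_lattice"
    by (rule weyl_comp[OF t(1) weyl_inv[OF u(1)]],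
        rule weyl_root_lattice[OF t(1) root_lattice_diff[OF u(2) t(2)]])
  have p3: "0 < 3 * p" using p by simp
  have "iota z' + rho = iota z + rho"
    by (rule alcove_unique(1)[OF p3 tu _ _ _ _ _ _ e]) (use a in \<open>auto simp: in_alcove_def\<close>)
  then show "z = z'" using iota_inj[OF a(1,2)] by simp
  have "t \<circ> inv u = id \<and> t (b - d) = 0"
    by (rule alcove_unique(2)[OF p3 tu _ _ _ _ _ _ e a(3)]) (use a in \<open>auto simp: in_alcove_def\<close>)
  then have w: "t \<circ> inv u = id" "t (b - d) = 0" by auto
  have "t x = u x" for x using w(1) u(1) by (metis comp_apply id_apply weyl_inv_apply(2))
  then have "t = u" by auto
  moreover have "inv t (t (b - d)) = inv t 0" using w by simp
  then have "b = d" using t(1) weyl_inv[OF t(1)] by (simp add: weyl_linear(2))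
  ultimately show "v = v'" using u t by simp
qed

text \<open>A multiple of the squared distance of \<open>v\<close> from \<open>\<rho>\<close>.\<close>

definition rho_dist :: "weight \<Rightarrow> int" where
  "rho_dist v = (fst v)\<^sup>2 + fst v * snd v + (snd v)\<^sup>2 - 3 * (fst v + snd v) + 3"

lemma rho_dist_nonneg: "0 \<le> rho_dist v"
proof -
  have "4 * rho_dist v = (2 * (fst v - 1) + (snd v - 1))\<^sup>2 + 3 * (snd v - 1)\<^sup>2"
    by (simp add: rho_dist_def power2_eq_square algebra_simps)
  moreover have "0 \<le> (2 * (fst v - 1) + (snd v - 1))\<^sup>2 + 3 * (snd v - 1)\<^sup>2" by simp
  ultimately show ?thesis by linarith
qed

text \<open>Among all translates of \<open>\<iota>(y) + \<rho>\<close> choose one nearest to \<open>\<rho>\<close>. If it were outside the alcove, the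
  reflection in a wall separating it from the interior point \<open>\<rho>\<close> would bring it nearer. It is not
  on a wall, because its coordinates and their sum are not divisible by \<open>3\<close>.\<close>

lemma Wplus_exists:
  assumes p: "2 \<le> p" and y: "y \<in> aff_weyl 1"
  obtains z v where "z \<in> Wplus p" "v \<in> aff_weyl p" "y = z \<circ> v"
proof -
  let ?n = "\<lambda>v. iota (y \<circ> v) + rho"
  obtain v where v: "v \<in> aff_weyl p" and
    min: "\<And>v'. v' \<in> aff_weyl p \<Longrightarrow> nat (rho_dist (?n v)) \<le> nat (rho_dist (?n v'))"
    using ex_has_least_nat[of "\<lambda>v. v \<in> aff_weyl p" id "\<lambda>v. nat (rho_dist (?n v))"] id_aff_weyl by blast
  have yv: "y \<circ> v \<in> aff_weyl 1" using y v aff_weyl_comp aff_weyl_mono by blast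
  obtain a b where ab: "?n v = (a, b)" by (cases "?n v")
  have le: "rho_dist (a, b) \<le> rho_dist (inv u (a, b) + smult (3 * p) d)" if "u \<in> weyl" "d \<in> root_lattice" for u d
  proof -
    have "?n (v \<circ> (u \<circ> transl (- smult p d))) = inv u (a, b) + smult (3 * p) d"
      unfolding o_assoc iota_comp[OF yv that, unfolded o_assoc] ab ..
    then show ?thesis
      using min[OF aff_weyl_comp[OF v affI[OF that]]] rho_dist_nonneg[of "inv u (a, b) + smult (3 * p) d"]
      unfolding ab by (simp add: nat_le_iff)
  qed
  have fst: "a mod 3 = 1 \<or> a mod 3 = 2" using fst_weyl_iota[OF yv weyl_id] ab by (auto split: if_splits)
  have ab3: "(a - b) mod 3 = 0"
  proof -
    obtain g l where g: "g \<in> weyl" "l \<in> root_lattice" "y \<circ> v = g \<circ> transl (- l)" using aff1E[OF yv] .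
    have "rho \<in> root_lattice" by (simp add: root_lattice_iff rho_eq)
    then have "smult 3 l + inv g rho \<in> root_lattice"
      by (rule root_lattice_add[OF root_lattice_smult[OF g(2)] weyl_root_lattice[OF weyl_inv[OF g(1)]]])
    moreover have "smult 3 l + inv g rho = (a, b)" using iota_rho[OF g(1), of l] g(3) ab by simp
    ultimately show ?thesis by (simp only: root_lattice_iff fst_conv snd_conv)
  qed
  have W: "s1 \<in> weyl" "s2 \<in> weyl" "s1 \<circ> s2 \<circ> s1 \<in> weyl" by (simp_all add: weyl_eq)
  have z: "(0 :: weight) \<in> root_lattice" "theta \<in> root_lattice" by (simp_all add: root_lattice_iff theta_eq)
  have "0 \<le> a" using le[OF W(1) z(1)]
    by (simp add: weyl_inverses rho_dist_def power2_eq_square algebra_simps)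
  moreover have "0 \<le> b" using le[OF W(2) z(1)]
    by (simp add: weyl_inverses rho_dist_def power2_eq_square algebra_simps)
  moreover have "a + b \<le> 3 * p"
  proof (rule ccontr)
    assume n: "\<not> ?thesis"
    \<comment> \<open>the right side is the change of \<open>rho_dist\<close> under the affine reflection\<close>
    have "0 \<le> (a + b - 3 * p) * (6 - 9 * p)" using le[OF W(3) z(2)]
      by (simp add: weyl_inverses rho_dist_def theta_eq smult_def power2_eq_square algebra_simps)
    moreover have "(a + b - 3 * p) * (6 - 9 * p) < 0" using n p by (intro mult_pos_neg) auto
    ultimately show False by simp
  qed
  moreover have "a \<noteq> 0" "b \<noteq> 0" "a + b \<noteq> 3 * p" using fst ab3 by presburger+
  ultimately have "y \<circ> v \<in> Wplus p" unfolding Wplus_iff in_alcove_def ab using yv by auto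
  moreover have "y = (y \<circ> v) \<circ> inv v" using aff_weyl_inv(2)[OF v] by (simp add: comp_assoc)
  ultimately show thesis using that aff_weyl_inv(1)[OF v] by blast
qed

lemma finite_Wplus: "finite (Wplus p)"
proof (rule finite_imageD)
  show "inj_on iota (Wplus p)" by (auto simp: inj_on_def Wplus_iff intro: iota_inj)
  have "iota ` Wplus p \<subseteq> {-1..3*p} \<times> {-1..3*p}"
  proof
    fix n assume "n \<in> iota ` Wplus p"
    then have "in_alcove (3 * p) (n + rho)" by (auto simp: Wplus_iff)
    then show "n \<in> {-1..3*p} \<times> {-1..3*p}" by (cases n) (auto simp: in_alcove_def rho_eq)
  qed
  then show "finite (iota ` Wplus p)" by (rule finite_subset) simp
qed

lemma id_Wplus: "2 \<le> p \<Longrightarrow> id \<in> Wplus p"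
  using iota_rho[OF weyl_id, of 0] unfolding Wplus_iff
  by (simp add: id_aff_weyl transl_zero in_alcove_def rho_eq)

lemma Wplus_aff: "y \<in> Wplus p \<Longrightarrow> y \<in> aff_weyl 1"
  by (simp add: Wplus_iff)

section \<open>The eigenvector equation\<close>

lemma iota_root_lattice:
  assumes "y \<in> aff_weyl 1" shows "iota y \<in> root_lattice"
proof -
  obtain g l where g: "g \<in> weyl" "l \<in> root_lattice" "y = g \<circ> transl (- l)" using aff1E[OF assms] .
  have r: "rho \<in> root_lattice" by (simp add: root_lattice_iff rho_eq)
  have "iota y = smult 3 l + inv g rho - rho" using iota_rho[OF g(1), of l] g(3) by (simp add: algebra_simps)
  then show ?thesis
    using root_lattice_diff[OF root_lattice_add[OF root_lattice_smult[OF g(2), of 3]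
      weyl_root_lattice[OF weyl_inv[OF g(1)] r]] r] by simp
qed

text \<open>The parity of \<open>y\<close> is visible in the grade of the weight \<open>\<iota>(y)\<close>; this turns the factor \<open>\<kappa>\<close> into a
  weight of the grading.\<close>

lemma iota_grade:
  assumes "y \<in> aff_weyl 1" shows "fst (iota y) mod 3 = (if wdet (fin_part y) = 1 then 0 else 1)"
proof -
  have g: "fst (iota y + rho) mod 3 = (if wdet (fin_part y) = 1 then 1 else 2)"
    using fst_weyl_iota[OF assms weyl_id] by simp
  have s: "fst (iota y + rho) = fst (iota y) + 1" by (simp add: rho_eq)
  have m: "(a + 1) mod 3 = 1 \<Longrightarrow> a mod 3 = 0" "(a + 1) mod 3 = 2 \<Longrightarrow> a mod 3 = 1" for a :: int
    by presburger+
  show ?thesis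
  proof (cases "wdet (fin_part y) = 1")
    case True
    then have "(fst (iota y) + 1) mod 3 = 1" using g s by simp
    then have "fst (iota y) mod 3 = 0" by (rule m)
    then show ?thesis using True by simp
  next
    case False
    then have "(fst (iota y) + 1) mod 3 = 2" using g s by simp
    then have "fst (iota y) mod 3 = 1" by (rule m)
    then show ?thesis using False by simp
  qed
qed

text \<open>Modulo \<open>3Q\<close> the weights that are congruent to \<open>\<rho>\<close> or to \<open>2\<rho>\<close> modulo \<open>3P\<close> form six classes, one
  for each image of \<open>\<rho>\<close> under the Weyl group.\<close>

lemma iota_surj:
  assumes n: "n \<in> root_lattice" "fst n mod 3 \<noteq> 2"
  obtains y where "y \<in> aff_weyl 1" "iota y = n"
proof -
  note found = that
  define a b where "a = fst n + 1" and "b = snd n + 1"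
  have nr: "n + rho = (a, b)" by (simp add: a_def b_def rho_eq prod_eq_iff)
  have ab: "(a - b) mod 3 = 0" using n(1) by (simp add: root_lattice_iff a_def b_def)
  have am: "a mod 3 = 1 \<or> a mod 3 = 2" using n(2) unfolding a_def by presburger
  have W: "id \<in> weyl" "s1 \<in> weyl" "s2 \<in> weyl" "s1 \<circ> s2 \<in> weyl" "s2 \<circ> s1 \<in> weyl" "s1 \<circ> s2 \<circ> s1 \<in> weyl"
    by (simp_all add: weyl_eq)
  have goal: thesis if w: "w \<in> weyl" "w rho = (c, d)" and k: "a - c = 3 * k" "b - d = 3 * k'" "3 dvd k - k'"
    for w c d k k'
  proof -
    define l where "l = (k, k')"
    have l3: "smult 3 l = (a - c, b - d)" unfolding l_def smult_def k by simp
    have l: "l \<in> root_lattice" using k(3) unfolding l_def root_lattice_iff mod_eq_0_iff_dvd by simp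
    have "iota (inv w \<circ> transl (- l)) + rho = n + rho"
      unfolding iota_rho[OF weyl_inv[OF w(1)]] weyl_inv_inv[OF w(1)] w(2) l3 nr by simp
    then have "iota (inv w \<circ> transl (- l)) = n" by simp
    then show thesis by (rule found[OF aff1I[OF weyl_inv[OF w(1)] l]])
  qed
  obtain k where k: "a - b = 3 * k" using ab by (auto simp: mod_eq_0_iff_dvd)
  have "\<exists>j. a = 3 * j + 1 \<or> a = 3 * j - 1" using am by presburger
  then obtain j where j: "a = 3 * j + 1 \<or> a = 3 * j - 1" by blast
  have "\<exists>i. k = 3 * i \<or> k = 3 * i + 1 \<or> k = 3 * i - 1" by presburger
  then obtain i where i: "k = 3 * i \<or> k = 3 * i + 1 \<or> k = 3 * i - 1" by blast
  show thesis using j i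
  proof (elim disjE)
    assume "a = 3 * j + 1" "k = 3 * i"
    then show thesis using k by (intro goal[OF W(1), of 1 1 j "j - 3 * i"]) (simp_all add: rho_eq)
  next
    assume "a = 3 * j + 1" "k = 3 * i + 1"
    then show thesis using k by (intro goal[OF W(5), of 1 "- 2" j "j - 3 * i"]) (simp_all add: rho_eq)
  next
    assume "a = 3 * j + 1" "k = 3 * i - 1"
    then show thesis using k by (intro goal[OF W(4), of "- 2" 1 "j + 1" "j + 1 - 3 * i"]) (simp_all add: rho_eq)
  next
    assume "a = 3 * j - 1" "k = 3 * i"
    then show thesis using k by (intro goal[OF W(6), of "- 1" "- 1" j "j - 3 * i"]) (simp_all add: rho_eq)
  next
    assume "a = 3 * j - 1" "k = 3 * i + 1"
    then show thesis using k by (intro goal[OF W(3), of 2 "- 1" "j - 1" "j - 1 - 3 * i"]) (simp_all add: rho_eq)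
  next
    assume "a = 3 * j - 1" "k = 3 * i - 1"
    then show thesis using k by (intro goal[OF W(2), of "- 1" 2 j "j - 3 * i"]) (simp_all add: rho_eq)
  qed
qed

definition iota_support :: "(weight \<Rightarrow> weight) \<Rightarrow> (weight \<Rightarrow> weight) set" where
  "iota_support y = {h \<in> aff_weyl 1. mbar (iota y) (iota h) \<noteq> 0}"

lemma iota_support_bij:
  assumes y: "y \<in> aff_weyl 1"
  shows "bij_betw iota (iota_support y) {n. mbar (iota y) n \<noteq> 0 \<and> fst n mod 3 \<noteq> 2}"
  unfolding bij_betw_def
proof
  show "inj_on iota (iota_support y)" by (auto simp: inj_on_def iota_support_def intro: iota_inj)
  show "iota ` iota_support y = {n. mbar (iota y) n \<noteq> 0 \<and> fst n mod 3 \<noteq> 2}" (is "?A = ?B")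
  proof
    show "?A \<subseteq> ?B"
    proof
      fix n assume "n \<in> ?A"
      then obtain h where "h \<in> aff_weyl 1" "mbar (iota y) (iota h) \<noteq> 0" "n = iota h"
        by (auto simp: iota_support_def)
      then show "n \<in> ?B" using iota_grade[of h] by simp
    qed
    show "?B \<subseteq> ?A"
    proof
      fix n assume n: "n \<in> ?B"
      then have "iota y - n \<in> root_lattice" using mbar_root_lattice by blast
      then have "iota y - (iota y - n) \<in> root_lattice" by (rule root_lattice_diff[OF iota_root_lattice[OF y]])
      then have "n \<in> root_lattice" by simp
      then obtain h where "h \<in> aff_weyl 1" "iota h = n" using iota_surj[of n] n by blast
      then show "n \<in> ?A" using n by (auto simp: iota_support_def)
    qed
  qed
qed

lemma finite_iota_support:
  assumes "y \<in> aff_weyl 1" shows "finite (iota_support y)"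
proof -
  have "finite {n. mbar (iota y) n \<noteq> 0 \<and> fst n mod 3 \<noteq> 2}"
    by (rule finite_subset[OF _ mbar_finite_support]) auto
  then show ?thesis using bij_betw_finite[OF iota_support_bij[OF assms]] by simp
qed

lemma sum_iota_support:
  assumes y: "y \<in> aff_weyl 1"
  shows "(\<Sum>h\<in>iota_support y. of_int (mbar (iota y) (iota h)) *
      ((if wdet (fin_part h) = 1 then A else B) * e (iota h)))
    = A * graded_char (iota y) e 0 + B * graded_char (iota y) e 1"
proof -
  let ?f = "\<lambda>n. of_int (mbar (iota y) n) * (if fst n mod 3 = 0 then A * e n else if fst n mod 3 = 1 then B * e n else 0)"
  have "(\<Sum>h\<in>iota_support y. of_int (mbar (iota y) (iota h)) *
      ((if wdet (fin_part h) = 1 then A else B) * e (iota h))) = (\<Sum>h\<in>iota_support y. ?f (iota h))"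
    by (rule sum.cong) (auto simp: iota_support_def iota_grade)
  also have "\<dots> = (\<Sum>n\<in>{n. mbar (iota y) n \<noteq> 0 \<and> fst n mod 3 \<noteq> 2}. ?f n)"
    by (rule sum.reindex_bij_betw[OF iota_support_bij[OF y]])
  also have "\<dots> = (\<Sum>n\<in>{n. mbar (iota y) n \<noteq> 0}. ?f n)"
    by (rule sum.mono_neutral_left[OF mbar_finite_support]) auto
  also have "\<dots> = A * graded_char (iota y) e 0 + B * graded_char (iota y) e 1"
    unfolding graded_char_def sum_distrib_left sum.distrib[symmetric] by (rule sum.cong) auto
  finally show ?thesis .
qed

text \<open>The sum is \<open>p\<^sub>0 + \<kappa> p\<^sub>1\<close> for the character \<open>e \<circ> u\<close> if \<open>u\<close> is even, and \<open>\<kappa> p\<^sub>0 + p\<^sub>1\<close> if it is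
  odd. In the first case the closed formula for \<open>e \<circ> u\<close> has the same value as for \<open>e\<close>. In the
  second case \<open>e \<circ> u\<close> has the conjugate of \<open>s\<close> in the role of \<open>s\<close>, and \<open>1 / \<kappa>\<close> in the role of \<open>\<kappa>\<close>.\<close>

lemma chi_twisted_by_weyl:
  assumes p: "2 \<le> p" and m: "m \<in> E p" and y: "y \<in> aff_weyl 1" and u: "u \<in> weyl"
  shows "(\<Sum>h\<in>iota_support y. of_int (mbar (iota y) (iota h)) *
      (parity_factor (twist_phase p m) (u \<circ> fin_part h) * eval_char p (m + rho) (u (iota h))))
    = parity_factor (twist_phase p m) u * chi p y m"
proof -
  let ?e = "eval_char p (m + rho)" and ?k = "twist_phase p m"
  let ?s = "rot_sum ?e"
  define p0 p1 where "p0 = graded_char (iota y) (?e \<circ> u) 0" and "p1 = graded_char (iota y) (?e \<circ> u) 1"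
  note kp = twist_phase_props[OF p m]
  note ch = chi_twisted_num[OF p m y]
  have eu: "is_char (?e \<circ> u)" by (rule comp_char[OF eval_char_char u])
  have inv_comp: "inv_char (?e \<circ> u) = inv_char ?e \<circ> u"
    unfolding inv_char_def comp_def weyl_linear(3)[OF u, unfolded comp_def] ..
  have par: "wdet (u \<circ> fin_part h) = wdet u * wdet (fin_part h)" for h by (rule wdet_comp[OF u])
  show ?thesis
  proof (cases "wdet u = 1")
    case True
    have "(\<Sum>h\<in>iota_support y. of_int (mbar (iota y) (iota h)) *
      (parity_factor ?k (u \<circ> fin_part h) * ?e (u (iota h)))) = 1 * p0 + ?k * p1"
      unfolding p0_def p1_def sum_iota_support[OF y, symmetric] parity_factor_def par True by simp
    also have "\<dots> = chi p y m"
    proof -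
      have sg: "rot_sum (?e \<circ> u) = ?s" "rot_sum (inv_char (?e \<circ> u)) = cnj ?s"
        unfolding inv_comp rot_sum_comp[OF u] using True by (simp_all add: rot_sum_inv_eval)
      have "?s * (1 - ?k ^ 3) * (p0 + ?k * p1) = ?s * (1 - ?k ^ 3) * chi p y m"
        using twisted_num_graded[OF eu y, of ?k] kp(3) twisted_num_comp(1)[OF y u kp(6) True] ch
        unfolding sg p0_def p1_def by simp
      then show ?thesis using kp(1,2) by simp
    qed
    finally show ?thesis by (simp add: parity_factor_def True)
  next
    case False
    then have d: "wdet u = - 1" using wdet_cases[OF u] by simp
    have "(\<Sum>h\<in>iota_support y. of_int (mbar (iota y) (iota h)) *
      (parity_factor ?k (u \<circ> fin_part h) * ?e (u (iota h)))) = ?k * p0 + 1 * p1"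
    proof -
      have "of_int (mbar (iota y) (iota h)) * (parity_factor ?k (u \<circ> fin_part h) * ?e (u (iota h)))
        = of_int (mbar (iota y) (iota h)) * ((if wdet (fin_part h) = 1 then ?k else 1) * (?e \<circ> u) (iota h))"
        if "h \<in> iota_support y" for h
      proof -
        have "h \<in> aff_weyl 1" using that by (simp add: iota_support_def)
        then have "wdet (fin_part h) = 1 \<or> wdet (fin_part h) = - 1" using aff1E fin_part_eq wdet_cases by metis
        then show ?thesis unfolding parity_factor_def par d by auto
      qed
      then show ?thesis unfolding p0_def p1_def sum_iota_support[OF y, symmetric] by (rule sum.cong[OF refl])
    qed
    also have "\<dots> = ?k * chi p y m"
    proof -
      have sg: "rot_sum (?e \<circ> u) = cnj ?s" "rot_sum (inv_char (?e \<circ> u)) = ?s"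
        unfolding inv_comp rot_sum_comp[OF u] using d by (simp_all add: rot_sum_inv_eval)
      have kk: "(1 / ?k)\<^sup>2 * cnj ?s = ?s"
        unfolding kp(3)[symmetric] using kp(6) by (simp add: power_divide)
      have "cnj ?s * (1 - (1 / ?k) ^ 3) * (p0 + 1 / ?k * p1) = - (1 / ?k) * (?s * (1 - ?k ^ 3) * chi p y m)"
        using twisted_num_graded[OF eu y, of "1 / ?k"] kk twisted_num_comp(2)[OF y u kp(6) d] ch
        unfolding sg p0_def p1_def by simp
      moreover have "cnj ?s * (1 - (1 / ?k) ^ 3) = - (1 / ?k) * (?s * (1 - ?k ^ 3))"
        unfolding kp(3)[symmetric] using kp(6)
        by (simp add: field_simps power2_eq_square power3_eq_cube)
      ultimately have "- (1 / ?k) * (?s * (1 - ?k ^ 3)) * (p0 + 1 / ?k * p1)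
          = - (1 / ?k) * (?s * (1 - ?k ^ 3)) * chi p y m" by (simp only: mult.assoc)
      moreover have "- (1 / ?k) * (?s * (1 - ?k ^ 3)) \<noteq> 0" using kp(1,2,6) by simp
      ultimately have "p0 + 1 / ?k * p1 = chi p y m" by (simp only: mult_cancel_left) simp
      then have "?k * (p0 + 1 / ?k * p1) = ?k * chi p y m" by simp
      then show ?thesis using kp(6) by (simp add: distrib_left)
    qed
    finally show ?thesis using d by (simp add: parity_factor_def)
  qed
qed

text \<open>Since \<open>\<iota>(h x) + \<rho> = g\<^sup>-\<^sup>1(\<iota>(h)) + (\<iota>(x) + \<rho>)\<close>, where \<open>g\<close> is the finite part of \<open>x\<close>, each term of
  the closed formula for \<open>h x\<close> is a product of a term for \<open>x\<close> and a term of \<open>chi_twisted_by_weyl\<close>.\<close>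

lemma chi_mult:
  assumes p: "2 \<le> p" and m: "m \<in> E p" and y: "y \<in> aff_weyl 1" and x: "x \<in> aff_weyl 1"
  shows "(\<Sum>h\<in>iota_support y. of_int (mbar (iota y) (iota h)) * chi p (h \<circ> x) m) = chi p y m * chi p x m"
proof -
  let ?e = "eval_char p (m + rho)" and ?k = "twist_phase p m"
  let ?C = "rot_sum ?e * (1 - ?k ^ 3)"
  note kp = twist_phase_props[OF p m]
  obtain g l where g: "g \<in> weyl" "l \<in> root_lattice" "x = g \<circ> transl (- l)" using aff1E[OF x] .
  have fx: "fin_part x = g" unfolding g(3) by (rule fin_part_eq[OF g(1)])
  have summand: "of_int (wdet w) * (parity_factor ?k (w \<circ> fin_part (h \<circ> x)) * ?e (w (iota (h \<circ> x) + rho)))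
      = of_int (wdet w) * ?e (w (iota x + rho)) *
        (parity_factor ?k ((w \<circ> inv g) \<circ> fin_part h) * ?e ((w \<circ> inv g) (iota h)))"
    if h: "h \<in> aff_weyl 1" and w: "w \<in> weyl" for h w
  proof -
    obtain a c where a: "a \<in> weyl" "c \<in> root_lattice" "h = a \<circ> transl (- c)" using aff1E[OF h] .
    have fh: "fin_part h = a" unfolding a(3) by (rule fin_part_eq[OF a(1)])
    have hx: "h \<circ> x = (a \<circ> g) \<circ> transl (- (inv g c + l))" unfolding a(3) g(3) by (rule transl_comp[OF g(1)])
    have "fin_part (h \<circ> x) = a \<circ> g" unfolding hx by (rule fin_part_eq[OF weyl_comp[OF a(1) g(1)]])
    then have par: "wdet (w \<circ> fin_part (h \<circ> x)) = wdet ((w \<circ> inv g) \<circ> fin_part h)"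
      unfolding fh o_assoc[symmetric] using w g(1) a(1) weyl_inv[OF g(1)]
      by (simp only: wdet_comp weyl_comp wdet_inv) simp
    have "h \<circ> (g \<circ> transl (- smult 1 l)) = h \<circ> x" using g(3) by simp
    then have "iota (h \<circ> x) + rho = inv g (iota h + rho) + smult 3 l"
      using iota_comp[OF h g(1,2), of 1] by simp
    also have "\<dots> = inv g (iota h) + (iota x + rho)"
      unfolding g(3) iota_rho[OF g(1)] using weyl_inv[OF g(1)] by (simp add: weyl_linear add_ac)
    finally have "w (iota (h \<circ> x) + rho) = (w \<circ> inv g) (iota h) + w (iota x + rho)"
      using w by (simp only: weyl_linear comp_apply)
    then show ?thesis unfolding parity_factor_def par by (simp only: char_add[OF eval_char_char] ac_simps)
  qed
  have hx: "h \<circ> x \<in> aff_weyl 1" if "h \<in> iota_support y" for h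
    using that aff_weyl_comp x by (auto simp: iota_support_def)
  have "?C * (\<Sum>h\<in>iota_support y. of_int (mbar (iota y) (iota h)) * chi p (h \<circ> x) m)
      = (\<Sum>h\<in>iota_support y. of_int (mbar (iota y) (iota h)) * twisted_num (h \<circ> x) ?e ?k)"
    unfolding sum_distrib_left mult.left_commute[of ?C]
    using chi_twisted_num[OF p m hx] by (intro sum.cong) simp_all
  also have "\<dots> = (\<Sum>h\<in>iota_support y. \<Sum>w\<in>weyl. of_int (mbar (iota y) (iota h)) * (of_int (wdet w) * ?e (w (iota x + rho)) *
        (parity_factor ?k ((w \<circ> inv g) \<circ> fin_part h) * ?e ((w \<circ> inv g) (iota h)))))"
    unfolding twisted_num_def sum_distrib_left
    by (intro sum.cong refl arg_cong2[of _ _ _ _ "(*)"] summand) (simp_all add: iota_support_def)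
  also have "\<dots> = (\<Sum>w\<in>weyl. of_int (wdet w) * ?e (w (iota x + rho)) *
      (\<Sum>h\<in>iota_support y. of_int (mbar (iota y) (iota h)) *
        (parity_factor ?k ((w \<circ> inv g) \<circ> fin_part h) * ?e ((w \<circ> inv g) (iota h)))))"
    unfolding sum_distrib_left by (subst sum.swap) (simp only: mult.left_commute)
  also have "\<dots> = (\<Sum>w\<in>weyl. of_int (wdet w) * ?e (w (iota x + rho)) * (parity_factor ?k (w \<circ> inv g) * chi p y m))"
    using chi_twisted_by_weyl[OF p m y weyl_comp[OF _ weyl_inv[OF g(1)]]] by (intro sum.cong) simp_all
  also have "\<dots> = chi p y m * twisted_num x ?e ?k"
    unfolding twisted_num_def fx sum_distrib_left
  proof (rule sum.cong[OF refl])
    fix w assume "w \<in> weyl"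
    then have "parity_factor ?k (w \<circ> inv g) = parity_factor ?k (w \<circ> g)"
      using g(1) by (simp only: parity_factor_def wdet_comp wdet_inv)
    then show "of_int (wdet w) * ?e (w (iota x + rho)) * (parity_factor ?k (w \<circ> inv g) * chi p y m)
      = chi p y m * (of_int (wdet w) * (parity_factor ?k (w \<circ> g) * ?e (w (iota x + rho))))"
      by (simp only: ac_simps)
  qed
  also have "\<dots> = ?C * (chi p y m * chi p x m)"
    unfolding chi_twisted_num[OF p m x, symmetric] by (simp only: ac_simps)
  finally show ?thesis using kp(1,2) by simp
qed

text \<open>The substitution \<open>h = z w x\<^sup>-\<^sup>1\<close> is a bijection from pairs \<open>z \<in> Wplus p\<close>, \<open>w \<in> W\<^bsup>[p]\<^esup>\<close> to \<open>W\<close>,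
  and antisymmetry absorbs \<open>det w\<close> into \<open>\<chi>\<close>.\<close>

lemma fusion_eigen:
  assumes p: "2 \<le> p" and m: "m \<in> E p" and y: "y \<in> aff_weyl 1" and x: "x \<in> aff_weyl 1"
  shows "(\<Sum>z\<in>Wplus p. of_int (fusion p y x z) * chi p z m) = chi p y m * chi p x m"
proof -
  define S where "S z = {w \<in> aff_weyl p. mbar (iota y) (iota (z \<circ> w \<circ> inv x)) \<noteq> 0}" for z
  let ?f = "\<lambda>(z, w). z \<circ> w \<circ> inv x"
  note xi = aff_weyl_inv[OF x]
  have cancel: "z \<circ> w = h \<circ> x" if "z \<circ> w \<circ> inv x = h" for z w h :: "weight \<Rightarrow> weight"
  proof -
    have "h \<circ> x = z \<circ> w \<circ> (inv x \<circ> x)" unfolding that[symmetric] by (simp only: o_assoc)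
    then show ?thesis by (simp only: xi(3) o_id)
  qed
  have mem: "z \<circ> w \<circ> inv x \<in> aff_weyl 1" if "z \<in> Wplus p" "w \<in> aff_weyl p" for z w
    by (rule aff_weyl_comp[OF aff_weyl_comp[OF Wplus_aff[OF that(1)] aff_weyl_mono[OF that(2)]] xi(1)])
  have bij: "bij_betw ?f (Sigma (Wplus p) S) (iota_support y)"
    unfolding bij_betw_def
  proof
    show "inj_on ?f (Sigma (Wplus p) S)"
    proof (rule inj_onI, clarify)
      fix z w z' w'
      assume a: "z \<in> Wplus p" "w \<in> S z" "z' \<in> Wplus p" "w' \<in> S z'" and eq: "z \<circ> w \<circ> inv x = z' \<circ> w' \<circ> inv x"
      have e: "z \<circ> w = z' \<circ> w'" using cancel[OF eq] cancel[OF refl, of z' w'] by simp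
      have "w \<in> aff_weyl p" "w' \<in> aff_weyl p" using a(2,4) by (simp_all add: S_def)
      from Wplus_unique[OF p a(1,3) this e] show "z = z' \<and> w = w'" by simp
    qed
    show "?f ` Sigma (Wplus p) S = iota_support y"
    proof
      show "?f ` Sigma (Wplus p) S \<subseteq> iota_support y"
        using mem by (auto simp: S_def iota_support_def simp del: comp_apply)
      show "iota_support y \<subseteq> ?f ` Sigma (Wplus p) S"
      proof
        fix h assume h: "h \<in> iota_support y"
        then have "h \<circ> x \<in> aff_weyl 1" using aff_weyl_comp x by (auto simp: iota_support_def)
        then obtain z w where zw: "z \<in> Wplus p" "w \<in> aff_weyl p" "h \<circ> x = z \<circ> w" using Wplus_exists[OF p] by metis
        have "z \<circ> w \<circ> inv x = h" unfolding zw(3)[symmetric] o_assoc[symmetric] xi(2) by (rule o_id)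
        then have "(z, w) \<in> Sigma (Wplus p) S" "h = ?f (z, w)" using h zw by (simp_all add: S_def iota_support_def)
        then show "h \<in> ?f ` Sigma (Wplus p) S" by blast
      qed
    qed
  qed
  have fin: "finite (Sigma (Wplus p) S)" using bij_betw_finite[OF bij] finite_iota_support[OF y] by simp
  have finS: "finite (S z)" if "z \<in> Wplus p" for z
  proof (rule finite_subset[OF _ finite_imageI[OF fin, of snd]])
    show "S z \<subseteq> snd ` Sigma (Wplus p) S" using that by (auto simp: image_iff)
  qed
  have "(\<Sum>z\<in>Wplus p. of_int (fusion p y x z) * chi p z m)
      = (\<Sum>z\<in>Wplus p. \<Sum>w\<in>S z. of_int (mbar (iota y) (iota (?f (z, w)))) * chi p (?f (z, w) \<circ> x) m)"
  proof (rule sum.cong[OF refl])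
    fix z assume z: "z \<in> Wplus p"
    have "of_int (fusion p y x z) * chi p z m
        = (\<Sum>w\<in>S z. of_int (mbar (iota y) (iota (?f (z, w)))) * (of_int (wdet (fin_part w)) * chi p z m))"
      unfolding fusion_def S_def[symmetric] of_int_sum sum_distrib_right
      by (rule sum.cong) (simp_all del: comp_apply)
    also have "\<dots> = (\<Sum>w\<in>S z. of_int (mbar (iota y) (iota (?f (z, w)))) * chi p (?f (z, w) \<circ> x) m)"
    proof (rule sum.cong[OF refl])
      fix w assume "w \<in> S z"
      then have w: "w \<in> aff_weyl p" by (simp add: S_def)
      have "chi p (?f (z, w) \<circ> x) m = of_int (wdet (fin_part w)) * chi p z m"
        unfolding case_prod_conv cancel[OF refl, symmetric] by (rule chi_right[OF p m Wplus_aff[OF z] w])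
      then show "of_int (mbar (iota y) (iota (?f (z, w)))) * (of_int (wdet (fin_part w)) * chi p z m)
        = of_int (mbar (iota y) (iota (?f (z, w)))) * chi p (?f (z, w) \<circ> x) m" by (simp only:)
    qed
    finally show "of_int (fusion p y x z) * chi p z m
      = (\<Sum>w\<in>S z. of_int (mbar (iota y) (iota (?f (z, w)))) * chi p (?f (z, w) \<circ> x) m)" .
  qed
  also have "\<dots> = (\<Sum>q\<in>Sigma (Wplus p) S. of_int (mbar (iota y) (iota (?f q))) * chi p (?f q \<circ> x) m)"
    using finS by (subst sum.Sigma[OF finite_Wplus]) (auto intro!: sum.cong)
  also have "\<dots> = (\<Sum>h\<in>iota_support y. of_int (mbar (iota y) (iota h)) * chi p (h \<circ> x) m)"
    by (rule sum.reindex_bij_betw[OF bij, of "\<lambda>h. of_int (mbar (iota y) (iota h)) * chi p (h \<circ> x) m"])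
  also have "\<dots> = chi p y m * chi p x m" by (rule chi_mult[OF p m y x])
  finally show ?thesis .
qed

section \<open>Orthogonality\<close>

text \<open>The elements \<open>u t\<^sub>-\<^sub>l\<close> with \<open>l\<close> in a fundamental parallelogram of \<open>pQ\<close> represent the cosets of
  \<open>W\<close> modulo translations by \<open>pQ\<close>.\<close>

definition box_elem :: "(weight \<Rightarrow> weight) \<times> nat \<times> nat \<Rightarrow> weight \<Rightarrow> weight" where
  "box_elem = (\<lambda>(u, a, b). u \<circ> transl (- (smult (int a) alpha1 + smult (int b) alpha2)))"

definition box_index :: "int \<Rightarrow> (weight \<Rightarrow> weight) \<Rightarrow> (weight \<Rightarrow> weight) \<times> nat \<times> nat" where
  "box_index p y = (fin_part y, nat ((2 * fst (lat_part y) + snd (lat_part y)) div 3 mod p),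
     nat ((fst (lat_part y) + 2 * snd (lat_part y)) div 3 mod p))"

lemma root_coords:
  assumes "l = smult a alpha1 + smult b alpha2"
  shows "(2 * fst l + snd l) div 3 = a" "(fst l + 2 * snd l) div 3 = b"
proof -
  have "2 * fst l + snd l = a * 3" "fst l + 2 * snd l = b * 3"
    unfolding assms by (simp_all add: smult_def weight_defs)
  then show "(2 * fst l + snd l) div 3 = a" "(fst l + 2 * snd l) div 3 = b" by simp_all
qed

lemma alpha_root_lattice: "smult a alpha1 + smult b alpha2 \<in> root_lattice"
  by (auto simp: root_lattice_def)

lemma box_index_mem:
  assumes "0 < p" "y \<in> aff_weyl 1" shows "box_index p y \<in> weyl \<times> {..<nat p} \<times> {..<nat p}"
proof -
  have "fin_part y \<in> weyl" using aff1E[OF assms(2)] fin_part_eq by metis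
  then show ?thesis using assms(1) by (simp add: box_index_def nat_less_iff)
qed

lemma box_elem_aff:
  assumes "i \<in> weyl \<times> A" shows "box_elem i \<in> aff_weyl 1"
proof -
  obtain u a b where i: "i = (u, a, b)" "u \<in> weyl" using assms by (cases i) auto
  show ?thesis unfolding i(1) box_elem_def prod.case by (rule aff1I[OF i(2) alpha_root_lattice])
qed

lemma box_elem_index:
  assumes p: "0 < p" and y: "y \<in> aff_weyl 1"
  obtains c where "c \<in> root_lattice" "box_elem (box_index p y) = y \<circ> transl (- smult p c)"
proof -
  obtain g l where g: "g \<in> weyl" "l \<in> root_lattice" "y = g \<circ> transl (- l)" using aff1E[OF y] .
  obtain a b where ab: "l = smult a alpha1 + smult b alpha2" using g(2) by (auto simp: root_lattice_def)
  have i: "box_index p y = (g, nat (a mod p), nat (b mod p))"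
    unfolding box_index_def g(3) fin_part_eq[OF g(1)] lat_part_eq[OF g(1)] root_coords[OF ab] ..
  \<comment> \<open>the multiples of \<open>p\<close> removed by the reduction\<close>
  define c where "c = smult (- (a div p)) alpha1 + smult (- (b div p)) alpha2"
  have "smult (a mod p) alpha1 + smult (b mod p) alpha2 = l + smult p c"
    unfolding ab c_def by (simp add: smult_def weight_defs minus_mult_div_eq_mod[symmetric] algebra_simps)
  moreover have "int (nat (a mod p)) = a mod p" "int (nat (b mod p)) = b mod p" using p by simp_all
  ultimately have "box_elem (box_index p y) = g \<circ> transl (- (l + smult p c))"
    unfolding i box_elem_def prod.case by (simp only:)
  also have "\<dots> = y \<circ> transl (- smult p c)"
    unfolding g(3) by (auto simp: fun_eq_iff transl_def algebra_simps)
  finally show thesis using that alpha_root_lattice c_def by blast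
qed

lemma box_index_elem:
  assumes u: "u \<in> weyl" and ab: "a < nat p" "b < nat p" and y: "y \<in> aff_weyl 1" and c: "c \<in> root_lattice"
    and eq: "box_elem (u, a, b) = y \<circ> transl (- smult p c)"
  shows "box_index p y = (u, a, b)"
proof -
  obtain g l where g: "g \<in> weyl" "l \<in> root_lattice" "y = g \<circ> transl (- l)" using aff1E[OF y] .
  let ?l = "smult (int a) alpha1 + smult (int b) alpha2"
  obtain c1 c2 where cc: "c = smult c1 alpha1 + smult c2 alpha2" using c by (auto simp: root_lattice_def)
  have yc: "y \<circ> transl (- smult p c) = g \<circ> transl (- (l + smult p c))"
    unfolding g(3) by (auto simp: fun_eq_iff transl_def algebra_simps)
  have e: "u \<circ> transl (- ?l) = g \<circ> transl (- (l + smult p c))"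
    using eq unfolding yc by (simp add: box_elem_def)
  have ug: "u = g" using arg_cong[OF e, of fin_part] unfolding fin_part_eq[OF u] fin_part_eq[OF g(1)] .
  have "?l = l + smult p c" using arg_cong[OF e, of lat_part] unfolding lat_part_eq[OF u] lat_part_eq[OF g(1)] .
  then have "l = ?l - smult p c" by simp
  then have "l = smult (int a - p * c1) alpha1 + smult (int b - p * c2) alpha2"
    unfolding cc by (simp add: smult_def weight_defs algebra_simps)
  note r = root_coords[OF this]
  have "(int a - p * c1) mod p = int a" "(int b - p * c2) mod p = int b"
    using ab by (simp_all add: mod_diff_right_eq[symmetric])
  then show ?thesis
    unfolding box_index_def g(3) fin_part_eq[OF g(1)] lat_part_eq[OF g(1)] r ug by simp
qed

lemma transl_aff_weyl: "c \<in> root_lattice \<Longrightarrow> transl (- smult p c) \<in> aff_weyl p"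
  using affI[OF weyl_id, of c p] by (simp only: id_o)

lemma weyl_aff_weyl: "w \<in> weyl \<Longrightarrow> w \<in> aff_weyl p"
  using affI[of w 0 p] by (simp only: smult_0 minus_zero transl_zero o_id) (simp add: root_lattice_iff)

text \<open>The products \<open>z v\<close> with \<open>z \<in> Wplus p\<close> and \<open>v\<close> in the finite Weyl group are another set of
  representatives modulo \<open>pQ\<close>; reduction of the translation part identifies it with the box.\<close>

lemma Wplus_box_bij:
  assumes p: "2 \<le> p"
  shows "bij_betw (\<lambda>(z, v). box_index p (z \<circ> v)) (Wplus p \<times> weyl) (weyl \<times> {..<nat p} \<times> {..<nat p})"
  unfolding bij_betw_def
proof
  have p0: "0 < p" using p by simp
  have aff: "z \<circ> v \<in> aff_weyl 1" if "z \<in> Wplus p" "v \<in> weyl" for z v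
    by (rule aff_weyl_comp[OF Wplus_aff[OF that(1)] weyl_aff_weyl[OF that(2)]])
  show "inj_on (\<lambda>(z, v). box_index p (z \<circ> v)) (Wplus p \<times> weyl)"
  proof (rule inj_onI, clarify)
    fix z v z' v'
    assume a: "z \<in> Wplus p" "v \<in> weyl" "z' \<in> Wplus p" "v' \<in> weyl" and eq: "box_index p (z \<circ> v) = box_index p (z' \<circ> v')"
    obtain c where c: "c \<in> root_lattice" "box_elem (box_index p (z \<circ> v)) = z \<circ> v \<circ> transl (- smult p c)"
      using box_elem_index[OF p0 aff[OF a(1,2)]] .
    obtain d where d: "d \<in> root_lattice" "box_elem (box_index p (z' \<circ> v')) = z' \<circ> v' \<circ> transl (- smult p d)"
      using box_elem_index[OF p0 aff[OF a(3,4)]] .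
    have "z \<circ> (v \<circ> transl (- smult p c)) = z' \<circ> (v' \<circ> transl (- smult p d))"
      using c(2) d(2) eq by (simp only: o_assoc)
    note un = Wplus_unique[OF p a(1,3) affI[OF a(2) c(1)] affI[OF a(4) d(1)] this]
    have "v = v'" using arg_cong[OF un(2), of fin_part] unfolding fin_part_eq[OF a(2)] fin_part_eq[OF a(4)] .
    then show "z = z' \<and> v = v'" using un(1) by simp
  qed
  show "(\<lambda>(z, v). box_index p (z \<circ> v)) ` (Wplus p \<times> weyl) = weyl \<times> {..<nat p} \<times> {..<nat p}"
  proof
    show "(\<lambda>(z, v). box_index p (z \<circ> v)) ` (Wplus p \<times> weyl) \<subseteq> weyl \<times> {..<nat p} \<times> {..<nat p}"
    proof (rule image_subsetI)
      fix q assume "q \<in> Wplus p \<times> weyl"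
      then obtain z v where q: "q = (z, v)" "z \<in> Wplus p" "v \<in> weyl" by (rule SigmaE)
      show "(case q of (z, v) \<Rightarrow> box_index p (z \<circ> v)) \<in> weyl \<times> {..<nat p} \<times> {..<nat p}"
        unfolding q(1) prod.case by (rule box_index_mem[OF p0 aff[OF q(2,3)]])
    qed
    show "weyl \<times> {..<nat p} \<times> {..<nat p} \<subseteq> (\<lambda>(z, v). box_index p (z \<circ> v)) ` (Wplus p \<times> weyl)"
    proof
      fix i assume i: "i \<in> weyl \<times> {..<nat p} \<times> {..<nat p}"
      then obtain u a b where uab: "i = (u, a, b)" "u \<in> weyl" "a < nat p" "b < nat p" by auto
      obtain z v' where z: "z \<in> Wplus p" "v' \<in> aff_weyl p" "box_elem i = z \<circ> v'"
        using Wplus_exists[OF p box_elem_aff[OF i]] .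
      obtain v c where v: "v \<in> weyl" "c \<in> root_lattice" "v' = v \<circ> transl (- smult p c)" using affE[OF z(2)] .
      have "box_elem (u, a, b) = (z \<circ> v) \<circ> transl (- smult p c)" using z(3) v(3) uab(1) by (simp only: o_assoc)
      then have "i = (case (z, v) of (z, v) \<Rightarrow> box_index p (z \<circ> v))"
        unfolding uab(1) prod.case by (intro sym[OF box_index_elem[OF uab(2-4) aff[OF z(1) v(1)] v(2)]])
      then show "i \<in> (\<lambda>(z, v). box_index p (z \<circ> v)) ` (Wplus p \<times> weyl)" using z(1) v(1) by (rule image_eqI[OF _ SigmaI])
    qed
  qed
qed

lemma sum_Wplus_box:
  fixes f :: "(weight \<Rightarrow> weight) \<Rightarrow> complex"
  assumes p: "2 \<le> p" and inv: "\<And>y v. y \<in> aff_weyl 1 \<Longrightarrow> v \<in> aff_weyl p \<Longrightarrow> f (y \<circ> v) = f y"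
  shows "6 * (\<Sum>y\<in>Wplus p. f y) = (\<Sum>i\<in>weyl \<times> {..<nat p} \<times> {..<nat p}. f (box_elem i))"
proof -
  have p0: "0 < p" using p by simp
  have "(\<Sum>i\<in>weyl \<times> {..<nat p} \<times> {..<nat p}. f (box_elem i))
      = (\<Sum>q\<in>Wplus p \<times> weyl. f (box_elem (case q of (z, v) \<Rightarrow> box_index p (z \<circ> v))))"
    by (rule sum.reindex_bij_betw[OF Wplus_box_bij[OF p], symmetric])
  also have "\<dots> = (\<Sum>q\<in>Wplus p \<times> weyl. f (fst q))"
  proof (rule sum.cong[OF refl], clarify)
    fix z v assume a: "z \<in> Wplus p" "v \<in> weyl"
    have zv: "z \<circ> v \<in> aff_weyl 1" by (rule aff_weyl_comp[OF Wplus_aff[OF a(1)] weyl_aff_weyl[OF a(2)]])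
    obtain c where c: "c \<in> root_lattice" "box_elem (box_index p (z \<circ> v)) = z \<circ> v \<circ> transl (- smult p c)"
      using box_elem_index[OF p0 zv] .
    have "f (box_elem (box_index p (z \<circ> v))) = f (z \<circ> v)"
      unfolding c(2) by (rule inv[OF zv transl_aff_weyl[OF c(1)]])
    also have "\<dots> = f z" by (rule inv[OF Wplus_aff[OF a(1)] weyl_aff_weyl[OF a(2)]])
    finally show "f (box_elem (box_index p (z \<circ> v))) = f (fst (z, v))" by simp
  qed
  also have "\<dots> = (\<Sum>z\<in>Wplus p. \<Sum>v\<in>weyl. f z)"
    unfolding sum.cartesian_product by (rule sum.cong) auto
  also have "\<dots> = 6 * (\<Sum>z\<in>Wplus p. f z)" unfolding sum_constant card_weyl sum_distrib_left by simp
  finally show ?thesis by simp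
qed

lemma sum_roots_of_unity:
  assumes p: "0 < p"
  shows "(\<Sum>a<nat p. cis (2 * pi * of_int k / of_int p) ^ a) = (if p dvd k then of_int p else 0)"
proof -
  let ?z = "cis (2 * pi * of_int k / of_int p)"
  have "?z ^ nat p = cis (2 * pi * of_int k)" using p by (simp add: DeMoivre)
  also have "\<dots> = 1" by (rule cis_multiple_2pi) simp
  finally have zp: "?z ^ nat p = 1" .
  show ?thesis
  proof (cases "?z = 1")
    case True
    then show ?thesis using cis_period_dvd[OF p True] p by simp
  next
    case False
    have "\<not> p dvd k"
    proof
      assume "p dvd k"
      then obtain j where "k = p * j" by (rule dvdE)
      then have "2 * pi * of_int k / of_int p = 2 * pi * of_int j" using p by simp
      then have "?z = 1" by (simp only: cis_multiple_2pi Ints_of_int)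
      then show False using False by simp
    qed
    then show ?thesis using zp False by (simp add: sum_gp_strict)
  qed
qed

lemma eval_char_alpha:
  assumes p: "0 < p"
  shows "eval_char p x (smult 3 (smult (int a) alpha1 + smult (int b) alpha2))
    * cnj (eval_char p x' (smult 3 (smult (int a) alpha1 + smult (int b) alpha2)))
    = cis (2 * pi * of_int (fst x' - fst x) / of_int p) ^ a * cis (2 * pi * of_int (snd x' - snd x) / of_int p) ^ b"
proof -
  have "ip (smult 3 (smult (int a) alpha1 + smult (int b) alpha2)) v = 3 * (of_nat a * of_int (fst v) + of_nat b * of_int (snd v))" for v
    by (simp add: ip_def smult_def weight_defs algebra_simps)
  then show ?thesis
    unfolding eval_char_def using p
    by (simp add: cis_cnj cis_mult DeMoivre) (rule arg_cong[of _ _ cis], simp add: field_simps)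
qed

lemma eval_char_div:
  assumes p: "0 < p" and d: "x - x' = smult p d"
  shows "eval_char p x n * cnj (eval_char p x' n) = eval_char 1 d n"
proof -
  have "x = x' + smult p d" using d by (simp add: algebra_simps)
  then have "ip n x = ip n x' + of_int p * ip n d" by (simp add: ip_def smult_def field_simps)
  then show ?thesis unfolding eval_char_def using p
    by (simp add: cis_cnj cis_mult) (rule arg_cong[of _ _ cis], simp add: field_simps)
qed

lemma cis_int_third_cube: "cis (2 * pi * of_int k / 3) ^ 3 = 1"
proof -
  have "real 3 * (2 * pi * of_int k / 3) = 2 * pi * of_int k" by simp
  then show ?thesis unfolding DeMoivre by (simp only: cis_multiple_2pi Ints_of_int)
qed

text \<open>If \<open>d\<close> is outside the root lattice, the three values are the three different cube roots of
  unity.\<close>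

lemma rot_sum_third_zero:
  assumes d: "d \<notin> root_lattice" shows "rot_sum (eval_char 1 d) = 0"
proof -
  define x y z where "x = eval_char 1 d (- alpha1)" and "y = eval_char 1 d (- alpha2)" and "z = eval_char 1 d theta"
  have xyz: "z * x * y = 1" unfolding x_def y_def z_def by (rule char_values(1)[OF eval_char_char])
  have x: "x = cis (2 * pi * of_int (fst d) / 3)" and y: "y = cis (2 * pi * of_int (snd d) / 3)"
    unfolding x_def y_def eval_char_values by simp_all
  have x3: "x ^ 3 = 1" and y3: "y ^ 3 = 1"
    unfolding x y by (rule cis_int_third_cube)+
  have ne: "x \<noteq> y"
  proof
    assume "x = y"
    then have "x * cnj y = 1" unfolding y by (simp add: cis_cnj cis_mult)
    then have "cis (2 * pi * of_int (fst d - snd d) / of_int 3) = 1"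
      unfolding x y by (simp add: cis_cnj cis_mult diff_divide_distrib right_diff_distrib)
    then have "3 dvd fst d - snd d" by (rule cis_period_dvd[rotated]) simp
    then show False using d by (simp add: root_lattice_iff)
  qed
  have "(x - y) * (x\<^sup>2 + x * y + y\<^sup>2) = x ^ 3 - y ^ 3" by (simp add: power2_eq_square power3_eq_cube algebra_simps)
  then have q: "x\<^sup>2 + x * y + y\<^sup>2 = 0" using ne x3 y3 by simp
  have "x * y * (z + x + y) = z * x * y - x ^ 3 + x * (x\<^sup>2 + x * y + y\<^sup>2)"
    by (simp add: power2_eq_square power3_eq_cube algebra_simps)
  also have "\<dots> = 0" unfolding q xyz x3 by simp
  finally have "z + x + y = 0" using xyz by auto
  then show ?thesis by (simp add: rot_sum_def x_def y_def z_def)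
qed

text \<open>If \<open>d\<close> is in the root lattice, its pairings with \<open>\<theta>, -\<alpha>\<^sub>1, -\<alpha>\<^sub>2\<close> agree modulo \<open>3\<close>.\<close>

lemma eval_char_third:
  assumes d: "d \<in> root_lattice"
  obtains om where "om ^ 3 = 1" "cnj om * om = 1" "eval_char 1 d theta = om" "eval_char 1 d (- alpha1) = om"
    "eval_char 1 d (- alpha2) = om"
proof
  define om where "om = eval_char 1 d (- alpha1)"
  obtain k where k: "fst d - snd d = 3 * k" using d by (auto simp: root_lattice_iff mod_eq_0_iff_dvd)
  have om: "om = cis (2 * pi * of_int (fst d) / 3)" unfolding om_def eval_char_values by simp
  show "om ^ 3 = 1" unfolding om by (rule cis_int_third_cube)
  show "cnj om * om = 1" unfolding om by (simp add: cis_cnj cis_mult)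
  show "eval_char 1 d (- alpha1) = om" by (simp add: om_def)
  have shift: "cis (t + 2 * pi * of_int j) = cis t" for t j
    by (simp only: cis_mult[symmetric] cis_multiple_2pi Ints_of_int mult_1_right)
  have three: "3 * real_of_int 1 = 3" by simp
  have snd_d: "snd d = fst d - 3 * k" using k by simp
  have e: "2 * pi * of_int (snd d) / 3 = 2 * pi * of_int (fst d) / 3 + 2 * pi * of_int (- k)"
    "- 2 * pi * of_int (fst d + snd d) / 3 = 2 * pi * of_int (fst d) / 3 + 2 * pi * of_int (k - fst d)"
    unfolding snd_d by (simp_all add: field_simps)
  show "eval_char 1 d (- alpha2) = om" unfolding eval_char_values om three e(1) by (rule shift)
  show "eval_char 1 d theta = om" unfolding eval_char_values om three e(2) by (rule shift)
qed

lemma parity_sum: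
  assumes w: "w \<in> weyl" "w' \<in> weyl"
  shows "(\<Sum>u\<in>weyl. parity_factor k (w \<circ> u) * cnj (parity_factor k' (w' \<circ> u)) * e (u rho))
    = parity_factor k w * cnj (parity_factor k' w') * rot_sum e
      + (if wdet w = 1 then k else 1) * cnj (if wdet w' = 1 then k' else 1) * rot_sum (inv_char e)"
  unfolding parity_factor_def wdet_comp[OF w(1)] wdet_comp[OF w(2)]
  using wdet_cases[OF w(1)] wdet_cases[OF w(2)]
  by (auto simp: sum_weyl wdet_values rot_sum_def inv_char_def weight_defs algebra_simps)

text \<open>Write \<open>h, h'\<close> for the two images of \<open>\<mu> + \<rho>\<close> and \<open>\<mu>' + \<rho>\<close>, and \<open>q, q'\<close> for the phases with \<open>q
  s(h) = F(\<mu>)\<close> and \<open>q' s(h') = F(\<mu>')\<close>. If \<open>d\<close> is in the root lattice, then \<open>s(h) = \<omega> s(h')\<close> for a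
  cube root of unity \<open>\<omega>\<close>. Moreover the two points lie in different triangles by \<open>triangle_unique\<close>,
  so \<open>F(\<mu>') = - F(\<mu>)\<close>. Together these force \<open>q cnj(q') = - cnj \<omega>\<close>, which is what makes the
  contributions of the even and the odd elements cancel.\<close>

lemma parity_sum_zero:
  assumes p: "2 \<le> p" and m: "m \<in> E p" "m' \<in> E p" "m \<noteq> m'" and w: "w \<in> weyl" "w' \<in> weyl"
    and d: "inv w (m + rho) - inv w' (m' + rho) = smult p d"
  shows "(\<Sum>u\<in>weyl. parity_factor (twist_phase p m) (w \<circ> u) * cnj (parity_factor (twist_phase p m') (w' \<circ> u)) * eval_char 1 d (u rho)) = 0"
proof (cases "d \<in> root_lattice")
  case False
  then show ?thesis unfolding parity_sum[OF w] rot_sum_inv_eval by (simp add: rot_sum_third_zero)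
next
  case True
  have p0: "0 < p" using p by simp
  obtain om where om: "om ^ 3 = 1" "cnj om * om = 1" "eval_char 1 d theta = om" "eval_char 1 d (- alpha1) = om"
    "eval_char 1 d (- alpha2) = om" using eval_char_third[OF True] .
  have sd: "rot_sum (eval_char 1 d) = 3 * om" unfolding rot_sum_def om by simp
  have eps: "eps p m' = - eps p m"
  proof (rule ccontr)
    assume "\<not> ?thesis"
    then have same: "eps p m = eps p m'" by (auto simp: eps_def split: if_splits)
    have "w' (inv w' (m' + rho)) = w' (inv w (m + rho) - smult p d)" using d by (simp add: algebra_simps)
    then have "m' + rho = (w' \<circ> inv w) (m + rho) + smult p (- w' d)"
      using w(2) by (simp add: weyl_diff weyl_smult) (simp add: smult_def)
    then have "m = m'"
      by (rule triangle_unique[OF p m(1,2) weyl_comp[OF w(2) weyl_inv[OF w(1)]]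
            root_lattice_minus[OF weyl_root_lattice[OF w(2) True]] _ same])
    then show False using m(3) by simp
  qed
  define h h' where "h = inv w (m + rho)" and "h' = inv w' (m' + rho)"
  let ?s = "rot_sum (eval_char p h)" and ?s' = "rot_sum (eval_char p h')"
  define q q' where "q = (if wdet w = 1 then twist_phase p m else cnj (twist_phase p m))"
    and "q' = (if wdet w' = 1 then twist_phase p m' else cnj (twist_phase p m'))"
  \<comment> \<open>an odd element replaces \<open>s\<close> and \<open>\<kappa>\<close> by their conjugates and \<open>F\<close> is real\<close>
  have sgen: "(if wdet v = 1 then twist_phase p n else cnj (twist_phase p n)) * rot_sum (eval_char p (inv v (n + rho))) = F p n
      \<and> cmod (rot_sum (eval_char p (inv v (n + rho)))) = cmod (rot_sum (eval_char p (n + rho)))"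
    if v: "v \<in> weyl" and n: "n \<in> E p" for v n
  proof -
    have "eval_char p (inv v (n + rho)) = eval_char p (n + rho) \<circ> v"
      by (rule ext) (simp only: comp_apply eval_char_weyl[OF v])
    then have s: "rot_sum (eval_char p (inv v (n + rho)))
        = (if wdet v = 1 then rot_sum (eval_char p (n + rho)) else cnj (rot_sum (eval_char p (n + rho))))"
      unfolding rot_sum_inv_eval[symmetric] by (simp add: rot_sum_comp[OF v])
    have "cnj (F p n) = F p n" unfolding F_eq by (simp add: eps_def)
    then have "cnj (twist_phase p n) * cnj (rot_sum (eval_char p (n + rho))) = F p n"
      unfolding twist_phase_props(4)[OF p n] by simp
    then show ?thesis unfolding s using twist_phase_props(4)[OF p n] by simp
  qed
  have qs: "q * ?s = F p m" "q' * ?s' = F p m'" "cmod ?s = cmod (rot_sum (eval_char p (m + rho)))"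
    "cmod ?s' = cmod (rot_sum (eval_char p (m' + rho)))"
    using sgen[OF w(1) m(1)] sgen[OF w(2) m(2)] unfolding q_def q'_def h_def h'_def by auto
  have unit: "twist_phase p n * cnj (twist_phase p n) = 1" if "n \<in> E p" for n
    using twist_phase_props(5)[OF p that] by (simp add: complex_norm_square[symmetric])
  have q'1: "q' * cnj q' = 1" unfolding q'_def using unit[OF m(2)] by (auto simp: mult.commute)
  have mul: "eval_char p h n = eval_char 1 d n * eval_char p h' n" for n
  proof -
    have "eval_char p h' n * cnj (eval_char p h' n) = 1" by (simp add: eval_char_def cis_cnj cis_mult)
    then show ?thesis using eval_char_div[OF p0 d, folded h_def h'_def, of n, symmetric] by (simp add: ac_simps)
  qed
  have ss: "?s = om * ?s'" unfolding rot_sum_def mul om by (simp add: distrib_left)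
  have "cmod om = 1"
  proof -
    have "cmod om ^ 3 = 1" unfolding norm_power[symmetric] om(1) by simp
    then have "cmod om ^ 3 = 1 ^ 3" by simp
    then show ?thesis by (rule power_eq_imp_eq_base) simp_all
  qed
  then have "cmod ?s = cmod ?s'" unfolding ss by (simp add: norm_mult)
  then have "F p m' = - F p m" unfolding F_eq eps using qs(3,4) by simp
  then have "q' * ?s' = - (q * ?s)" by (simp only: qs(1,2))
  then have "q' * ?s' = - (q * om) * ?s'" unfolding ss by (simp add: mult.assoc)
  moreover have "?s' \<noteq> 0" using qs(4) twist_phase_props(1)[OF p m(2)] by auto
  ultimately have q'q: "q' = - (q * om)" by (metis mult_right_cancel)
  have qq: "q * cnj q' = - cnj om"
  proof -
    have "q = - q' * cnj om" unfolding q'q using om(2) by (simp add: mult.assoc) (simp add: mult.commute)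
    then have "q * cnj q' = - (q' * cnj q') * cnj om" by simp
    then show ?thesis unfolding q'1 by simp
  qed
  have flip: "(if wdet v = 1 then twist_phase p n else 1) = parity_factor (twist_phase p n) v * (if wdet v = 1 then twist_phase p n else cnj (twist_phase p n))"
    if "n \<in> E p" for v n
    using unit[OF that] by (simp add: parity_factor_def)
  have fw: "(if wdet w = 1 then twist_phase p m else 1) = parity_factor (twist_phase p m) w * q"
    "(if wdet w' = 1 then twist_phase p m' else 1) = parity_factor (twist_phase p m') w' * q'"
    unfolding q_def q'_def by (rule flip[OF m(1)], rule flip[OF m(2)])
  have "om + q * cnj q' * cnj om = 0"
  proof -
    have "cnj om = om\<^sup>2"
    proof -
      have "cnj om = cnj om * om ^ 3" unfolding om(1) by simp
      also have "\<dots> = (cnj om * om) * om\<^sup>2" by (simp add: power2_eq_square power3_eq_cube)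
      finally show ?thesis unfolding om(2) by simp
    qed
    then have "cnj om * cnj om = om ^ 3 * om" by (simp add: power2_eq_square power3_eq_cube)
    then show ?thesis unfolding qq om(1) by simp
  qed
  moreover have "(\<Sum>u\<in>weyl. parity_factor (twist_phase p m) (w \<circ> u) * cnj (parity_factor (twist_phase p m') (w' \<circ> u)) * eval_char 1 d (u rho))
    = 3 * parity_factor (twist_phase p m) w * cnj (parity_factor (twist_phase p m') w') * (om + q * cnj q' * cnj om)"
    unfolding parity_sum[OF w] rot_sum_inv_eval sd fw by (simp add: algebra_simps)
  ultimately show ?thesis by simp
qed

lemma box_sum:
  assumes p: "0 < p"
  shows "(\<Sum>(a, b)\<in>{..<nat p} \<times> {..<nat p}. eval_char p x (smult 3 (smult (int a) alpha1 + smult (int b) alpha2))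
      * cnj (eval_char p x' (smult 3 (smult (int a) alpha1 + smult (int b) alpha2))))
    = (if p dvd fst x' - fst x then of_int p else 0) * (if p dvd snd x' - snd x then of_int p else 0)"
  unfolding eval_char_alpha[OF p] sum.cartesian_product[symmetric] sum_product[symmetric] sum_roots_of_unity[OF p] ..

lemma twisted_num_box:
  assumes u: "u \<in> weyl"
  shows "twisted_num (u \<circ> transl (- l)) (eval_char p x) k = (\<Sum>w\<in>weyl. of_int (wdet w) *
    (parity_factor k (w \<circ> u) * eval_char p (inv w x) (inv u rho) * eval_char p (inv w x) (smult 3 l)))"
  unfolding twisted_num_def fin_part_eq[OF u] iota_rho[OF u]
  by (rule sum.cong) (simp_all add: eval_char_weyl char_add[OF eval_char_char] ac_simps del: comp_apply)

text \<open>For each pair of terms of the two alternating sums the sum over the box factors into a sum over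
  translations and a sum over the finite Weyl group. Either the first or the second factor
  vanishes.\<close>

lemma twisted_num_orthogonal:
  assumes p: "2 \<le> p" and m: "m \<in> E p" "m' \<in> E p" "m \<noteq> m'"
  shows "(\<Sum>i\<in>weyl \<times> {..<nat p} \<times> {..<nat p}. twisted_num (box_elem i) (eval_char p (m + rho)) (twist_phase p m)
    * cnj (twisted_num (box_elem i) (eval_char p (m' + rho)) (twist_phase p m'))) = 0"
proof -
  have p0: "0 < p" using p by simp
  let ?B = "{..<nat p} \<times> {..<nat p}"
  let ?l = "\<lambda>(a, b). smult (int a) alpha1 + smult (int b) alpha2"
  let ?e = "\<lambda>w. eval_char p (inv w (m + rho))" and ?e' = "\<lambda>w. eval_char p (inv w (m' + rho))"
  let ?P = "\<lambda>w u. parity_factor (twist_phase p m) (w \<circ> u)" and ?P' = "\<lambda>w u. parity_factor (twist_phase p m') (w \<circ> u)"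
  let ?G = "\<lambda>w w'. \<Sum>c\<in>?B. ?e w (smult 3 (?l c)) * cnj (?e' w' (smult 3 (?l c)))"
  let ?S = "\<lambda>w w'. \<Sum>u\<in>weyl. ?P w u * cnj (?P' w' u) * (?e w (inv u rho) * cnj (?e' w' (inv u rho)))"
  have factor: "(\<Sum>u\<in>U. \<Sum>c\<in>B. d * A c * P u) = d * (sum A B * sum P U)"
    for U :: "(weight \<Rightarrow> weight) set" and B :: "(nat \<times> nat) set" and d :: complex and A P
    by (subst sum.swap, subst sum_product) (simp only: sum_distrib_left mult.assoc)
  have zero: "?G w w' * ?S w w' = 0" if w: "w \<in> weyl" "w' \<in> weyl" for w w'
  proof (cases "p dvd fst (inv w' (m' + rho)) - fst (inv w (m + rho)) \<and> p dvd snd (inv w' (m' + rho)) - snd (inv w (m + rho))")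
    case False
    then show ?thesis using box_sum[OF p0, of "inv w (m + rho)" "inv w' (m' + rho)"] by (auto simp: case_prod_beta)
  next
    case True
    then obtain a b where ab: "fst (inv w' (m' + rho)) - fst (inv w (m + rho)) = p * a"
      "snd (inv w' (m' + rho)) - snd (inv w (m + rho)) = p * b" by (auto elim!: dvdE)
    define d where "d = (- a, - b)"
    have d: "inv w (m + rho) - inv w' (m' + rho) = smult p d"
      using ab by (simp add: d_def smult_def prod_eq_iff)
    have "?S w w' = (\<Sum>u\<in>weyl. ?P w u * cnj (?P' w' u) * eval_char 1 d (inv u rho))"
      unfolding eval_char_div[OF p0 d] ..
    also have "\<dots> = (\<Sum>u\<in>weyl. ?P w (inv u) * cnj (?P' w' (inv u)) * eval_char 1 d (u rho))"
      by (subst sum_weyl_inv[symmetric]) (auto intro!: sum.cong)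
    also have "\<dots> = (\<Sum>u\<in>weyl. ?P w u * cnj (?P' w' u) * eval_char 1 d (u rho))"
      by (rule sum.cong[OF refl]) (simp only: parity_factor_def wdet_comp[OF w(1)] wdet_comp[OF w(2)] wdet_inv)
    also have "\<dots> = 0" by (rule parity_sum_zero[OF p m w d])
    finally show ?thesis by simp
  qed
  have "(\<Sum>i\<in>weyl \<times> ?B. twisted_num (box_elem i) (eval_char p (m + rho)) (twist_phase p m)
    * cnj (twisted_num (box_elem i) (eval_char p (m' + rho)) (twist_phase p m')))
    = (\<Sum>u\<in>weyl. \<Sum>c\<in>?B. twisted_num (u \<circ> transl (- ?l c)) (eval_char p (m + rho)) (twist_phase p m)
    * cnj (twisted_num (u \<circ> transl (- ?l c)) (eval_char p (m' + rho)) (twist_phase p m')))"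
    unfolding sum.cartesian_product by (rule sum.cong) (auto simp: box_elem_def)
  also have "\<dots> = (\<Sum>u\<in>weyl. \<Sum>c\<in>?B. \<Sum>w\<in>weyl. \<Sum>w'\<in>weyl. of_int (wdet w * wdet w') *
      (?e w (smult 3 (?l c)) * cnj (?e' w' (smult 3 (?l c)))) *
      (?P w u * cnj (?P' w' u) * (?e w (inv u rho) * cnj (?e' w' (inv u rho)))))"
  proof (intro sum.cong refl)
    fix u c assume u: "u \<in> weyl"
    show "twisted_num (u \<circ> transl (- ?l c)) (eval_char p (m + rho)) (twist_phase p m)
        * cnj (twisted_num (u \<circ> transl (- ?l c)) (eval_char p (m' + rho)) (twist_phase p m'))
      = (\<Sum>w\<in>weyl. \<Sum>w'\<in>weyl. of_int (wdet w * wdet w') *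
        (?e w (smult 3 (?l c)) * cnj (?e' w' (smult 3 (?l c)))) *
        (?P w u * cnj (?P' w' u) * (?e w (inv u rho) * cnj (?e' w' (inv u rho)))))"
      unfolding twisted_num_box[OF u] cnj_sum sum_product
      by (intro sum.cong refl)
        (simp only: complex_cnj_mult complex_cnj_of_int of_int_mult ac_simps)
  qed
  also have "\<dots> = (\<Sum>u\<in>weyl. \<Sum>w\<in>weyl. \<Sum>w'\<in>weyl. \<Sum>c\<in>?B. of_int (wdet w * wdet w') *
      (?e w (smult 3 (?l c)) * cnj (?e' w' (smult 3 (?l c)))) *
      (?P w u * cnj (?P' w' u) * (?e w (inv u rho) * cnj (?e' w' (inv u rho)))))"
    by (rule sum.cong[OF refl], subst sum.swap, rule sum.cong[OF refl], rule sum.swap)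
  also have "\<dots> = (\<Sum>w\<in>weyl. \<Sum>w'\<in>weyl. \<Sum>u\<in>weyl. \<Sum>c\<in>?B. of_int (wdet w * wdet w') *
      (?e w (smult 3 (?l c)) * cnj (?e' w' (smult 3 (?l c)))) *
      (?P w u * cnj (?P' w' u) * (?e w (inv u rho) * cnj (?e' w' (inv u rho)))))"
    by (subst sum.swap, rule sum.cong[OF refl], rule sum.swap)
  also have "\<dots> = (\<Sum>w\<in>weyl. \<Sum>w'\<in>weyl. of_int (wdet w * wdet w') * (?G w w' * ?S w w'))"
    by (rule sum.cong[OF refl], rule sum.cong[OF refl], rule factor)
  also have "\<dots> = 0" using zero by (intro sum.neutral ballI) simp
  finally show ?thesis .
qed

lemma chi_orthogonal:
  assumes p: "2 \<le> p" and m: "m \<in> E p" "m' \<in> E p" "m \<noteq> m'"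
  shows "(\<Sum>y\<in>Wplus p. chi p y m * cnj (chi p y m')) = 0"
proof -
  define C where "C n = rot_sum (eval_char p (n + rho)) * (1 - twist_phase p n ^ 3)" for n
  have C: "C n \<noteq> 0" if "n \<in> E p" for n unfolding C_def using twist_phase_props(1,2)[OF p that] by simp
  let ?f = "\<lambda>y. chi p y m * cnj (chi p y m')"
  have inv: "?f (y \<circ> v) = ?f y" if "y \<in> aff_weyl 1" "v \<in> aff_weyl p" for y v
  proof -
    have "wdet (fin_part v) = 1 \<or> wdet (fin_part v) = - 1"
      using affE[OF that(2)] fin_part_eq wdet_cases by metis
    then show ?thesis unfolding chi_right[OF p m(1) that] chi_right[OF p m(2) that] by auto
  qed
  have s6: "6 * (\<Sum>y\<in>Wplus p. ?f y) = (\<Sum>i\<in>weyl \<times> {..<nat p} \<times> {..<nat p}. ?f (box_elem i))"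
    by (rule sum_Wplus_box[OF p inv])
  have "C m * cnj (C m') * (6 * (\<Sum>y\<in>Wplus p. ?f y))
      = (\<Sum>i\<in>weyl \<times> {..<nat p} \<times> {..<nat p}. (C m * chi p (box_elem i) m) * cnj (C m' * chi p (box_elem i) m'))"
    unfolding s6 unfolding sum_distrib_left complex_cnj_mult by (simp only: ac_simps)
  also have "\<dots> = (\<Sum>i\<in>weyl \<times> {..<nat p} \<times> {..<nat p}. twisted_num (box_elem i) (eval_char p (m + rho)) (twist_phase p m)
    * cnj (twisted_num (box_elem i) (eval_char p (m' + rho)) (twist_phase p m')))"
    unfolding C_def by (rule sum.cong) (simp_all only: chi_twisted_num[OF p m(1) box_elem_aff] chi_twisted_num[OF p m(2) box_elem_aff])
  also have "\<dots> = 0" by (rule twisted_num_orthogonal[OF p m])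
  finally show ?thesis using C[OF m(1)] C[OF m(2)] by simp
qed

section \<open>Linear independence\<close>

lemma chi_norm:
  assumes p: "2 \<le> p" and m: "m \<in> E p"
  shows "(\<Sum>y\<in>Wplus p. chi p y m * cnj (chi p y m)) \<noteq> 0"
proof -
  have "0 < (\<Sum>y\<in>Wplus p. (cmod (chi p y m))\<^sup>2)"
  proof (rule sum_pos2[OF finite_Wplus id_Wplus[OF p]])
    show "0 < (cmod (chi p id m))\<^sup>2" unfolding chi_one[OF p m] by simp
  qed simp
  moreover have "(\<Sum>y\<in>Wplus p. chi p y m * cnj (chi p y m)) = of_real (\<Sum>y\<in>Wplus p. (cmod (chi p y m))\<^sup>2)"
    unfolding complex_norm_square[symmetric] by simp
  ultimately show ?thesis by (simp only: of_real_eq_0_iff)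
qed

lemma finite_E: "finite (E p)"
proof (rule finite_subset)
  show "E p \<subseteq> {0..p} \<times> {0..p}" by (auto simp: E_iff rho_eq)
qed simp

lemma sum_fun_apply: "(\<Sum>a\<in>A. f a) x = (\<Sum>a\<in>A. (f a x :: complex))"
  by (induction A rule: infinite_finite_induct) simp_all

theorem corollary7p2:
  fixes p :: int
  assumes "2 \<le> p" and "\<not> 3 dvd p"
  shows "(\<forall>\<mu>\<in>E p. \<forall>\<mu>'\<in>E p. \<mu> \<noteq> \<mu>' \<longrightarrow>
            (\<Sum>y\<in>Wplus p. chi p y \<mu> * cnj (chi p y \<mu>')) = 0) \<and>
         inj_on (chi_vec p) (E p) \<and> cfun.independent (chi_vec p ` E p) \<and>
         (\<forall>\<mu>\<in>E p. chi_vec p \<mu> \<noteq> 0 \<and>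
            (\<forall>y\<in>Wplus p. \<forall>x\<in>Wplus p.
               fusion_matrix_mult p y (chi_vec p \<mu>) x = chi p y \<mu> * chi_vec p \<mu> x))"
proof (intro conjI ballI impI)
  note p = assms(1)
  show "(\<Sum>y\<in>Wplus p. chi p y m * cnj (chi p y m')) = 0" if "m \<in> E p" "m' \<in> E p" "m \<noteq> m'" for m m'
    by (rule chi_orthogonal[OF p that])
  show inj: "inj_on (chi_vec p) (E p)"
  proof (rule inj_onI, rule ccontr)
    fix m m' assume m: "m \<in> E p" "m' \<in> E p" "chi_vec p m = chi_vec p m'" "m \<noteq> m'"
    have "chi p y m = chi p y m'" if "y \<in> Wplus p" for y
      using fun_cong[OF m(3), of y] that by (simp add: chi_vec_def)
    then show False using chi_orthogonal[OF p m(1,2,4)] chi_norm[OF p m(2)] by simp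
  qed
  show "cfun.independent (chi_vec p ` E p)"
  proof (rule cfun.independent_if_scalars_zero)
    show "finite (chi_vec p ` E p)" using finite_E by simp
    fix f v assume z: "(\<Sum>x\<in>chi_vec p ` E p. cscale (f x) x) = 0" and v: "v \<in> chi_vec p ` E p"
    obtain m' where m': "m' \<in> E p" "v = chi_vec p m'" using v by auto
    have z': "(\<Sum>m\<in>E p. f (chi_vec p m) * chi p y m) = 0" if "y \<in> Wplus p" for y
      using fun_cong[OF z, of y] that unfolding sum.reindex[OF inj] sum_fun_apply
      by (simp add: cscale_def chi_vec_def)
    have "0 = (\<Sum>y\<in>Wplus p. (\<Sum>m\<in>E p. f (chi_vec p m) * chi p y m) * cnj (chi p y m'))"
      using z' by simp
    also have "\<dots> = (\<Sum>m\<in>E p. f (chi_vec p m) * (\<Sum>y\<in>Wplus p. chi p y m * cnj (chi p y m')))"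
      unfolding sum_distrib_right sum_distrib_left by (subst sum.swap) (simp only: mult.assoc)
    also have "\<dots> = (\<Sum>m\<in>E p. if m = m' then f v * (\<Sum>y\<in>Wplus p. chi p y m' * cnj (chi p y m')) else 0)"
      using chi_orthogonal[OF p _ m'(1)] m'(2) by (intro sum.cong) auto
    also have "\<dots> = f v * (\<Sum>y\<in>Wplus p. chi p y m' * cnj (chi p y m'))"
      using finite_E m'(1) by simp
    finally show "f v = 0" using chi_norm[OF p m'(1)] by simp
  qed
  fix m assume m: "m \<in> E p"
  have "chi_vec p m id = 1" using id_Wplus[OF p] chi_one[OF p m] by (simp add: chi_vec_def)
  then show "chi_vec p m \<noteq> 0" by auto
  fix y x assume yx: "y \<in> Wplus p" "x \<in> Wplus p"
  have "fusion_matrix_mult p y (chi_vec p m) x = (\<Sum>z\<in>Wplus p. of_int (fusion p y x z) * chi p z m)"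
    unfolding fusion_matrix_mult_def by (rule sum.cong) (simp_all add: chi_vec_def)
  also have "\<dots> = chi p y m * chi_vec p m x"
    using fusion_eigen[OF p m Wplus_aff[OF yx(1)] Wplus_aff[OF yx(2)]] yx by (simp add: chi_vec_def)
  finally show "fusion_matrix_mult p y (chi_vec p m) x = chi p y m * chi_vec p m x" .
qed

end
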